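(* Let $\theta_t:\mathbb{R}^{(m+1)n}\to\mathbb{C}$, $t>0$, satisfy the size and regularity conditions (K1)–(K3) of the context, with associated square function $S$. Suppose that for all $1<p_1,\dots,p_m<\infty$ with $\frac12=\sum_{i=1}^m\frac1{p_i}$, $S$ is bounded from $L^{p_1}\times\cdots\times L^{p_m}$ into $L^2$. Then for all $2\le p<\infty$ and $1<p_1,\dots,p_m<\infty$ with $\frac1p=\sum_{i=1}^m\frac1{p_i}$, $S$ is bounded from $L^{p_1}\times\cdots\times L^{p_m}$ into $L^p$.
   Context: $\Theta_t(f_1,\dots,f_m)(x)=\int_{\mathbb{R}^{mn}}\theta_t(x,y_1,\dots,y_m)\prod_{i=1}^m f_i(y_i)\,dy_1\cdots dy_m$ and $S(f_1,\dots,f_m)(x)=\left(\int_0^\infty|\Theta_t(f_1,\dots,f_m)(x)|^2\frac{dt}{t}\right)^{1/2}$. $S$ bounded from $L^{p_1}\times\cdots\times L^{p_m}$ into $L^p$ means $\|S(f_1,\dots,f_m)\|_{L^p}\le C\prod_i\|f_i\|_{L^{p_i}}$ for all $f_i\in L^{p_i}$, with $C$ independent of the $f_i$. Kernel conditions: there are constants $N>n$, $0<\gamma\le1$ and $A>0$ (independent of $t$ and of all points) such that for all $t>0$ and all $x,x',y_1,\dots,y_m,y_1',\dots,y_m'\in\mathbb{R}^n$: (K1) $|\theta_t(x,y_1,\dots,y_m)|\le A\,\dfrac{t^{-mn}}{\prod_{j=1}^m(1+t^{-1}|x-y_j|)^{N+\gamma}}$; (K2) for each $i=1,\dots,m$,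 $|\theta_t(x,y_1,\dots,y_m)-\theta_t(x,y_1,\dots,y_i',\dots,y_m)|\le A\,\dfrac{t^{-mn}(t^{-1}|y_i-y_i'|)^\gamma}{\prod_{j=1}^m(1+t^{-1}|x-y_j|)^{N+\gamma}}$; (K3) $|\theta_t(x,y_1,\dots,y_m)-\theta_t(x',y_1,\dots,y_m)|\le A\,\dfrac{t^{-mn}(t^{-1}|x-x'|)^\gamma}{\prod_{j=1}^m(1+t^{-1}|x-y_j|)^{N+\gamma}}$. *)

theory Defs
  imports "HOL-Analysis.Analysis"
begin

text \<open>
  Points of \<open>\<real>\<^sup>n\<close> have type \<^typ>\<open>real^'n\<close>, and an \<open>m\<close>-tuple of such points has type
  \<^typ>\<open>real^'n^'m\<close>, whose Lebesgue measure is the one on \<open>\<real>\<^sup>m\<^sup>n\<close>; thus \<open>n = CARD('n)\<close> and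
  \<open>m = CARD('m)\<close>.
\<close>

definition replace_coord :: "'a^'m \<Rightarrow> 'm \<Rightarrow> 'a \<Rightarrow> 'a^'m" where
  "replace_coord y i z = (\<chi> j. if j = i then z else y $ j)"

definition kernel_decay :: "real \<Rightarrow> real \<Rightarrow> real \<Rightarrow> real^'n \<Rightarrow> real^'n^'m \<Rightarrow> real" where
  "kernel_decay N \<gamma> t x y =
     1 / t ^ (CARD('m) * CARD('n)) / (\<Prod>j\<in>UNIV. (1 + norm (x - y $ j) / t) powr (N + \<gamma>))"

text \<open>
  The estimates imply that \<open>\<theta>\<^sub>t\<close> is continuous in the space variables but say nothing about the
  dependence on \<open>t\<close>. The first condition supplies the measurability in \<open>t\<close> without which the
  square function is undefined; with the estimates it yields joint measurability.
\<close>

definition square_function_kernel ::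
    "real \<Rightarrow> real \<Rightarrow> real \<Rightarrow> (real \<Rightarrow> real^'n \<Rightarrow> real^'n^'m \<Rightarrow> complex) \<Rightarrow> bool" where
  "square_function_kernel N \<gamma> A \<theta> \<longleftrightarrow>
     (\<forall>x y. (\<lambda>t. \<theta> t x y) \<in> borel_measurable (lebesgue_on {0<..})) \<and>
     (\<forall>t>0. \<forall>x y. norm (\<theta> t x y) \<le> A * kernel_decay N \<gamma> t x y) \<and>
     (\<forall>t>0. \<forall>x y i z. norm (\<theta> t x y - \<theta> t x (replace_coord y i z))
        \<le> A * (norm (y $ i - z) / t) powr \<gamma> * kernel_decay N \<gamma> t x y) \<and>
     (\<forall>t>0. \<forall>x x' y. norm (\<theta> t x y - \<theta> t x' y)
        \<le> A * (norm (x - x') / t) powr \<gamma> * kernel_decay N \<gamma> t x y)"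

definition Theta ::
    "(real \<Rightarrow> real^'n \<Rightarrow> real^'n^'m \<Rightarrow> complex) \<Rightarrow> real \<Rightarrow> ('m \<Rightarrow> real^'n \<Rightarrow> complex)
      \<Rightarrow> real^'n \<Rightarrow> complex" where
  "Theta \<theta> t f x = (\<integral>y. \<theta> t x y * (\<Prod>i\<in>UNIV. f i (y $ i)) \<partial>lebesgue)"

text \<open>Used for positive exponents only, so that \<open>\<infinity>\<close> to the power \<open>a\<close> is \<open>\<infinity>\<close>.\<close>

definition ennreal_powr :: "ennreal \<Rightarrow> real \<Rightarrow> ennreal" where
  "ennreal_powr u a = (if u = top then top else ennreal (enn2real u powr a))"

definition square_function ::
    "(real \<Rightarrow> real^'n \<Rightarrow> real^'n^'m \<Rightarrow> complex) \<Rightarrow> ('m \<Rightarrow> real^'n \<Rightarrow> complex)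
      \<Rightarrow> real^'n \<Rightarrow> ennreal" where
  "square_function \<theta> f x =
     ennreal_powr (\<integral>\<^sup>+t\<in>{0<..}. ennreal ((norm (Theta \<theta> t f x))\<^sup>2 / t) \<partial>lebesgue) (1/2)"

definition Lp_norm :: "real \<Rightarrow> (real^'n \<Rightarrow> ennreal) \<Rightarrow> ennreal" where
  "Lp_norm p g = ennreal_powr (\<integral>\<^sup>+x. ennreal_powr (g x) p \<partial>lebesgue) (1/p)"

definition in_Lp :: "real \<Rightarrow> (real^'n \<Rightarrow> complex) \<Rightarrow> bool" where
  "in_Lp p f \<longleftrightarrow> f \<in> borel_measurable lebesgue \<and> Lp_norm p (\<lambda>x. ennreal (norm (f x))) < top"

text \<open>
  For the kernels above and \<open>f\<^sub>i\<close> in \<open>L\<close>-spaces with exponents at least 1, measurability of the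
  square function is automatic; it is stated because the \<open>L\<^sup>p\<close> norm has its usual meaning for
  measurable functions only.
\<close>

definition square_function_bounded ::
    "(real \<Rightarrow> real^'n \<Rightarrow> real^'n^'m \<Rightarrow> complex) \<Rightarrow> ('m \<Rightarrow> real) \<Rightarrow> real \<Rightarrow> bool" where
  "square_function_bounded \<theta> ps p \<longleftrightarrow>
     (\<exists>C\<ge>0. \<forall>f. (\<forall>i. in_Lp (ps i) (f i)) \<longrightarrow>
        square_function \<theta> f \<in> borel_measurable lebesgue \<and>
        Lp_norm p (square_function \<theta> f)
          \<le> ennreal C * (\<Prod>i\<in>UNIV. Lp_norm (ps i) (\<lambda>x. ennreal (norm (f i x)))))"

end

theory Submission
  imports Defs
begin

text \<open>
  Put \<open>w\<^sub>i = p / p\<^sub>i\<close>, so that the \<open>w\<^sub>i\<close> sum to 1, and \<open>q\<^sub>i = 2 / w\<^sub>i\<close>. The hypothesis applies to the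
  exponents \<open>q\<^sub>i \<le> p\<^sub>i\<close>, and \<open>W = \<Prod>\<^sub>i (M(|f\<^sub>i|^q\<^sub>i))^w\<^sub>i\<close>, with \<open>M\<close> the Hardy--Littlewood maximal function,
  has \<open>L\<close>-norm with exponent \<open>p/2\<close> bounded by the product of the norms of the \<open>f\<^sub>i\<close>, squared, as soon as
  \<open>p > 2\<close>.

  Two facts relate \<open>S(f)\<close> to \<open>W\<close>. On a cube of size \<open>r\<close>, the part of \<open>S(f)\<^sup>2\<close> coming from the scales
  \<open>t < r\<close> has average at most a multiple of \<open>W\<close>: near the cube this is the hypothesis, and away from it
  the size condition gains a power of \<open>t/r\<close>. The part \<open>A\<^sub>r\<close> coming from the scales \<open>t \<ge> r\<close> satisfies
  \<open>A\<^sub>r(x) \<le> 2 A\<^sub>r(x') + C W(x)\<close> on the cube, by the regularity in \<open>x\<close>.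

  Let \<open>s = p/2\<close> and let \<open>D\<^sub>k\<close> be the part of \<open>S(f)\<^sup>2\<close> coming from the \<open>k\<close>-th dyadic scale. Telescoping gives
  \<open>(S\<^sup>2)^s \<le> s \<Sum>\<^sub>k A\<^sub>k^(s-1) D\<^sub>k\<close>. Replacing \<open>A\<^sub>k\<close> by its infimum over the cell and using Abel summation in
  \<open>k\<close> bounds the integral by \<open>C \<integral> (S\<^sup>2)^(s-1) W + C \<integral> W^(s-1) S\<^sup>2\<close>, and Young's inequality absorbs \<open>S\<close>. For
  the absorption the scales are truncated, which makes all integrals finite.
\<close>

section \<open>Powers of extended nonnegative reals and Hoelder's inequality\<close>

text \<open>With \<open>s = p / 2 > 1\<close> one has \<open>p\<^sub>i = s q\<^sub>i\<close>, so
  \<open>|f\<^sub>i|^q\<^sub>i\<close> lies in \<open>L^s\<close>, where M is bounded. For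
  \<open>p = 2\<close> this breaks down, but then the claim is the hypothesis. A function in the
  larger exponent need not lie in \<open>L^q\<^sub>i\<close>, so the hypothesis is applied only to
  cut-offs to balls; all else must come from the kernel.

  The obstacle is that a power of \<open>S^2\<close> varies inside a cell, while the local estimate
  compares integrals over whole cells. The coarse part is nearly constant there: it is at most twice
  its infimum plus an error in W at the same point, the 2 coming from the square of a sum. The
  infima increase with k, since cells shrink while \<open>A\<^sub>k\<close> grows, so the increments
  in the Abel summation are nonnegative. The error in W produces the term
  \<open>W^(s-1) S^2\<close>.

  Absorption subtracts a multiple of the very integral to be bounded, hence the concern for
  finiteness. The bound that shows finiteness may blow up with the truncation; the constant that
  absorption yields does not depend on it.\<close>

lemma ennreal_powr_ennreal: "0 \<le> x \<Longrightarrow> ennreal_powr (ennreal x) a = ennreal (x powr a)"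
  by (simp add: ennreal_powr_def)

lemma ennreal_powr_top [simp]: "ennreal_powr top a = top"
  by (simp add: ennreal_powr_def)

lemma ennreal_powr_0 [simp]: "ennreal_powr 0 a = 0"
  by (simp add: ennreal_powr_def)

lemma ennreal_powr_1 [simp]: "ennreal_powr u 1 = u"
  by (cases u) (auto simp: ennreal_powr_ennreal)

lemma ennreal_powr_one [simp]: "ennreal_powr 1 a = 1"
  by (simp add: ennreal_powr_def)

lemma ennreal_powr_2: "ennreal_powr u 2 = u ^ 2"
proof (cases u)
  case (real r)
  then show ?thesis by (simp add: ennreal_powr_ennreal ennreal_power)
qed (auto simp: power2_eq_square)

lemma ennreal_powr_eq_0_iff [simp]: "ennreal_powr u a = 0 \<longleftrightarrow> u = 0"
  by (cases u) (auto simp: ennreal_powr_ennreal ennreal_eq_0_iff)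

lemma ennreal_powr_eq_top_iff [simp]: "ennreal_powr u a = top \<longleftrightarrow> u = top"
  by (cases u) (auto simp: ennreal_powr_ennreal)

lemma ennreal_powr_less_top_iff [simp]: "ennreal_powr u a < top \<longleftrightarrow> u < top"
  by (simp add: less_top[symmetric])

lemma ennreal_powr_mono: "u \<le> v \<Longrightarrow> 0 \<le> a \<Longrightarrow> ennreal_powr u a \<le> ennreal_powr v a"
  by (cases u; cases v)
    (auto simp: ennreal_powr_ennreal top_unique intro!: ennreal_leI powr_mono2)

lemma ennreal_powr_mult: "ennreal_powr (u * v) a = ennreal_powr u a * ennreal_powr v a"
proof (cases "u = 0 \<or> v = 0")
  case False
  then show ?thesis
    by (cases u; cases v)
      (auto simp: ennreal_powr_ennreal ennreal_mult_top ennreal_top_mult ennreal_mult[symmetric] powr_mult)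
qed auto

lemma ennreal_powr_powr: "ennreal_powr (ennreal_powr u a) b = ennreal_powr u (a * b)"
  by (cases u) (auto simp: ennreal_powr_ennreal powr_powr)

lemma ennreal_powr_add: "ennreal_powr u (a + b) = ennreal_powr u a * ennreal_powr u b"
  by (cases u) (auto simp: ennreal_powr_ennreal powr_add ennreal_mult[symmetric])

lemma ennreal_powr_prod:
  "ennreal_powr (\<Prod>i\<in>I. g i) a = (\<Prod>i\<in>I. ennreal_powr (g i) a)"
  by (induction I rule: infinite_finite_induct) (auto simp: ennreal_powr_mult)

lemma ennreal_powr_le_cancel:
  assumes "ennreal_powr u a \<le> v" "0 < a"
  shows "u \<le> ennreal_powr v (1 / a)"
proof -
  have "u = ennreal_powr (ennreal_powr u a) (1 / a)"
    using assms by (simp add: ennreal_powr_powr)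
  also have "\<dots> \<le> ennreal_powr v (1 / a)"
    using assms by (intro ennreal_powr_mono) auto
  finally show ?thesis .
qed

lemma ennreal_powr_SUP_le:
  assumes "\<And>k. ennreal_powr (A k) a \<le> v" "0 < a"
  shows "ennreal_powr (SUP k. A k) a \<le> v"
proof -
  have "(SUP k. A k) \<le> ennreal_powr v (1 / a)"
    using assms by (intro SUP_least ennreal_powr_le_cancel) auto
  then have "ennreal_powr (SUP k. A k) a \<le> ennreal_powr (ennreal_powr v (1 / a)) a"
    using assms by (intro ennreal_powr_mono) auto
  then show ?thesis
    using assms by (simp add: ennreal_powr_powr)
qed

lemma ennreal_powr_add_le:
  assumes "0 \<le> a"
  shows "ennreal_powr (u + v) a \<le> ennreal (2 powr a) * (ennreal_powr u a + ennreal_powr v a)"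
proof -
  have "u + v \<le> ennreal 2 * max u v"
    by (metis add_mono ennreal_numeral max.cobounded1 max.cobounded2 mult_2)
  then have "ennreal_powr (u + v) a \<le> ennreal_powr (ennreal 2 * max u v) a"
    using assms by (intro ennreal_powr_mono)
  also have "\<dots> = ennreal (2 powr a) * ennreal_powr (max u v) a"
    by (simp add: ennreal_powr_mult ennreal_powr_ennreal del: ennreal_numeral)
  also have "\<dots> \<le> ennreal (2 powr a) * (ennreal_powr u a + ennreal_powr v a)"
    by (intro mult_left_mono) (auto simp: max_def add_increasing add_increasing2)
  finally show ?thesis .
qed

lemma borel_measurable_ennreal_powr [measurable (raw)]:
  assumes [measurable]: "g \<in> borel_measurable M"
  shows "(\<lambda>x. ennreal_powr (g x) a) \<in> borel_measurable M"
  unfolding ennreal_powr_def by measurable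

section \<open>Weighted AM-GM and Hoelder's inequality for finitely many factors\<close>

lemma weighted_am_gm:
  fixes w a :: "'i \<Rightarrow> real"
  assumes "finite I" "\<And>i. i \<in> I \<Longrightarrow> 0 < w i" "sum w I = 1" "\<And>i. i \<in> I \<Longrightarrow> 0 \<le> a i"
  shows "(\<Prod>i\<in>I. a i powr w i) \<le> (\<Sum>i\<in>I. w i * a i)"
proof (cases "\<exists>i\<in>I. a i = 0")
  case True
  then have "(\<Prod>i\<in>I. a i powr w i) = 0"
    using assms(1) by (auto intro!: prod_zero)
  then show ?thesis
    using assms(2,4) by (simp add: sum_nonneg less_imp_le)
next
  case False
  then have pos: "\<And>i. i \<in> I \<Longrightarrow> 0 < a i" using assms(4) by force
  have "(\<Prod>i\<in>I. a i powr w i) = exp (\<Sum>i\<in>I. w i *\<^sub>R ln (a i))"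
    using assms(1) pos by (subst exp_sum) (auto intro!: prod.cong simp: powr_def dest: pos)
  also have "\<dots> \<le> (\<Sum>i\<in>I. w i * exp (ln (a i)))"
    using assms by (intro convex_on_sum[OF _ _ exp_convex]) (auto simp: less_imp_le)
  also have "\<dots> = (\<Sum>i\<in>I. w i * a i)"
    using pos by (auto intro!: sum.cong)
  finally show ?thesis .
qed

lemma ennreal_weighted_am_gm:
  assumes "finite I" "\<And>i. i \<in> I \<Longrightarrow> 0 < w i" "sum w I = 1"
  shows "(\<Prod>i\<in>I. ennreal_powr (a i) (w i)) \<le> (\<Sum>i\<in>I. ennreal (w i) * a i)"
proof (cases "\<exists>i\<in>I. a i = top")
  case True
  then obtain j where j: "j \<in> I" "a j = top" by auto
  have "top = ennreal (w j) * a j"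
    using j assms(2)[of j] by (simp add: ennreal_mult_top)
  also have "\<dots> \<le> (\<Sum>i\<in>I. ennreal (w i) * a i)"
    by (rule member_le_sum) (use j assms(1) in auto)
  finally show ?thesis by (simp add: top_unique)
next
  case False
  define b where "b i = enn2real (a i)" for i
  have a: "i \<in> I \<Longrightarrow> a i = ennreal (b i)" for i
    using False by (auto simp: b_def less_top)
  have b: "0 \<le> b i" for i by (simp add: b_def)
  have "(\<Prod>i\<in>I. ennreal_powr (a i) (w i)) = ennreal (\<Prod>i\<in>I. b i powr w i)"
    by (subst prod_ennreal[symmetric]) (auto intro!: prod.cong simp: a b ennreal_powr_ennreal)
  also have "\<dots> \<le> ennreal (\<Sum>i\<in>I. w i * b i)"
    using assms b by (intro ennreal_leI weighted_am_gm) auto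
  also have "\<dots> = (\<Sum>i\<in>I. ennreal (w i) * a i)"
    using assms b
    by (subst sum_ennreal[symmetric]) (auto intro!: sum.cong simp: a ennreal_mult less_imp_le)
  finally show ?thesis .
qed

text \<open>Hoelder's inequality with exponents \<open>1 / w i\<close>, where \<open>g i\<close>
  stands for the factor already raised to its exponent. Once every \<open>g i\<close> is divided by
  its integral, the pointwise weighted AM-GM inequality integrates to 1.\<close>

lemma nn_integral_prod_powr_le:
  assumes I: "finite I" "\<And>i. i \<in> I \<Longrightarrow> 0 < w i" "sum w I = (1::real)"
    and g [measurable]: "\<And>i. i \<in> I \<Longrightarrow> g i \<in> borel_measurable M"
  shows "(\<integral>\<^sup>+x. (\<Prod>i\<in>I. ennreal_powr (g i x) (w i)) \<partial>M) \<le> (\<Prod>i\<in>I. ennreal_powr (\<integral>\<^sup>+x. g i x \<partial>M) (w i))"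
proof -
  define c where "c i = (\<integral>\<^sup>+x. g i x \<partial>M)" for i
  \<comment> \<open>Zero comes first: as \<open>0 * top = 0\<close>, an infinite integral makes the
    right-hand side infinite only if no other integral vanishes.\<close>
  consider (zero) i where "i \<in> I" "c i = 0"
    | (top) i where "i \<in> I" "c i = top" "\<And>j. j \<in> I \<Longrightarrow> c j \<noteq> 0"
    | (pos) "\<And>i. i \<in> I \<Longrightarrow> c i \<noteq> 0 \<and> c i \<noteq> top"
    by blast
  then show ?thesis
  proof cases
    case zero
    then have "AE x in M. g i x = 0"
      using g by (simp add: c_def nn_integral_0_iff_AE)
    then have "AE x in M. (\<Prod>i\<in>I. ennreal_powr (g i x) (w i)) = 0"
      by eventually_elim (use zero I(1) in \<open>auto intro!: prod_zero\<close>)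
    then have "(\<integral>\<^sup>+x. (\<Prod>i\<in>I. ennreal_powr (g i x) (w i)) \<partial>M) = 0"
      by (subst nn_integral_cong_AE[where v="\<lambda>_. 0"]) auto
    then show ?thesis by simp
  next
    case top
    then have "(\<Prod>i\<in>I. ennreal_powr (c i) (w i)) = top"
      using I by (auto simp: ennreal_prod_eq_top)
    then show ?thesis by (simp add: c_def)
  next
    case pos
    define K where "K = (\<Prod>i\<in>I. ennreal_powr (c i) (w i))"
    have "(\<integral>\<^sup>+x. (\<Prod>i\<in>I. ennreal_powr (g i x) (w i)) \<partial>M)
        \<le> (\<integral>\<^sup>+x. K * (\<Sum>i\<in>I. ennreal (w i) * (g i x / c i)) \<partial>M)"
    proof (rule nn_integral_mono)
      fix x
      have "(\<Prod>i\<in>I. ennreal_powr (g i x) (w i)) = (\<Prod>i\<in>I. ennreal_powr (c i * (g i x / c i)) (w i))"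
        using pos by (intro prod.cong refl arg_cong2[where f=ennreal_powr])
          (simp add: ennreal_times_divide mult.commute[of "c _"] mult_divide_eq_ennreal)
      also have "\<dots> = K * (\<Prod>i\<in>I. ennreal_powr (g i x / c i) (w i))"
        by (simp add: K_def ennreal_powr_mult prod.distrib)
      also have "\<dots> \<le> K * (\<Sum>i\<in>I. ennreal (w i) * (g i x / c i))"
        using I by (intro mult_left_mono ennreal_weighted_am_gm) auto
      finally show "(\<Prod>i\<in>I. ennreal_powr (g i x) (w i)) \<le> \<dots>" .
    qed
    also have "\<dots> = K * (\<Sum>i\<in>I. ennreal (w i) * (c i / c i))"
      by (simp add: nn_integral_cmult nn_integral_sum nn_integral_divide c_def)
    also have "(\<Sum>i\<in>I. ennreal (w i) * (c i / c i)) = (\<Sum>i\<in>I. ennreal (w i))"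
      using pos by (intro sum.cong) (auto simp: ennreal_divide_self less_top[symmetric])
    also have "\<dots> = 1"
      using I by (subst sum_ennreal) (auto simp: less_imp_le)
    finally show ?thesis by (simp add: K_def c_def)
  qed
qed

section \<open>Lebesgue measure on tuples of points\<close>

lemma measurable_vec_nth [measurable]: "(\<lambda>y::'a::real_normed_vector^'m. y $ i) \<in> borel \<rightarrow>\<^sub>M borel"
  by (intro borel_measurable_continuous_onI continuous_intros)

lemma measurable_vec_lambda:
  "vec_lambda \<in> Pi\<^sub>M UNIV (\<lambda>_::'m::finite. (lborel :: 'a::euclidean_space measure)) \<rightarrow>\<^sub>M borel"
proof (subst borel_measurable_euclidean_space, rule ballI)
  fix b :: "'a^'m" assume "b \<in> Basis"
  then obtain i u where b: "b = axis i u"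
    by (auto simp: Basis_vec_def)
  have "(\<lambda>x::'m \<Rightarrow> 'a. x i \<bullet> u) \<in> borel_measurable (Pi\<^sub>M UNIV (\<lambda>_. lborel))"
    by measurable
  then show "(\<lambda>x. vec_lambda x \<bullet> b) \<in> borel_measurable (Pi\<^sub>M UNIV (\<lambda>_. (lborel :: 'a measure)))"
    by (simp add: b inner_axis)
qed

lemma prod_Basis_vec:
  "(\<Prod>b\<in>(Basis :: ('a::euclidean_space^'m) set). F b) = (\<Prod>i\<in>UNIV. \<Prod>u\<in>Basis. F (axis i u))"
proof -
  have inj: "inj_on (\<lambda>(i, u). axis i u) (UNIV \<times> Basis :: ('m \<times> 'a) set)"
  proof (rule inj_onI, clarify)
    fix i j :: 'm and u v :: 'a
    assume "u \<in> Basis" "v \<in> Basis" "axis i u = axis j v"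
    then show "i = j \<and> u = v" by (auto simp: axis_eq_axis)
  qed
  have eq: "Basis = (\<lambda>(i, u). axis i u) ` (UNIV \<times> Basis :: ('m \<times> 'a) set)"
    by (auto simp: Basis_vec_def)
  have "(\<Prod>b\<in>(Basis :: ('a^'m) set). F b) = (\<Prod>(i, u)\<in>UNIV \<times> Basis. F (axis i u))"
    using arg_cong[where f="prod F", OF eq]
    by (rule trans) (subst prod.reindex[OF inj], simp add: o_def case_prod_unfold)
  then show ?thesis
    by (simp add: prod.cartesian_product)
qed

text \<open>Lebesgue measure is determined by its values on boxes, and a box of tuples is a product
  of boxes. This lets an integral of a product over all m variables split into m integrals.\<close>

lemma lborel_vec_eq:
  "(lborel :: ('a::euclidean_space^'m) measure) = distr (Pi\<^sub>M UNIV (\<lambda>_::'m. (lborel :: 'a measure))) borel vec_lambda"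
proof (rule lborel_eqI)
  interpret product_sigma_finite "\<lambda>_::'m. (lborel :: 'a measure)" ..
  fix l u :: "'a^'m"
  assume le: "\<And>b. b \<in> Basis \<Longrightarrow> l \<bullet> b \<le> u \<bullet> b"
  have le': "l $ i \<bullet> b \<le> u $ i \<bullet> b" if "b \<in> Basis" for i b
    using le[of "axis i b"] that by (simp add: inner_axis)
  have vimage: "vec_lambda -` box l u \<inter> space (Pi\<^sub>M UNIV (\<lambda>_::'m. (lborel :: 'a measure)))
      = Pi\<^sub>E UNIV (\<lambda>i. box (l $ i) (u $ i))"
    by (auto simp: space_PiM box_def Basis_vec_def inner_axis PiE_def Pi_def)
  have "emeasure (distr (Pi\<^sub>M UNIV (\<lambda>_::'m. (lborel :: 'a measure))) borel vec_lambda) (box l u)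
      = (\<Prod>i\<in>UNIV. emeasure lborel (box (l $ i) (u $ i)))"
    by (subst emeasure_distr[OF measurable_vec_lambda], simp, subst vimage, subst emeasure_PiM) auto
  also have "\<dots> = ennreal (\<Prod>i\<in>UNIV. \<Prod>b\<in>Basis. (u $ i - l $ i) \<bullet> b)"
    using le' by (subst prod_ennreal[symmetric])
      (auto intro!: prod.cong prod_nonneg simp: emeasure_lborel_box inner_diff_left)
  also have "(\<Prod>i\<in>UNIV. \<Prod>b\<in>Basis. (u $ i - l $ i) \<bullet> b) = (\<Prod>b\<in>Basis. (u - l) \<bullet> b)"
    by (simp add: prod_Basis_vec inner_axis)
  finally show "emeasure (distr (Pi\<^sub>M UNIV (\<lambda>_::'m. (lborel :: 'a measure))) borel vec_lambda) (box l u)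
      = (\<Prod>b\<in>Basis. (u - l) \<bullet> b)" .
qed auto

lemma nn_integral_prod_vec:
  fixes g :: "'m::finite \<Rightarrow> 'a::euclidean_space \<Rightarrow> ennreal"
  assumes [measurable]: "\<And>i. g i \<in> borel_measurable borel"
  shows "(\<integral>\<^sup>+y. (\<Prod>i\<in>UNIV. g i (y $ i)) \<partial>(lborel :: ('a^'m) measure)) = (\<Prod>i\<in>UNIV. \<integral>\<^sup>+x. g i x \<partial>lborel)"
proof -
  interpret product_sigma_finite "\<lambda>_::'m. (lborel :: 'a measure)" ..
  have "(\<integral>\<^sup>+y. (\<Prod>i\<in>UNIV. g i (y $ i)) \<partial>(lborel :: ('a^'m) measure))
      = (\<integral>\<^sup>+y. (\<Prod>i\<in>UNIV. g i (y i)) \<partial>Pi\<^sub>M UNIV (\<lambda>_::'m. (lborel :: 'a measure)))"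
    by (subst lborel_vec_eq, subst nn_integral_distr[OF measurable_vec_lambda]) auto
  also have "\<dots> = (\<Prod>i\<in>UNIV. \<integral>\<^sup>+x. g i x \<partial>lborel)"
    by (subst product_nn_integral_prod) auto
  finally show ?thesis .
qed

text \<open>The cylinder over a null set is null even though its other m - 1 sides have infinite
  measure, because \<open>0 * top = 0\<close>. This is why \<open>Theta\<close> ignores changes of
  the functions on null sets.\<close>

lemma AE_vec_nth:
  assumes "AE x in (lborel :: 'a::euclidean_space measure). P x"
  shows "AE y in (lborel :: ('a^'m) measure). P (y $ i)"
proof -
  obtain Z where Z: "{x. \<not> P x} \<subseteq> Z" "Z \<in> null_sets lborel"
    using assms by (auto simp: eventually_ae_filter)
  then have [measurable]: "Z \<in> sets borel" by (auto simp: null_sets_def)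
  have "emeasure (lborel :: ('a^'m) measure) {y. y $ i \<in> Z}
      = (\<integral>\<^sup>+y. (\<Prod>j\<in>UNIV. (if j = i then indicator Z (y $ j) else 1)) \<partial>lborel)"
  proof -
    have "(\<Prod>j\<in>UNIV. (if j = i then indicator Z (y $ j) else 1)) = (indicator {y. y $ i \<in> Z} y :: ennreal)"
      for y :: "'a^'m"
      by (simp add: indicator_def)
    then show ?thesis by simp
  qed
  also have "\<dots> = (\<Prod>j\<in>UNIV. \<integral>\<^sup>+x. (if j = i then indicator Z x else 1) \<partial>(lborel :: 'a measure))"
    by (rule nn_integral_prod_vec) measurable
  also have "\<dots> = 0"
    using Z by (intro prod_zero bexI[of _ i]) (auto simp: null_sets_def)
  finally have "{y::'a^'m. y $ i \<in> Z} \<in> null_sets lborel"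
    by (auto simp: null_sets_def)
  then show ?thesis
    using Z by (auto intro!: AE_I'[of "{y. y $ i \<in> Z}"])
qed

section \<open>The Hardy--Littlewood maximal function\<close>

text \<open>The uncentred maximal function: the supremum runs over all open balls containing z,
  whatever their centres. This makes its superlevel sets open, and a ball about x can be charged to
  any other point z in it.\<close>

definition hl_maximal :: "('a::euclidean_space \<Rightarrow> ennreal) \<Rightarrow> 'a \<Rightarrow> ennreal" where
  "hl_maximal g z = (SUP (x, \<rho>)\<in>{(x, \<rho>). dist x z < \<rho>}.
     (\<integral>\<^sup>+y\<in>ball x \<rho>. g y \<partial>lborel) / emeasure lborel (ball x \<rho>))"

lemma emeasure_ball_pos_finite:
  fixes x :: "'a::euclidean_space"
  assumes "0 < \<rho>"
  shows "emeasure lborel (ball x \<rho>) \<noteq> 0" "emeasure lborel (ball x \<rho>) \<noteq> top"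
  using assms by (simp_all add: emeasure_ball less_imp_le ennreal_eq_0_iff not_le)

lemma nn_integral_ball_le_hl_maximal:
  fixes g :: "'a::euclidean_space \<Rightarrow> ennreal"
  assumes "dist x z < \<rho>"
  shows "(\<integral>\<^sup>+y\<in>ball x \<rho>. g y \<partial>lborel) \<le> emeasure lborel (ball x \<rho>) * hl_maximal g z"
proof -
  have pos: "0 < \<rho>" using assms zero_le_dist[of x z] by linarith
  have "(\<integral>\<^sup>+y\<in>ball x \<rho>. g y \<partial>lborel) / emeasure lborel (ball x \<rho>) \<le> hl_maximal g z"
    unfolding hl_maximal_def using assms
    by (intro SUP_upper2[of "(x, \<rho>)"]) auto
  then have "emeasure lborel (ball x \<rho>) * ((\<integral>\<^sup>+y\<in>ball x \<rho>. g y \<partial>lborel) / emeasure lborel (ball x \<rho>))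
      \<le> emeasure lborel (ball x \<rho>) * hl_maximal g z"
    by (rule mult_left_mono) simp
  also have "emeasure lborel (ball x \<rho>) * ((\<integral>\<^sup>+y\<in>ball x \<rho>. g y \<partial>lborel) / emeasure lborel (ball x \<rho>))
      = (\<integral>\<^sup>+y\<in>ball x \<rho>. g y \<partial>lborel)"
    using emeasure_ball_pos_finite[OF pos, of x]
    by (simp add: ennreal_times_divide mult.commute[of "emeasure _ _"] mult_divide_eq_ennreal)
  finally show ?thesis .
qed

text \<open>The union of balls gives both the openness of the set, hence measurability, and the
  family to be thinned out by Vitali's covering lemma.\<close>

lemma hl_maximal_superlevel:
  fixes g :: "'a::euclidean_space \<Rightarrow> ennreal"
  shows "{z. \<alpha> < hl_maximal g z} =
    (\<Union>(x, \<rho>)\<in>{(x, \<rho>). 0 < \<rho> \<and> \<alpha> * emeasure lborel (ball x \<rho>) < (\<integral>\<^sup>+y\<in>ball x \<rho>. g y \<partial>lborel)}. ball x \<rho>)"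
proof -
  have *: "\<alpha> < (\<integral>\<^sup>+y\<in>ball x \<rho>. g y \<partial>lborel) / emeasure lborel (ball x \<rho>)
      \<longleftrightarrow> \<alpha> * emeasure lborel (ball x \<rho>) < (\<integral>\<^sup>+y\<in>ball x \<rho>. g y \<partial>lborel)" if "0 < \<rho>" for x \<rho>
  proof -
    let ?e = "emeasure lborel (ball x \<rho>)" and ?J = "\<integral>\<^sup>+y\<in>ball x \<rho>. g y \<partial>lborel"
    note e = emeasure_ball_pos_finite[OF that, of x]
    have "?J / ?e \<le> \<alpha> \<longleftrightarrow> ?J \<le> \<alpha> * ?e"
    proof
      assume "?J / ?e \<le> \<alpha>"
      then have "?J / ?e * ?e \<le> \<alpha> * ?e" by (rule mult_right_mono) simp
      moreover have "?J / ?e * ?e = ?J"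
        using e by (simp add: ennreal_divide_times ennreal_divide_self less_top[symmetric])
      ultimately show "?J \<le> \<alpha> * ?e" by simp
    next
      assume "?J \<le> \<alpha> * ?e"
      then have "?J / ?e \<le> \<alpha> * ?e / ?e" by (rule divide_right_mono_ennreal)
      then show "?J / ?e \<le> \<alpha>" using e by (simp add: mult_divide_eq_ennreal)
    qed
    then show ?thesis by (simp add: not_le[symmetric])
  qed
  show ?thesis
  proof safe
    fix z assume "\<alpha> < hl_maximal g z"
    then obtain x \<rho> where "dist x z < \<rho>"
      "\<alpha> < (\<integral>\<^sup>+y\<in>ball x \<rho>. g y \<partial>lborel) / emeasure lborel (ball x \<rho>)"
      unfolding hl_maximal_def less_SUP_iff by auto
    moreover from this have "0 < \<rho>" using zero_le_dist[of x z] by linarith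
    ultimately show "z \<in> (\<Union>(x, \<rho>)\<in>{(x, \<rho>). 0 < \<rho> \<and>
        \<alpha> * emeasure lborel (ball x \<rho>) < (\<integral>\<^sup>+y\<in>ball x \<rho>. g y \<partial>lborel)}. ball x \<rho>)"
      using * by auto
  next
    fix z x \<rho> assume "0 < \<rho>" "\<alpha> * emeasure lborel (ball x \<rho>) < (\<integral>\<^sup>+y\<in>ball x \<rho>. g y \<partial>lborel)" "z \<in> ball x \<rho>"
    then show "\<alpha> < hl_maximal g z"
      using * unfolding hl_maximal_def less_SUP_iff by (auto intro!: bexI[of _ "(x, \<rho>)"])
  qed
qed

lemma borel_measurable_hl_maximal [measurable]: "hl_maximal g \<in> borel_measurable borel"
proof (rule borel_measurableI_greater)
  fix \<alpha>
  have "open {z. \<alpha> < hl_maximal g z}"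
    unfolding hl_maximal_superlevel by (intro open_UN) auto
  then have "{z. \<alpha> < hl_maximal g z} \<in> sets borel" by (rule borel_open)
  then show "{x \<in> space borel. \<alpha> < hl_maximal g x} \<in> sets borel" by simp
qed

text \<open>Vitali's lemma selects disjoint balls whose fivefold enlargements cover the superlevel
  set, whence the factor \<open>5 ^ DIM('a)\<close>. On each selected ball g has mass above \<alpha>
  times the volume, and by disjointness these masses add up to at most the integral of g.\<close>

lemma hl_maximal_weak_type:
  fixes g :: "'a::euclidean_space \<Rightarrow> ennreal"
  assumes [measurable]: "g \<in> borel_measurable borel" and \<alpha>: "0 < \<alpha>"
  shows "ennreal \<alpha> * emeasure lborel {z. ennreal \<alpha> < hl_maximal g z} \<le> 5 ^ DIM('a) * (\<integral>\<^sup>+x. g x \<partial>lborel)"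
proof (cases "(\<integral>\<^sup>+x. g x \<partial>lborel) = top")
  case True
  then show ?thesis by (simp add: ennreal_mult_top)
next
  case False
  then obtain I where I: "(\<integral>\<^sup>+x. g x \<partial>lborel) = ennreal I" "0 \<le> I"
    by (cases "\<integral>\<^sup>+x. g x \<partial>lborel") auto
  define K where "K = {(x::'a, \<rho>). 0 < \<rho> \<and>
    ennreal \<alpha> * emeasure lborel (ball x \<rho>) < (\<integral>\<^sup>+y\<in>ball x \<rho>. g y \<partial>lborel)}"
  define v where "v = unit_ball_vol (real DIM('a))"
  have v: "0 < v" by (simp add: v_def)
  \<comment> \<open>Vitali's lemma asks for bounded radii. The finite integral of g bounds
    \<open>\<rho> ^ DIM('a)\<close>, and this bounds \<rho> itself when \<rho> is at least 1; hence
    the maximum with 1.\<close>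
  have radius: "0 < snd i \<and> snd i \<le> max 1 (I / (\<alpha> * v))" if i: "i \<in> K" for i
  proof -
    obtain x \<rho> where i_eq: "i = (x, \<rho>)" by (cases i)
    have \<rho>: "0 < \<rho>" and less: "ennreal \<alpha> * emeasure lborel (ball x \<rho>) < (\<integral>\<^sup>+y\<in>ball x \<rho>. g y \<partial>lborel)"
      using i by (auto simp: K_def i_eq)
    note less
    also have "(\<integral>\<^sup>+y\<in>ball x \<rho>. g y \<partial>lborel) \<le> (\<integral>\<^sup>+y. g y \<partial>lborel)"
      by (intro nn_integral_mono) (auto simp: indicator_def)
    finally have "\<alpha> * (v * \<rho> ^ DIM('a)) < I"
      using \<rho> \<alpha> v I by (simp add: emeasure_ball v_def[symmetric] ennreal_mult[symmetric] ennreal_less_iff)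
    then have "\<rho> ^ DIM('a) \<le> I / (\<alpha> * v)"
      using \<alpha> v by (simp add: field_simps)
    moreover have "\<rho> \<le> \<rho> ^ DIM('a)" if "1 \<le> \<rho>"
      using that by (intro self_le_power) auto
    ultimately show ?thesis using \<rho> by (cases "1 \<le> \<rho>") (auto simp: i_eq)
  qed
  have S: "{z. ennreal \<alpha> < hl_maximal g z} \<subseteq> (\<Union>i\<in>K. ball (fst i) (snd i))"
    by (auto simp: hl_maximal_superlevel K_def)
  obtain C where C: "countable C" "C \<subseteq> K"
    "pairwise (\<lambda>i j. disjnt (ball (fst i) (snd i)) (ball (fst j) (snd j))) C"
    "{z. ennreal \<alpha> < hl_maximal g z} \<subseteq> (\<Union>i\<in>C. ball (fst i) (5 * snd i))"
    by (rule Vitali_covering_lemma_balls[OF S radius]) (assumption | rule that)+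
  \<comment> \<open>The selected balls are reindexed by natural numbers and padded with empty sets,
    so that countable additivity applies to sequences.\<close>
  define T where "T = to_nat_on C ` C"
  define e where "e = from_nat_into C"
  have e: "e n \<in> C" if "n \<in> T" for n
    using that C by (auto simp: T_def e_def)
  have inj: "inj_on e T"
    using C by (auto simp: T_def e_def inj_on_def)
  have surj: "e ` T = C"
    using C by (force simp: T_def e_def)
  define X where "X n = (if n \<in> T then ball (fst (e n)) (snd (e n)) else {})" for n
  define Y where "Y n = (if n \<in> T then ball (fst (e n)) (5 * snd (e n)) else {})" for n
  have XY [measurable]: "X n \<in> sets borel" "Y n \<in> sets borel" for n
    by (auto simp: X_def Y_def)
  have disj: "disjoint_family X"
    using C(3) inj e by (auto simp: disjoint_family_on_def X_def pairwise_def disjnt_def dest: inj_onD)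
  have eY: "emeasure lborel (Y n) = 5 ^ DIM('a) * emeasure lborel (X n)" for n
  proof (cases "n \<in> T")
    case True
    have pos: "0 < snd (e n)" using radius[of "e n"] e[OF True] C(2) by blast
    have "emeasure lborel (Y n) = ennreal (5 ^ DIM('a) * (unit_ball_vol (real DIM('a)) * snd (e n) ^ DIM('a)))"
      using True pos by (simp add: Y_def emeasure_ball power_mult_distrib mult_ac)
    also have "\<dots> = 5 ^ DIM('a) * emeasure lborel (X n)"
      using True pos by (subst ennreal_mult) (auto simp: X_def emeasure_ball ennreal_power[symmetric])
    finally show ?thesis .
  qed (simp add: X_def Y_def)
  have eX: "ennreal \<alpha> * emeasure lborel (X n) \<le> emeasure (density lborel g) (X n)" for n
  proof (cases "n \<in> T")
    case True
    with e[OF True] C(2) have "e n \<in> K" by auto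
    then show ?thesis using True by (auto simp: X_def K_def emeasure_density less_imp_le)
  qed (simp add: X_def)
  have "{z. ennreal \<alpha> < hl_maximal g z} \<subseteq> (\<Union>n. Y n)"
    using C(4) surj by (fastforce simp: Y_def)
  then have "emeasure lborel {z. ennreal \<alpha> < hl_maximal g z} \<le> emeasure lborel (\<Union>n. Y n)"
    by (intro emeasure_mono) auto
  also have "\<dots> \<le> (\<Sum>n. emeasure lborel (Y n))"
    by (intro emeasure_subadditive_countably) auto
  finally have "ennreal \<alpha> * emeasure lborel {z. ennreal \<alpha> < hl_maximal g z}
      \<le> ennreal \<alpha> * (5 ^ DIM('a) * (\<Sum>n. emeasure lborel (X n)))"
    by (intro mult_left_mono) (auto simp: eY)
  also have "\<dots> = 5 ^ DIM('a) * (\<Sum>n. ennreal \<alpha> * emeasure lborel (X n))"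
    by (simp add: mult_ac)
  also have "\<dots> \<le> 5 ^ DIM('a) * (\<Sum>n. emeasure (density lborel g) (X n))"
    using eX by (intro mult_left_mono suminf_le) auto
  also have "(\<Sum>n. emeasure (density lborel g) (X n)) = emeasure (density lborel g) (\<Union>n. X n)"
    using disj by (intro suminf_emeasure) auto
  also have "\<dots> \<le> emeasure (density lborel g) UNIV"
    by (intro emeasure_mono) auto
  also have "\<dots> = (\<integral>\<^sup>+x. g x \<partial>lborel)"
    by (simp add: emeasure_density)
  finally show ?thesis by (simp add: mult_left_mono)
qed

section \<open>From the weak type bound to the strong type bound\<close>

lemma hl_maximal_add_const:
  fixes g h :: "'a::euclidean_space \<Rightarrow> ennreal"
  assumes [measurable]: "h \<in> borel_measurable borel" and le: "\<And>x. g x \<le> h x + c"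
  shows "hl_maximal g z \<le> hl_maximal h z + c"
proof -
  have "(\<integral>\<^sup>+y\<in>ball x \<rho>. g y \<partial>lborel) / emeasure lborel (ball x \<rho>) \<le> hl_maximal h z + c"
    if d: "dist x z < \<rho>" for x \<rho>
  proof -
    have \<rho>: "0 < \<rho>" using d zero_le_dist[of x z] by linarith
    have [measurable]: "ball x \<rho> \<in> sets borel" by simp
    have "(\<integral>\<^sup>+y\<in>ball x \<rho>. g y \<partial>lborel) \<le> (\<integral>\<^sup>+y. h y * indicator (ball x \<rho>) y + c * indicator (ball x \<rho>) y \<partial>lborel)"
      using le by (intro nn_integral_mono) (auto simp: indicator_def)
    also have "\<dots> = (\<integral>\<^sup>+y\<in>ball x \<rho>. h y \<partial>lborel) + c * emeasure lborel (ball x \<rho>)"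
    proof (subst nn_integral_add)
      show "(\<lambda>y. h y * indicator (ball x \<rho>) y) \<in> borel_measurable lborel"
        "(\<lambda>y. c * indicator (ball x \<rho>) y) \<in> borel_measurable lborel" by measurable
    qed (simp add: nn_integral_cmult_indicator)
    finally have "(\<integral>\<^sup>+y\<in>ball x \<rho>. g y \<partial>lborel) / emeasure lborel (ball x \<rho>)
       \<le> ((\<integral>\<^sup>+y\<in>ball x \<rho>. h y \<partial>lborel) + c * emeasure lborel (ball x \<rho>)) / emeasure lborel (ball x \<rho>)"
      by (rule divide_right_mono_ennreal)
    also have "\<dots> = (\<integral>\<^sup>+y\<in>ball x \<rho>. h y \<partial>lborel) / emeasure lborel (ball x \<rho>) + c"
      using emeasure_ball_pos_finite[OF \<rho>, of x]
      by (simp add: add_divide_distrib_ennreal mult_divide_eq_ennreal)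
    also have "\<dots> \<le> hl_maximal h z + c"
      unfolding hl_maximal_def using d
      by (intro add_right_mono SUP_upper2[of "(x, \<rho>)"]) auto
    finally show ?thesis .
  qed
  then show ?thesis
    unfolding hl_maximal_def[of g] by (intro SUP_least) auto
qed

text \<open>The part of g below \<alpha>/2 adds at most \<alpha>/2 to the maximal function, so the
  weak type bound at level \<alpha>/2 need only see the part above. Without this restriction the
  integral over all levels would diverge.\<close>

lemma hl_maximal_superlevel_le:
  fixes g :: "'a::euclidean_space \<Rightarrow> ennreal"
  assumes [measurable]: "g \<in> borel_measurable borel" and \<alpha>: "0 < \<alpha>"
  shows "ennreal \<alpha> * emeasure lborel {z. ennreal \<alpha> < hl_maximal g z}
    \<le> 2 * 5 ^ DIM('a) * (\<integral>\<^sup>+x. g x * indicator {x. ennreal \<alpha> < 2 * g x} x \<partial>lborel)"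
proof -
  define h where "h x = g x * indicator {x. ennreal \<alpha> < 2 * g x} x" for x
  have [measurable]: "h \<in> borel_measurable borel"
    unfolding h_def by measurable
  have half: "ennreal \<alpha> = ennreal (\<alpha> / 2) + ennreal (\<alpha> / 2)"
    using \<alpha> by (subst ennreal_plus[symmetric]) auto
  have "g x \<le> h x + ennreal (\<alpha> / 2)" for x
  proof (cases "ennreal \<alpha> < 2 * g x")
    case False
    then have "2 * g x \<le> 2 * ennreal (\<alpha> / 2)"
      using half by (simp add: mult_2 not_less)
    then have "g x \<le> ennreal (\<alpha> / 2)"
      by (simp add: ennreal_mult_le_mult_iff)
    then show ?thesis by (simp add: h_def False)
  qed (simp add: h_def)
  then have le: "hl_maximal g z \<le> hl_maximal h z + ennreal (\<alpha> / 2)" for z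
    by (intro hl_maximal_add_const) auto
  have sub: "{z. ennreal \<alpha> < hl_maximal g z} \<subseteq> {z. ennreal (\<alpha> / 2) < hl_maximal h z}"
  proof safe
    fix z assume "ennreal \<alpha> < hl_maximal g z"
    also note le[of z]
    finally show "ennreal (\<alpha> / 2) < hl_maximal h z"
      unfolding half by (meson add_right_mono linorder_not_less)
  qed
  have "ennreal \<alpha> * emeasure lborel {z. ennreal \<alpha> < hl_maximal g z}
      \<le> (2 * ennreal (\<alpha> / 2)) * emeasure lborel {z. ennreal (\<alpha> / 2) < hl_maximal h z}"
    using half by (intro mult_mono emeasure_mono[OF sub]) (auto simp: mult_2)
  also have "\<dots> \<le> 2 * (5 ^ DIM('a) * (\<integral>\<^sup>+x. h x \<partial>lborel))"
    unfolding mult.assoc using \<alpha> by (intro mult_left_mono hl_maximal_weak_type) auto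
  finally show ?thesis by (simp add: h_def mult_ac)
qed

lemma nn_integral_layer_cake:
  assumes r: "0 < r"
  shows "(\<integral>\<^sup>+l. ennreal (l powr (r - 1)) * indicator {l. 0 < l \<and> ennreal l < u} l \<partial>lborel)
    = ennreal (1 / r) * ennreal_powr u r"
proof -
  have fin: "(\<integral>\<^sup>+l. ennreal (l powr (r - 1)) * indicator {l. 0 < l \<and> ennreal l < ennreal c} l \<partial>lborel)
      = ennreal (1 / r) * ennreal (c powr r)" if c: "0 \<le> c" for c
  proof -
    have "((\<lambda>x. x powr (r - 1)) has_integral (c powr (r - 1 + 1) / (r - 1 + 1))) {0..c}"
      using r c by (intro has_integral_powr_from_0) auto
    then have "((\<lambda>x. x powr (r - 1) * indicator {0..c} x) has_integral (c powr r / r)) UNIV"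
      by (subst (asm) has_integral_restrict_UNIV[symmetric])
        (simp add: indicator_def of_bool_def if_distrib cong: if_cong)
    then have "(\<integral>\<^sup>+x. ennreal (x powr (r - 1) * indicator {0..c} x) \<partial>lborel) = ennreal (c powr r / r)"
      by (intro nn_integral_has_integral_lborel) auto
    also have "(\<integral>\<^sup>+x. ennreal (x powr (r - 1) * indicator {0..c} x) \<partial>lborel)
       = (\<integral>\<^sup>+l. ennreal (l powr (r - 1)) * indicator {l. 0 < l \<and> ennreal l < ennreal c} l \<partial>lborel)"
    proof (rule nn_integral_cong_AE)
      have "AE x in lborel. x \<noteq> 0" "AE x in lborel. x \<noteq> c"
        by (rule AE_lborel_singleton)+
      then show "AE x in lborel. ennreal (x powr (r - 1) * indicator {0..c} x)
          = ennreal (x powr (r - 1)) * indicator {l. 0 < l \<and> ennreal l < ennreal c} x"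
        by eventually_elim (auto simp: indicator_def ennreal_less_iff)
    qed
    finally show ?thesis using r c by (simp add: ennreal_mult[symmetric])
  qed
  show ?thesis
  proof (cases u)
    case (real c)
    then show ?thesis using fin by (simp add: ennreal_powr_ennreal)
  next
    case top
    let ?J = "\<integral>\<^sup>+l. ennreal (l powr (r - 1)) * indicator {l. 0 < l \<and> ennreal l < u} l \<partial>lborel"
    \<comment> \<open>For infinite u, compare with the finite level \<open>y powr (1 / r)\<close>,
      whose r-th power is y; since y is arbitrary, the integral is infinite.\<close>
    have le: "ennreal (y / r) \<le> ?J" if "0 < y" for y
    proof -
      have "ennreal (y / r) = ennreal (1 / r) * ennreal ((y powr (1 / r)) powr r)"
        using that r by (simp add: powr_powr ennreal_mult[symmetric])
      also have "\<dots> \<le> ?J"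
        by (subst fin[symmetric])
          (use that top in \<open>auto intro!: nn_integral_mono mult_left_mono simp: indicator_def\<close>)
      finally show ?thesis .
    qed
    have "?J = top"
    proof (rule ccontr)
      assume "?J \<noteq> top"
      then obtain J where J: "?J = ennreal J" "0 \<le> J" by (cases ?J) auto
      show False
        using le[of "r * (J + 1)"] r J by (simp add: ennreal_le_iff)
    qed
    then show ?thesis using r top by (simp add: ennreal_mult_top)
  qed
qed

text \<open>Marcinkiewicz interpolation done by hand. In the constant, s comes from the outer layer
  cake formula, \<open>2 * 5 ^ DIM('a)\<close> from the superlevel estimate, and
  \<open>1 / (s - 1)\<close> and \<open>2 powr (s - 1)\<close> from the inner layer cake formula,
  which runs up to \<open>2 * g x\<close>.\<close>

lemma hl_maximal_strong_type:
  fixes g :: "'a::euclidean_space \<Rightarrow> ennreal"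
  assumes [measurable]: "g \<in> borel_measurable borel" and s: "1 < s"
  shows "(\<integral>\<^sup>+x. ennreal_powr (hl_maximal g x) s \<partial>lborel)
    \<le> ennreal (s * (2 * 5 ^ DIM('a)) * (1 / (s - 1)) * 2 powr (s - 1)) * (\<integral>\<^sup>+x. ennreal_powr (g x) s \<partial>lborel)"
proof -
  let ?k = "\<lambda>r l. ennreal (l powr r)"
  have "(\<integral>\<^sup>+x. ennreal_powr (hl_maximal g x) s \<partial>lborel)
     = (\<integral>\<^sup>+x. ennreal s * (\<integral>\<^sup>+l. ?k (s - 1) l * indicator {l. 0 < l \<and> ennreal l < hl_maximal g x} l \<partial>lborel) \<partial>lborel)"
  proof (rule nn_integral_cong)
    fix x :: 'a
    have "ennreal_powr (hl_maximal g x) s = (ennreal s * ennreal (1 / s)) * ennreal_powr (hl_maximal g x) s"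
      using s by (simp add: ennreal_mult[symmetric])
    then show "ennreal_powr (hl_maximal g x) s
        = ennreal s * (\<integral>\<^sup>+l. ?k (s - 1) l * indicator {l. 0 < l \<and> ennreal l < hl_maximal g x} l \<partial>lborel)"
      using s by (subst nn_integral_layer_cake) (auto simp: mult.assoc)
  qed
  also have "\<dots> = ennreal s * (\<integral>\<^sup>+x. (\<integral>\<^sup>+l. ?k (s - 1) l * indicator {l. 0 < l \<and> ennreal l < hl_maximal g x} l \<partial>lborel) \<partial>lborel)"
    by (rule nn_integral_cmult) measurable
  also have "(\<integral>\<^sup>+x. (\<integral>\<^sup>+l. ?k (s - 1) l * indicator {l. 0 < l \<and> ennreal l < hl_maximal g x} l \<partial>lborel) \<partial>lborel)
     = (\<integral>\<^sup>+l. (\<integral>\<^sup>+x. ?k (s - 1) l * indicator {l. 0 < l \<and> ennreal l < hl_maximal g x} l \<partial>lborel) \<partial>lborel)"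
    by (rule lborel_pair.Fubini'[symmetric]) measurable
  also have "\<dots> \<le> (\<integral>\<^sup>+l. (\<integral>\<^sup>+x. (2 * 5 ^ DIM('a)) * (g x * (?k (s - 1 - 1) l * indicator {l. 0 < l \<and> ennreal l < 2 * g x} l)) \<partial>lborel) \<partial>lborel)"
  proof (rule nn_integral_mono)
    fix l :: real
    show "(\<integral>\<^sup>+x. ?k (s - 1) l * indicator {l. 0 < l \<and> ennreal l < hl_maximal g x} l \<partial>lborel)
      \<le> (\<integral>\<^sup>+x. (2 * 5 ^ DIM('a)) * (g x * (?k (s - 1 - 1) l * indicator {l. 0 < l \<and> ennreal l < 2 * g x} l)) \<partial>lborel)"
    proof (cases "0 < l")
      case True
      have "(\<integral>\<^sup>+x. ?k (s - 1) l * indicator {l. 0 < l \<and> ennreal l < hl_maximal g x} l \<partial>(lborel :: 'a measure))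
          = (\<integral>\<^sup>+x. ?k (s - 1) l * indicator {x. ennreal l < hl_maximal g x} x \<partial>lborel)"
        using True by (intro nn_integral_cong) (auto simp: indicator_def)
      also have "\<dots> = ?k (s - 1) l * emeasure lborel {x. ennreal l < hl_maximal g x}"
        by (rule nn_integral_cmult_indicator) measurable
      \<comment> \<open>One factor l is split off, because the superlevel estimate bounds l times
        the measure.\<close>
      also have "\<dots> = ?k (s - 1 - 1) l * ennreal l * emeasure lborel {x. ennreal l < hl_maximal g x}"
        using True by (simp add: ennreal_mult[symmetric] powr_diff field_simps power2_eq_square)
      also have "\<dots>
          \<le> ?k (s - 1 - 1) l * (2 * 5 ^ DIM('a) * (\<integral>\<^sup>+x. g x * indicator {x. ennreal l < 2 * g x} x \<partial>lborel))"
        unfolding mult.assoc[of "?k _ _"] by (intro mult_left_mono hl_maximal_superlevel_le) (use True in auto)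
      also have "\<dots> = (\<integral>\<^sup>+x. (?k (s - 1 - 1) l * (2 * 5 ^ DIM('a))) * (g x * indicator {x. ennreal l < 2 * g x} x) \<partial>lborel)"
        by (subst nn_integral_cmult) (auto simp: mult.assoc)
      also have "\<dots> = (\<integral>\<^sup>+x. (2 * 5 ^ DIM('a)) * (g x * (?k (s - 1 - 1) l * indicator {l. 0 < l \<and> ennreal l < 2 * g x} l)) \<partial>lborel)"
        using True by (intro nn_integral_cong) (auto simp: indicator_def mult_ac)
      finally show ?thesis .
    qed simp
  qed
  also have "\<dots> = (\<integral>\<^sup>+x. (\<integral>\<^sup>+l. (2 * 5 ^ DIM('a)) * (g x * (?k (s - 1 - 1) l * indicator {l. 0 < l \<and> ennreal l < 2 * g x} l)) \<partial>lborel) \<partial>lborel)"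
    by (rule lborel_pair.Fubini') measurable
  also have "\<dots> = (\<integral>\<^sup>+x. (2 * 5 ^ DIM('a)) * (g x * (ennreal (1 / (s - 1)) * ennreal_powr (2 * g x) (s - 1))) \<partial>lborel)"
    using s by (intro nn_integral_cong, subst nn_integral_cmult, measurable,
      subst nn_integral_cmult, measurable, subst nn_integral_layer_cake) auto
  also have "\<dots> = (\<integral>\<^sup>+x. ennreal (2 * 5 ^ DIM('a) * (1 / (s - 1)) * 2 powr (s - 1)) * ennreal_powr (g x) s \<partial>lborel)"
  proof (rule nn_integral_cong)
    fix x
    have "ennreal_powr (g x) s = g x * ennreal_powr (g x) (s - 1)"
      using ennreal_powr_add[of "g x" 1 "s - 1"] by simp
    moreover have "ennreal_powr (2 * g x) (s - 1) = ennreal (2 powr (s - 1)) * ennreal_powr (g x) (s - 1)"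
      using ennreal_powr_ennreal[of 2 "s - 1"] by (simp add: ennreal_powr_mult)
    moreover have "ennreal (2 * 5 ^ DIM('a) * (1 / (s - 1)) * 2 powr (s - 1))
       = (2 * 5 ^ DIM('a)) * ennreal (1 / (s - 1)) * ennreal (2 powr (s - 1))"
      using s ennreal_power[of 5 "DIM('a)"]
      by (simp only: ennreal_mult zero_le_power zero_le_numeral zero_le_mult_iff powr_ge_zero
          divide_nonneg_nonneg zero_le_one ennreal_numeral diff_ge_0_iff_ge less_imp_le simp_thms)
    ultimately show "(2 * 5 ^ DIM('a)) * (g x * (ennreal (1 / (s - 1)) * ennreal_powr (2 * g x) (s - 1)))
      = ennreal (2 * 5 ^ DIM('a) * (1 / (s - 1)) * 2 powr (s - 1)) * ennreal_powr (g x) s"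
      by (simp add: mult_ac)
  qed
  also have "\<dots> = ennreal (2 * 5 ^ DIM('a) * (1 / (s - 1)) * 2 powr (s - 1)) * (\<integral>\<^sup>+x. ennreal_powr (g x) s \<partial>lborel)"
    by (rule nn_integral_cmult) measurable
  finally show ?thesis
    using s by (simp add: mult.assoc[symmetric] ennreal_mult[symmetric] mult_left_mono)
qed

section \<open>Averages against decaying kernels\<close>

definition decay :: "real \<Rightarrow> real \<Rightarrow> 'a::euclidean_space \<Rightarrow> real" where
  "decay a t z = (1 + norm z / t) powr (- a) / t ^ DIM('a)"

definition decay_avg :: "real \<Rightarrow> real \<Rightarrow> ('a::euclidean_space \<Rightarrow> ennreal) \<Rightarrow> 'a \<Rightarrow> ennreal" where
  "decay_avg a t f x = (\<integral>\<^sup>+y. ennreal (decay a t (x - y)) * f y \<partial>lborel)"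

text \<open>The sum of the geometric series over dyadic balls: the ball of radius
  \<open>2 ^ (l + 1) * t\<close> contributes its volume times the size
  \<open>2 powr (- a * l)\<close> of the kernel. It converges exactly for a > n.\<close>

definition decay_const :: "nat \<Rightarrow> real \<Rightarrow> real" where
  "decay_const n a = unit_ball_vol (real n) * 2 ^ n / (1 - 2 powr (real n - a))"

lemma decay_nonneg [simp]: "0 < t \<Longrightarrow> 0 \<le> decay a t z"
  by (simp add: decay_def)

lemma decay_minus: "decay a t (- z) = decay a t z"
  by (simp add: decay_def)

lemma borel_measurable_decay [measurable]: "decay a t \<in> borel_measurable borel"
  unfolding decay_def by measurable

lemma borel_measurable_decay_avg [measurable]:
  assumes [measurable]: "f \<in> borel_measurable borel"
  shows "decay_avg a t f \<in> borel_measurable borel"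
  unfolding decay_avg_def by measurable

lemma decay_const_pos:
  assumes "real n < a"
  shows "0 < decay_const n a"
proof -
  have "2 powr (real n - a) < 1" using assms by (simp add: powr_less_one)
  then show ?thesis by (simp add: decay_const_def)
qed

text \<open>If l is the index with \<open>2 ^ l \<le> 1 + norm z / t < 2 ^ (l + 1)\<close>, the l-th
  term alone dominates the kernel. The full sum is kept because its terms do not depend on
  z.\<close>

lemma decay_le_suminf:
  fixes z :: "'a::euclidean_space"
  assumes t: "0 < t" and a: "0 < a"
  shows "ennreal (decay a t z)
    \<le> (\<Sum>l. ennreal ((2 powr (- a)) ^ l / t ^ DIM('a)) * indicator (ball 0 (2 ^ (l + 1) * t)) z)"
proof -
  define u where "u = 1 + norm z / t"
  have u: "1 \<le> u" using t by (simp add: u_def)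
  have ex: "\<exists>k. u < 2 ^ k" by (rule real_arch_pow) simp
  define k where "k = (LEAST k. u < 2 ^ k)"
  have k: "u < 2 ^ k" unfolding k_def by (rule LeastI_ex[OF ex])
  then have "k \<noteq> 0" using u by (cases k) auto
  then obtain l where l: "k = Suc l" by (cases k) auto
  have "\<not> u < 2 ^ l" using not_less_Least[of l "\<lambda>k. u < 2 ^ k"] l by (simp add: k_def)
  then have ul: "2 ^ l \<le> u" by simp
  have "u powr (- a) \<le> (2 ^ l) powr (- a)"
    using ul a by (intro powr_mono2') auto
  also have "(2 ^ l) powr (- a) = (2 powr (- a)) ^ l"
    by (simp add: powr_realpow[symmetric] powr_powr mult.commute)
  finally have "decay a t z \<le> (2 powr (- a)) ^ l / t ^ DIM('a)"
    using t by (simp add: decay_def u_def[symmetric] divide_right_mono)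
  moreover have "norm z / t < 2 ^ (l + 1)"
    using k l u by (simp add: u_def)
  then have "z \<in> ball 0 (2 ^ (l + 1) * t)"
    using t by (simp add: field_simps)
  ultimately have le: "ennreal (decay a t z)
      \<le> ennreal ((2 powr (- a)) ^ l / t ^ DIM('a)) * indicator (ball 0 (2 ^ (l + 1) * t)) z"
    by (simp add: ennreal_leI)
  define F where "F = (\<lambda>l. ennreal ((2 powr (- a)) ^ l / t ^ DIM('a)) * indicator (ball 0 (2 ^ (l + 1) * t)) z)"
  have "ennreal (decay a t z) \<le> F l"
    using le by (simp only: F_def)
  also have "\<dots> = sum F {l}" by simp
  also have "\<dots> \<le> suminf F" by (rule sum_le_suminf) auto
  finally show ?thesis by (simp only: F_def)
qed

text \<open>Each ball of the dyadic decomposition about x contains z, since already the smallest has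
  radius \<open>2 * t\<close>. The maximal function may therefore be evaluated at z instead of
  x.\<close>

lemma decay_avg_le_hl_maximal:
  fixes f :: "'a::euclidean_space \<Rightarrow> ennreal"
  assumes [measurable]: "f \<in> borel_measurable borel"
    and t: "0 < t" and a: "real DIM('a) < a" and d: "dist x z < 2 * t"
  shows "decay_avg a t f x \<le> ennreal (decay_const DIM('a) a) * hl_maximal f z"
proof -
  define n where "n = DIM('a)"
  define v where "v = unit_ball_vol (real n)"
  have v: "0 \<le> v" by (simp add: v_def)
  define c where "c l = (2 powr (- a)) ^ l / t ^ n" for l :: nat
  have c: "0 \<le> c l" for l using t by (simp add: c_def)
  let ?B = "\<lambda>l::nat. ball x (2 ^ (l + 1) * t)"
  have [measurable]: "ball x R \<in> sets borel" for R by simp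
  have a0: "0 < a" using a by linarith
  have "decay_avg a t f x
      \<le> (\<integral>\<^sup>+y. (\<Sum>l. ennreal (c l) * (f y * indicator (?B l) y)) \<partial>lborel)"
    unfolding decay_avg_def
  proof (rule nn_integral_mono)
    fix y
    have "ennreal (decay a t (x - y)) * f y
      \<le> (\<Sum>l. ennreal (c l) * indicator (ball 0 (2 ^ (l + 1) * t)) (x - y)) * f y"
      unfolding c_def n_def by (intro mult_right_mono decay_le_suminf t a0) auto
    also have "\<dots> = (\<Sum>l. ennreal (c l) * (f y * indicator (?B l) y))"
      by (subst ennreal_suminf_multc[symmetric])
        (auto intro!: arg_cong[where f=suminf] simp: fun_eq_iff indicator_def dist_norm norm_minus_commute mult_ac)
    finally show "ennreal (decay a t (x - y)) * f y \<le> (\<Sum>l. ennreal (c l) * (f y * indicator (?B l) y))" .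
  qed
  also have "\<dots> = (\<Sum>l. \<integral>\<^sup>+y. ennreal (c l) * (f y * indicator (?B l) y) \<partial>lborel)"
    by (rule nn_integral_suminf) measurable
  also have "\<dots> = (\<Sum>l. ennreal (c l) * (\<integral>\<^sup>+y\<in>?B l. f y \<partial>lborel))"
    by (intro arg_cong[where f=suminf] ext nn_integral_cmult) measurable
  also have "\<dots> \<le> (\<Sum>l. ennreal (v * 2 ^ n * (2 powr (real n - a)) ^ l) * hl_maximal f z)"
  proof (rule suminf_le)
    fix l :: nat
    have "1 \<le> (2::real) ^ l" by simp
    then have "1 * (2 * t) \<le> 2 ^ l * (2 * t)"
      using t by (intro mult_right_mono) simp_all
    with d have "dist x z < 2 ^ l * (2 * t)" by linarith
    then have "dist x z < 2 ^ (l + 1) * t" by (simp add: mult_ac)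
    then have "ennreal (c l) * (\<integral>\<^sup>+y\<in>?B l. f y \<partial>lborel)
       \<le> ennreal (c l) * (emeasure lborel (?B l) * hl_maximal f z)"
      by (intro mult_left_mono nn_integral_ball_le_hl_maximal) auto
    also have "emeasure lborel (?B l) = ennreal (v * (2 ^ (l + 1) * t) ^ n)"
      using t by (subst emeasure_ball) (auto simp: v_def n_def)
    also have "ennreal (c l) * (ennreal (v * (2 ^ (l + 1) * t) ^ n) * hl_maximal f z)
       = ennreal (c l * (v * (2 ^ (l + 1) * t) ^ n)) * hl_maximal f z"
      using t v c by (simp add: ennreal_mult mult.assoc)
    also have "c l * (v * (2 ^ (l + 1) * t) ^ n) = v * 2 ^ n * (2 powr (real n - a)) ^ l"
    proof -
      have "(2 powr (real n - a)) ^ l = (2 ^ n) ^ l * (2 powr (- a)) ^ l"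
        unfolding power_mult_distrib[symmetric]
        by (simp add: powr_diff powr_realpow powr_minus divide_inverse)
      moreover have "(2 ^ (l + 1) * t) ^ n = 2 ^ n * (2 ^ n) ^ l * t ^ n"
        by (simp add: power_mult_distrib power_mult[symmetric] mult.commute[of l n])
      ultimately have "c l * (v * (2 ^ (l + 1) * t) ^ n)
          = (2 powr (- a)) ^ l / t ^ n * (v * (2 ^ n * (2 ^ n) ^ l * t ^ n))"
        and "v * 2 ^ n * (2 powr (real n - a)) ^ l = v * 2 ^ n * ((2 ^ n) ^ l * (2 powr (- a)) ^ l)"
        by (simp_all only: c_def)
      moreover have "X / t ^ n * (v * (Y * Z * t ^ n)) = v * Y * (Z * X)" for X Y Z
        using t by simp
      ultimately show ?thesis by (simp only:)
    qed
    finally show "ennreal (c l) * (\<integral>\<^sup>+y\<in>?B l. f y \<partial>lborel)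
        \<le> ennreal (v * 2 ^ n * (2 powr (real n - a)) ^ l) * hl_maximal f z" .
  qed auto
  also have "\<dots> = (\<Sum>l. ennreal (v * 2 ^ n * (2 powr (real n - a)) ^ l)) * hl_maximal f z"
    by simp
  also have "(\<Sum>l. ennreal (v * 2 ^ n * (2 powr (real n - a)) ^ l)) = ennreal (decay_const DIM('a) a)"
  proof -
    have lt: "2 powr (real n - a) < 1" using a by (simp add: n_def powr_less_one)
    then have "(\<lambda>l. v * 2 ^ n * (2 powr (real n - a)) ^ l) sums (v * 2 ^ n * (1 / (1 - 2 powr (real n - a))))"
      by (intro sums_mult geometric_sums) auto
    then have "(\<lambda>l. v * 2 ^ n * (2 powr (real n - a)) ^ l) sums (decay_const DIM('a) a)"
      by (simp add: decay_const_def v_def n_def)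
    then show ?thesis
      using v by (intro suminf_ennreal_eq) auto
  qed
  finally show ?thesis .
qed

lemma hl_maximal_1_le: "hl_maximal (\<lambda>_. 1) z \<le> 1"
  unfolding hl_maximal_def
proof (rule SUP_least, clarify)
  fix x :: 'a and \<rho> assume "dist x z < \<rho>"
  then have "0 < \<rho>" using zero_le_dist[of x z] by linarith
  from emeasure_ball_pos_finite[OF this, of x]
  show "(\<integral>\<^sup>+y\<in>ball x \<rho>. 1 \<partial>lborel) / emeasure lborel (ball x \<rho>) \<le> 1"
    by (simp add: ennreal_divide_self less_top[symmetric])
qed

text \<open>The mass of the kernel is read off from the maximal bound, since the maximal function of
  the constant 1 is at most 1.\<close>

lemma decay_avg_1_le:
  fixes x :: "'a::euclidean_space"
  assumes "0 < t" "real DIM('a) < a"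
  shows "decay_avg a t (\<lambda>_. 1) x \<le> ennreal (decay_const DIM('a) a)"
proof -
  have "decay_avg a t (\<lambda>_. 1) x \<le> ennreal (decay_const DIM('a) a) * hl_maximal (\<lambda>_. 1) x"
    using assms by (intro decay_avg_le_hl_maximal) auto
  also have "\<dots> \<le> ennreal (decay_const DIM('a) a) * 1"
    by (intro mult_left_mono hl_maximal_1_le) auto
  finally show ?thesis by simp
qed

lemma nn_integral_decay_avg_le:
  fixes f :: "'a::euclidean_space \<Rightarrow> ennreal"
  assumes [measurable]: "f \<in> borel_measurable borel" and t: "0 < t" and a: "real DIM('a) < a"
  shows "(\<integral>\<^sup>+x. decay_avg a t f x \<partial>lborel) \<le> ennreal (decay_const DIM('a) a) * (\<integral>\<^sup>+x. f x \<partial>lborel)"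
proof -
  have "(\<integral>\<^sup>+x. decay_avg a t f x \<partial>lborel)
     = (\<integral>\<^sup>+y. (\<integral>\<^sup>+x. ennreal (decay a t (x - y)) * f y \<partial>lborel) \<partial>lborel)"
    unfolding decay_avg_def by (rule lborel_pair.Fubini'[symmetric]) measurable
  also have "\<dots> = (\<integral>\<^sup>+y. decay_avg a t (\<lambda>_. 1) y * f y \<partial>lborel)"
  proof (rule nn_integral_cong)
    fix y :: 'a
    have "decay a t (x - y) = decay a t (y - x)" for x
      using decay_minus[of a t "x - y"] by simp
    then show "(\<integral>\<^sup>+x. ennreal (decay a t (x - y)) * f y \<partial>lborel) = decay_avg a t (\<lambda>_. 1) y * f y"
      by (simp add: decay_avg_def nn_integral_multc)
  qed
  also have "\<dots> \<le> (\<integral>\<^sup>+y. ennreal (decay_const DIM('a) a) * f y \<partial>lborel)"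
    using t a by (intro nn_integral_mono mult_right_mono decay_avg_1_le) auto
  also have "\<dots> = ennreal (decay_const DIM('a) a) * (\<integral>\<^sup>+y. f y \<partial>lborel)"
    by (rule nn_integral_cmult) measurable
  finally show ?thesis .
qed

text \<open>Hoelder's inequality for the measure with density \<open>decay\<close>, whose mass is at
  most \<open>decay_const\<close>. The kernel is split as k^w k^(1-w), and the two truth values
  index the two factors.\<close>

lemma decay_avg_powr_le:
  fixes g :: "'a::euclidean_space \<Rightarrow> ennreal"
  assumes [measurable]: "g \<in> borel_measurable borel" and t: "0 < t" and a: "real DIM('a) < a"
    and w: "0 < w" "w < 1"
  shows "decay_avg a t (\<lambda>y. ennreal_powr (g y) w) x
    \<le> ennreal (decay_const DIM('a) a powr (1 - w)) * ennreal_powr (decay_avg a t g x) w"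
proof -
  define h :: "bool \<Rightarrow> 'a \<Rightarrow> ennreal"
    where "h b y = (if b then ennreal (decay a t (x - y)) * g y else ennreal (decay a t (x - y)))" for b y
  define k where "k b = (if b then w else 1 - w)" for b
  have [measurable]: "h b \<in> borel_measurable borel" for b
    unfolding h_def by measurable
  have "decay_avg a t (\<lambda>y. ennreal_powr (g y) w) x = (\<integral>\<^sup>+y. (\<Prod>b\<in>UNIV. ennreal_powr (h b y) (k b)) \<partial>lborel)"
    unfolding decay_avg_def
  proof (rule nn_integral_cong)
    fix y
    have "ennreal (decay a t (x - y)) = ennreal_powr (ennreal (decay a t (x - y))) (w + (1 - w))"
      by simp
    then show "ennreal (decay a t (x - y)) * ennreal_powr (g y) w = (\<Prod>b\<in>UNIV. ennreal_powr (h b y) (k b))"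
      by (simp add: UNIV_bool h_def k_def ennreal_powr_mult mult_ac flip: ennreal_powr_add)
  qed
  also have "\<dots> \<le> (\<Prod>b\<in>UNIV. ennreal_powr (\<integral>\<^sup>+y. h b y \<partial>lborel) (k b))"
    using w by (intro nn_integral_prod_powr_le) (auto simp: UNIV_bool k_def)
  also have "\<dots> = ennreal_powr (decay_avg a t (\<lambda>_. 1) x) (1 - w) * ennreal_powr (decay_avg a t g x) w"
    by (simp add: UNIV_bool h_def k_def decay_avg_def)
  also have "\<dots> \<le> ennreal_powr (ennreal (decay_const DIM('a) a)) (1 - w) * ennreal_powr (decay_avg a t g x) w"
    using w t a by (intro mult_right_mono ennreal_powr_mono decay_avg_1_le) auto
  finally show ?thesis
    using decay_const_pos[OF a] by (simp add: ennreal_powr_ennreal)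
qed

text \<open>At distance at least r from the origin, 1 is negligible against
  \<open>norm z / r\<close> up to a factor 2, so replacing the scale t by r changes the kernel by a
  pure power. What survives the normalisation by \<open>t ^ DIM('a)\<close> is the gain
  \<open>(t / r) powr (a - n)\<close>.\<close>

lemma decay_far_le:
  fixes z :: "'a::euclidean_space"
  assumes t: "0 < t" "t \<le> r" and z: "r \<le> norm z" and a: "0 < a"
  shows "decay a t z \<le> 2 powr a * (t / r) powr (a - real DIM('a)) * decay a r z"
proof -
  have r: "0 < r" and u: "0 < norm z" using t z by linarith+
  have "(1 + norm z / t) powr (- a) \<le> (norm z / t) powr (- a)"
    using u t a by (intro powr_mono2') auto
  also have "\<dots> = (2 * (norm z / r)) powr (- a) * 2 powr a * (t / r) powr a"
  proof -
    have "(norm z / t) powr (- a) = ((2 * (norm z / r)) * inverse (2 * (t / r))) powr (- a)"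
      using t r by (simp add: field_simps)
    also have "\<dots> = (2 * (norm z / r)) powr (- a) * (2 * (t / r)) powr a"
      using t r u by (subst powr_mult) (simp_all only: powr_minus inverse_powr inverse_inverse_eq)
    also have "(2 * (t / r)) powr a = 2 powr a * (t / r) powr a"
      by (rule powr_mult)
    finally show ?thesis by simp
  qed
  also have "\<dots> \<le> (1 + norm z / r) powr (- a) * 2 powr a * (t / r) powr a"
  proof (intro mult_right_mono powr_mono2')
    have "1 \<le> norm z / r" using z r by simp
    then show "0 < 1 + norm z / r" "1 + norm z / r \<le> 2 * (norm z / r)" by linarith+
  qed (use a in auto)
  finally have "decay a t z \<le> (1 + norm z / r) powr (- a) * 2 powr a * (t / r) powr a / t ^ DIM('a)"
    using t by (simp add: decay_def divide_right_mono)
  also have "\<dots> = 2 powr a * (t / r) powr (a - real DIM('a)) * decay a r z"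
  proof -
    have "(t / r) powr (a - real DIM('a)) = (t / r) powr a * (r ^ DIM('a) / t ^ DIM('a))"
      using t r by (simp add: powr_diff powr_realpow power_divide)
    then show ?thesis using r by (simp add: decay_def)
  qed
  finally show ?thesis .
qed

lemma decay_avg_far_le:
  fixes f :: "'a::euclidean_space \<Rightarrow> ennreal"
  assumes [measurable]: "f \<in> borel_measurable borel"
    and t: "0 < t" "t \<le> r" and a: "real DIM('a) < a" and d: "dist x z < r"
  shows "decay_avg a t (\<lambda>y. f y * indicator (- ball z (2 * r)) y) x
    \<le> ennreal (2 powr a * decay_const DIM('a) a * (t / r) powr (a - real DIM('a))) * hl_maximal f z"
proof -
  define k where "k = 2 powr a * (t / r) powr (a - real DIM('a))"
  have k: "0 \<le> k" by (simp add: k_def)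
  have r: "0 < r" using t by linarith
  have "decay_avg a t (\<lambda>y. f y * indicator (- ball z (2 * r)) y) x
      \<le> (\<integral>\<^sup>+y. ennreal k * (ennreal (decay a r (x - y)) * f y) \<partial>lborel)"
    unfolding decay_avg_def
  proof (rule nn_integral_mono)
    fix y
    show "ennreal (decay a t (x - y)) * (f y * indicator (- ball z (2 * r)) y)
       \<le> ennreal k * (ennreal (decay a r (x - y)) * f y)"
    proof (cases "y \<in> ball z (2 * r)")
      case False
      then have "2 * r \<le> dist z y" by simp
      also have "dist z y \<le> dist x z + dist x y" by (metis dist_commute dist_triangle)
      finally have "r \<le> norm (x - y)" using d by (simp add: dist_norm)
      then have "decay a t (x - y) \<le> k * decay a r (x - y)"
        unfolding k_def using t a by (intro decay_far_le) auto
      then have "ennreal (decay a t (x - y)) \<le> ennreal k * ennreal (decay a r (x - y))"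
        using k r by (subst ennreal_mult[symmetric]) (auto intro: ennreal_leI)
      then have "ennreal (decay a t (x - y)) * f y \<le> ennreal k * ennreal (decay a r (x - y)) * f y"
        by (rule mult_right_mono) simp
      then show ?thesis using False by (simp add: mult.assoc)
    qed simp
  qed
  also have "\<dots> = ennreal k * decay_avg a r f x"
    unfolding decay_avg_def by (rule nn_integral_cmult) measurable
  also have "\<dots> \<le> ennreal k * (ennreal (decay_const DIM('a) a) * hl_maximal f z)"
    using r a d by (intro mult_left_mono decay_avg_le_hl_maximal) auto
  also have "\<dots> = ennreal (k * decay_const DIM('a) a) * hl_maximal f z"
    using k decay_const_pos[OF a] by (simp add: ennreal_mult mult.assoc)
  also have "k * decay_const DIM('a) a = 2 powr a * decay_const DIM('a) a * (t / r) powr (a - real DIM('a))"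
    by (simp add: k_def mult_ac)
  finally show ?thesis .
qed

lemma nn_integral_ball_decay_avg_far_le:
  fixes f :: "'a::euclidean_space \<Rightarrow> ennreal"
  assumes [measurable]: "f \<in> borel_measurable borel"
    and t: "0 < t" "t \<le> r" and a: "real DIM('a) < a"
  shows "(\<integral>\<^sup>+x\<in>ball z r. decay_avg a t (\<lambda>y. f y * indicator (- ball z (2 * r)) y) x \<partial>lborel)
    \<le> ennreal (2 powr a * decay_const DIM('a) a * unit_ball_vol DIM('a) * r ^ DIM('a)
        * (t / r) powr (a - real DIM('a))) * hl_maximal f z"
proof -
  define k where "k = 2 powr a * decay_const DIM('a) a * (t / r) powr (a - real DIM('a))"
  have k: "0 \<le> k" using decay_const_pos[OF a] by (simp add: k_def)
  have r: "0 < r" using t by linarith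
  have [measurable]: "ball z r \<in> sets borel" "- ball z (2 * r) \<in> sets borel" by auto
  have "(\<integral>\<^sup>+x\<in>ball z r. decay_avg a t (\<lambda>y. f y * indicator (- ball z (2 * r)) y) x \<partial>lborel)
      \<le> (\<integral>\<^sup>+x. (ennreal k * hl_maximal f z) * indicator (ball z r) x \<partial>lborel)"
  proof (rule nn_integral_mono)
    fix x
    show "decay_avg a t (\<lambda>y. f y * indicator (- ball z (2 * r)) y) x * indicator (ball z r) x
       \<le> (ennreal k * hl_maximal f z) * indicator (ball z r) x"
      unfolding k_def using t a
      by (cases "x \<in> ball z r") (auto intro!: decay_avg_far_le simp: dist_commute)
  qed
  also have "\<dots> = (ennreal k * hl_maximal f z) * emeasure lborel (ball z r)"
    by (rule nn_integral_cmult_indicator) measurable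
  also have "\<dots> = ennreal (2 powr a * decay_const DIM('a) a * unit_ball_vol DIM('a) * r ^ DIM('a)
        * (t / r) powr (a - real DIM('a))) * hl_maximal f z"
    using r k decay_const_pos[OF a]
    by (subst emeasure_ball, simp, subst mult.commute, subst mult.assoc[symmetric],
        subst ennreal_mult[symmetric]) (auto simp: k_def mult_ac)
  finally show ?thesis .
qed

lemma decay_avg_add:
  assumes [measurable]: "f \<in> borel_measurable borel" "g \<in> borel_measurable borel"
  shows "decay_avg a t (\<lambda>y. f y + g y) x = decay_avg a t f x + decay_avg a t g x"
  unfolding decay_avg_def distrib_left by (rule nn_integral_add) measurable

lemma decay_avg_cong: "(\<And>y. f y = g y) \<Longrightarrow> decay_avg a t f x = decay_avg a t g x"
  by (auto simp: decay_avg_def intro!: nn_integral_cong)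

text \<open>For t much smaller than r, the points of the ball are too far from z for a pointwise
  bound by the maximal function at z, and only the integral over the ball is controlled. The mass of
  f inside the doubled ball is handled by integrating in x first (the term
  \<open>2 ^ DIM('a)\<close>), the rest by the far estimate with its gain bounded by 1 (the term
  \<open>2 powr a\<close>).\<close>

lemma nn_integral_ball_decay_avg_le:
  fixes f :: "'a::euclidean_space \<Rightarrow> ennreal"
  assumes [measurable]: "f \<in> borel_measurable borel"
    and t: "0 < t" "t \<le> r" and a: "real DIM('a) < a"
  shows "(\<integral>\<^sup>+x\<in>ball z r. decay_avg a t f x \<partial>lborel)
    \<le> ennreal ((2 ^ DIM('a) + 2 powr a) * decay_const DIM('a) a * unit_ball_vol DIM('a) * r ^ DIM('a)) * hl_maximal f z"
proof -
  let ?n = "DIM('a)"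
  define C where "C = decay_const ?n a"
  have C: "0 < C" using decay_const_pos[OF a] by (simp add: C_def)
  define v where "v = unit_ball_vol (real ?n)"
  have v: "0 < v" by (simp add: v_def)
  have r: "0 < r" using t by linarith
  have [measurable]: "ball z r \<in> sets borel" "ball z (2 * r) \<in> sets borel" "- ball z (2 * r) \<in> sets borel" by auto
  let ?f0 = "\<lambda>y. f y * indicator (ball z (2 * r)) y" and ?f1 = "\<lambda>y. f y * indicator (- ball z (2 * r)) y"
  have "(\<integral>\<^sup>+x\<in>ball z r. decay_avg a t f x \<partial>lborel)
     = (\<integral>\<^sup>+x. decay_avg a t ?f0 x * indicator (ball z r) x + decay_avg a t ?f1 x * indicator (ball z r) x \<partial>lborel)"
    by (subst distrib_right[symmetric], subst decay_avg_add[symmetric], measurable)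
      (auto intro!: nn_integral_cong arg_cong2[where f="(*)"] decay_avg_cong simp: indicator_def)
  also have "\<dots> = (\<integral>\<^sup>+x. decay_avg a t ?f0 x * indicator (ball z r) x \<partial>lborel)
      + (\<integral>\<^sup>+x\<in>ball z r. decay_avg a t ?f1 x \<partial>lborel)"
    by (rule nn_integral_add) measurable
  also have "\<dots> \<le> ennreal (C * (v * (2 * r) ^ ?n)) * hl_maximal f z + ennreal (2 powr a * C * v * r ^ ?n) * hl_maximal f z"
  proof (rule add_mono)
    have "(\<integral>\<^sup>+x. decay_avg a t ?f0 x * indicator (ball z r) x \<partial>lborel) \<le> (\<integral>\<^sup>+x. decay_avg a t ?f0 x \<partial>lborel)"
      by (intro nn_integral_mono) (auto simp: indicator_def)
    also have "\<dots> \<le> ennreal C * (\<integral>\<^sup>+x. ?f0 x \<partial>lborel)"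
      unfolding C_def using t a by (intro nn_integral_decay_avg_le) auto
    also have "\<dots> \<le> ennreal C * (emeasure lborel (ball z (2 * r)) * hl_maximal f z)"
      using r by (intro mult_left_mono nn_integral_ball_le_hl_maximal) auto
    also have "\<dots> = ennreal (C * (v * (2 * r) ^ ?n)) * hl_maximal f z"
      using r C v by (subst emeasure_ball) (auto simp: v_def[symmetric] ennreal_mult mult.assoc)
    finally show "(\<integral>\<^sup>+x. decay_avg a t ?f0 x * indicator (ball z r) x \<partial>lborel) \<le> \<dots>" .
    have "(\<integral>\<^sup>+x\<in>ball z r. decay_avg a t ?f1 x \<partial>lborel)
        \<le> ennreal (2 powr a * C * v * r ^ ?n * (t / r) powr (a - real ?n)) * hl_maximal f z"
      unfolding C_def v_def using t a by (intro nn_integral_ball_decay_avg_far_le) auto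
    also have "\<dots> \<le> ennreal (2 powr a * C * v * r ^ ?n * 1) * hl_maximal f z"
      using C v r t a by (intro mult_right_mono ennreal_leI mult_left_mono powr_le1) auto
    finally show "(\<integral>\<^sup>+x\<in>ball z r. decay_avg a t ?f1 x \<partial>lborel)
        \<le> ennreal (2 powr a * C * v * r ^ ?n) * hl_maximal f z" by simp
  qed
  also have "\<dots> = ennreal ((2 ^ ?n + 2 powr a) * C * v * r ^ ?n) * hl_maximal f z"
  proof -
    have "C * (v * (2 * r) ^ ?n) + 2 powr a * C * v * r ^ ?n = (2 ^ ?n + 2 powr a) * C * v * r ^ ?n"
      by (simp add: power_mult_distrib algebra_simps)
    then show ?thesis
      using C v r by (simp add: distrib_right[symmetric] ennreal_plus[symmetric] del: ennreal_plus)
  qed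
  finally show ?thesis by (simp add: C_def v_def)
qed

section \<open>A square function estimate on nested cells\<close>

text \<open>Either v is at most \<eta> u, or u is at most v / \<eta>; in each case one of the two
  terms on the right suffices. The parameter \<eta> decides which of the two powers gets the small
  coefficient.\<close>

lemma ennreal_young:
  assumes s: "1 < s" and \<eta>: "0 < \<eta>"
  shows "ennreal_powr v (s - 1) * u \<le> ennreal (\<eta> powr (s - 1)) * ennreal_powr u s + ennreal (1 / \<eta>) * ennreal_powr v s"
proof -
  have split: "ennreal_powr x s = ennreal_powr x (s - 1) * x" for x
    using ennreal_powr_add[of x "s - 1" 1] by simp
  consider "v \<le> ennreal \<eta> * u" | "ennreal \<eta> * u \<le> v" by (meson linorder_linear)
  then show ?thesis
  proof cases
    case 1
    then have "ennreal_powr v (s - 1) * u \<le> ennreal_powr (ennreal \<eta> * u) (s - 1) * u"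
      using s by (intro mult_right_mono ennreal_powr_mono) auto
    also have "\<dots> = ennreal (\<eta> powr (s - 1)) * ennreal_powr u s"
      using \<eta> by (simp add: split ennreal_powr_mult ennreal_powr_ennreal mult.assoc)
    finally show ?thesis by (simp add: add_increasing2)
  next
    case 2
    have "u = ennreal (1 / \<eta>) * (ennreal \<eta> * u)"
      using \<eta> by (simp add: mult.assoc[symmetric] ennreal_mult[symmetric])
    also have "\<dots> \<le> ennreal (1 / \<eta>) * v"
      using 2 by (rule mult_left_mono) simp
    finally have "ennreal_powr v (s - 1) * u \<le> ennreal_powr v (s - 1) * (ennreal (1 / \<eta>) * v)"
      by (rule mult_left_mono) simp
    also have "\<dots> = ennreal (1 / \<eta>) * ennreal_powr v s"
      by (simp add: split mult_ac)
    finally show ?thesis by (simp add: add_increasing)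
  qed
qed

text \<open>Isolates b, so that a bound valid for all b in a family passes to their infimum.\<close>

lemma ennreal_diff_half_le_iff:
  fixes a b c :: ennreal
  assumes "c \<noteq> top"
  shows "(a - c) / 2 \<le> b \<longleftrightarrow> a \<le> 2 * b + c"
proof -
  have "(a - c) / 2 \<le> b \<longleftrightarrow> a - c \<le> 2 * b"
  proof
    assume "(a - c) / 2 \<le> b"
    then have "2 * ((a - c) / 2) \<le> 2 * b" by (rule mult_left_mono) simp
    also have "2 * ((a - c) / 2) = a - c"
      by (simp add: ennreal_times_divide mult.commute[of 2] mult_divide_eq_ennreal)
    finally show "a - c \<le> 2 * b" .
  next
    assume "a - c \<le> 2 * b"
    then show "(a - c) / 2 \<le> b" by (intro divide_le_posI_ennreal) auto
  qed
  also have "\<dots> \<longleftrightarrow> a \<le> 2 * b + c"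
    using assms by (subst ennreal_minus_le_iff) (simp only: add.commute simp_thms)
  finally show ?thesis .
qed

text \<open>The mean value theorem for the s-th power, the derivative being largest at the right
  end. Summed over dyadic scales, this produces the telescoping bound.\<close>

lemma powr_add_le:
  fixes u d s :: real
  assumes "1 < s" "0 \<le> u" "0 \<le> d"
  shows "(u + d) powr s \<le> u powr s + s * (u + d) powr (s - 1) * d"
proof (cases "u = 0 \<or> d = 0")
  case True
  show ?thesis
  proof (cases "d = 0")
    case False
    then have "0 < d" using assms by simp
    then have "d powr s = d powr (s - 1) * d" by (simp add: powr_diff)
    also have "\<dots> \<le> s * (d powr (s - 1) * d)"
      using assms mult_right_mono[of 1 s "d powr (s - 1) * d"] by simp
    finally show ?thesis using True False by (simp add: mult.assoc)
  qed simp
next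
  case False
  then have u: "0 < u" and d: "0 < d" using assms by auto
  have "\<exists>z>u. z < u + d \<and> (u + d) powr s - u powr s = (u + d - u) * (s * z powr (s - 1))"
  proof (rule MVT2[where f="\<lambda>x. x powr s" and f'="\<lambda>x. s * x powr (s - 1)"])
    show "u < u + d" using d by simp
    fix x assume "u \<le> x" "x \<le> u + d"
    then show "((\<lambda>x. x powr s) has_real_derivative s * x powr (s - 1)) (at x)"
      using u by (intro has_real_derivative_powr) auto
  qed
  then obtain z where z: "u < z" "z < u + d" "(u + d) powr s - u powr s = (u + d - u) * (s * z powr (s - 1))"
    by blast
  have "z powr (s - 1) \<le> (u + d) powr (s - 1)"
    using z u assms by (intro powr_mono2) auto
  then have "d * (s * z powr (s - 1)) \<le> d * (s * (u + d) powr (s - 1))"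
    using d assms by (intro mult_left_mono) auto
  moreover have "u + d - u = d" by simp
  ultimately have "(u + d) powr s - u powr s \<le> d * (s * (u + d) powr (s - 1))"
    using z(3) by metis
  then show ?thesis by (simp add: mult.assoc mult.left_commute mult.commute)
qed

lemma ennreal_powr_add_le_telescope:
  assumes "1 < s"
  shows "ennreal_powr (u + d) s \<le> ennreal_powr u s + ennreal s * (ennreal_powr (u + d) (s - 1) * d)"
proof (cases "u = top \<or> d = top")
  case True
  then show ?thesis using assms
    by (auto simp: ennreal_mult_top ennreal_top_mult)
next
  case False
  then obtain u' d' where [simp]: "u = ennreal u'" "d = ennreal d'" and nn: "0 \<le> u'" "0 \<le> d'"
    by (cases u; cases d) auto
  show ?thesis
    using powr_add_le[OF assms nn] nn assms
    by (simp add: ennreal_plus[symmetric] ennreal_powr_ennreal ennreal_mult[symmetric] mult.assoc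
      del: ennreal_plus)
qed

lemma nn_integral_split_cells:
  fixes cell :: "'a \<Rightarrow> nat"
  assumes [measurable]: "cell \<in> M \<rightarrow>\<^sub>M count_space UNIV" "T \<in> borel_measurable M"
  shows "(\<integral>\<^sup>+x. e (cell x) * T x \<partial>M) = (\<Sum>n. e n * (\<integral>\<^sup>+x. T x * indicator (cell -` {n}) x \<partial>M))"
proof -
  have "(\<integral>\<^sup>+x. e (cell x) * T x \<partial>M) = (\<integral>\<^sup>+x. (\<Sum>n. e n * (T x * indicator (cell -` {n}) x)) \<partial>M)"
  proof (rule nn_integral_cong)
    fix x
    have "(\<Sum>n. e n * (T x * indicator (cell -` {n}) x))
        = (\<Sum>n\<in>{cell x}. e n * (T x * indicator (cell -` {n}) x))"
      by (rule suminf_finite) (auto simp: indicator_def)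
    then show "e (cell x) * T x = (\<Sum>n. e n * (T x * indicator (cell -` {n}) x))"
      by simp
  qed
  also have "\<dots> = (\<Sum>n. \<integral>\<^sup>+x. e n * (T x * indicator (cell -` {n}) x) \<partial>M)"
    by (rule nn_integral_suminf) (simp add: vimage_def, measurable)
  also have "\<dots> = (\<Sum>n. e n * (\<integral>\<^sup>+x. T x * indicator (cell -` {n}) x \<partial>M))"
    by (intro arg_cong[where f=suminf] ext nn_integral_cmult) (simp add: vimage_def, measurable)
  finally show ?thesis .
qed

text \<open>
  Carleson embedding along a filtration: Abel summation in \<open>k\<close> writes \<open>h\<close> through its increments,
  and each increment only meets the tail of the \<open>D\<^sub>j\<close>, which is controlled on the cells.
\<close>

lemma carleson_embedding:
  fixes cell :: "nat \<Rightarrow> 'a \<Rightarrow> nat" and D :: "nat \<Rightarrow> 'a \<Rightarrow> ennreal"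
  assumes [measurable]: "\<And>k. cell k \<in> M \<rightarrow>\<^sub>M count_space UNIV"
    and [measurable]: "\<And>k. D k \<in> borel_measurable M" "W \<in> borel_measurable M"
    and nest: "\<And>k x y. cell (Suc k) x = cell (Suc k) y \<Longrightarrow> cell k x = cell k y"
    and loc: "\<And>k n. k \<le> L \<Longrightarrow> (\<integral>\<^sup>+x. (\<Sum>j=k..L. D j x) * indicator (cell k -` {n}) x \<partial>M)
        \<le> K * (\<integral>\<^sup>+x. W x * indicator (cell k -` {n}) x \<partial>M)"
    and mono: "\<And>k x. k < L \<Longrightarrow> h k (cell k x) \<le> h (Suc k) (cell (Suc k) x)"
  shows "(\<Sum>k\<le>L. \<integral>\<^sup>+x. h k (cell k x) * D k x \<partial>M) \<le> K * (\<integral>\<^sup>+x. h L (cell L x) * W x \<partial>M)"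
proof -
  have cellwise: "(\<integral>\<^sup>+x. e (cell k x) * (\<Sum>j=k..L. D j x) \<partial>M) \<le> K * (\<integral>\<^sup>+x. e (cell k x) * W x \<partial>M)"
    if k: "k \<le> L" for k and e :: "nat \<Rightarrow> ennreal"
  proof -
    have "(\<integral>\<^sup>+x. e (cell k x) * (\<Sum>j=k..L. D j x) \<partial>M)
        = (\<Sum>n. e n * (\<integral>\<^sup>+x. (\<Sum>j=k..L. D j x) * indicator (cell k -` {n}) x \<partial>M))"
      by (rule nn_integral_split_cells) measurable
    also have "\<dots> \<le> (\<Sum>n. e n * (K * (\<integral>\<^sup>+x. W x * indicator (cell k -` {n}) x \<partial>M)))"
      by (intro suminf_le mult_left_mono loc k) auto
    also have "\<dots> = K * (\<Sum>n. e n * (\<integral>\<^sup>+x. W x * indicator (cell k -` {n}) x \<partial>M))"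
      by (subst ennreal_suminf_cmult[symmetric]) (simp add: mult_ac)
    also have "\<dots> = K * (\<integral>\<^sup>+x. e (cell k x) * W x \<partial>M)"
      by (subst nn_integral_split_cells) auto
    finally show ?thesis .
  qed
  \<comment> \<open>\<open>par k\<close> sends the number of a cell to that of its parent. By
    nesting, any point of the cell gives the same answer; at numbers that belong to no cell the
    value is arbitrary and is never evaluated.\<close>
  define par where "par k n = cell k (SOME x. cell (Suc k) x = n)" for k n
  have par: "par k (cell (Suc k) x) = cell k x" for k x
    unfolding par_def by (rule nest) (rule someI[of _ x], simp)
  \<comment> \<open>Abel summation as an induction. Going from i to i + 1 leaves \<open>D i\<close>
    with its coefficient \<open>h i\<close> and raises the coefficient of the remaining tail by the
    increment; at \<open>i = L\<close> the tail is the single term \<open>D L\<close>.\<close>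
  have "(\<Sum>k<i. \<integral>\<^sup>+x. h k (cell k x) * D k x \<partial>M) + (\<integral>\<^sup>+x. h i (cell i x) * (\<Sum>j=i..L. D j x) \<partial>M)
      \<le> K * (\<integral>\<^sup>+x. h i (cell i x) * W x \<partial>M)" if "i \<le> L" for i
    using that
  proof (induction i)
    case 0
    then show ?case using cellwise[of 0 "h 0"] by simp
  next
    case (Suc i)
    \<comment> \<open>The increment depends only on the cell of generation i + 1, so the local
      estimate applies to it. Monotonicity makes the truncated subtraction of extended reals a
      genuine difference.\<close>
    define e where "e n = h (Suc i) n - h i (par i n)" for n
    have h: "h (Suc i) (cell (Suc i) x) = h i (cell i x) + e (cell (Suc i) x)" for x
      using mono[of i x] Suc.prems by (simp add: e_def par add_diff_inverse_ennreal)
    let ?S = "\<Sum>k<i. \<integral>\<^sup>+x. h k (cell k x) * D k x \<partial>M"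
    have "(\<Sum>k<Suc i. \<integral>\<^sup>+x. h k (cell k x) * D k x \<partial>M)
        + (\<integral>\<^sup>+x. h (Suc i) (cell (Suc i) x) * (\<Sum>j=Suc i..L. D j x) \<partial>M)
      = ?S + ((\<integral>\<^sup>+x. h i (cell i x) * D i x \<partial>M) + (\<integral>\<^sup>+x. h i (cell i x) * (\<Sum>j=Suc i..L. D j x) \<partial>M))
        + (\<integral>\<^sup>+x. e (cell (Suc i) x) * (\<Sum>j=Suc i..L. D j x) \<partial>M)"
      unfolding h distrib_right by (subst nn_integral_add) (auto simp: add_ac)
    also have "(\<integral>\<^sup>+x. h i (cell i x) * D i x \<partial>M) + (\<integral>\<^sup>+x. h i (cell i x) * (\<Sum>j=Suc i..L. D j x) \<partial>M)
        = (\<integral>\<^sup>+x. h i (cell i x) * (\<Sum>j=i..L. D j x) \<partial>M)"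
      using Suc.prems
      by (subst nn_integral_add[symmetric]) (auto simp: distrib_left[symmetric] sum.atLeast_Suc_atMost)
    also have "?S + (\<integral>\<^sup>+x. h i (cell i x) * (\<Sum>j=i..L. D j x) \<partial>M)
        + (\<integral>\<^sup>+x. e (cell (Suc i) x) * (\<Sum>j=Suc i..L. D j x) \<partial>M)
      \<le> K * (\<integral>\<^sup>+x. h i (cell i x) * W x \<partial>M) + K * (\<integral>\<^sup>+x. e (cell (Suc i) x) * W x \<partial>M)"
      using Suc by (intro add_mono cellwise) auto
    also have "\<dots> = K * (\<integral>\<^sup>+x. h (Suc i) (cell (Suc i) x) * W x \<partial>M)"
      unfolding h distrib_right by (subst nn_integral_add) (auto simp: distrib_left)
    finally show ?case .
  qed
  from this[of L] show ?thesis
    by (simp add: lessThan_Suc_atMost[symmetric])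
qed

section \<open>The absorption argument\<close>

definition good_const :: "real \<Rightarrow> real \<Rightarrow> real" where
  "good_const K s = s * (2 powr (s - 1) * 2 powr (s - 1) * K + 2 powr (s - 1) * K powr (s - 1))"

text \<open>Here c is the constant in front of the two mixed integrals. Each of them returns
  \<epsilon> times the integral to be bounded, so \<open>\<epsilon> = 1 / (4 * c)\<close> puts a
  total of one half on the right; moving it to the left doubles c. The two powers of \<epsilon> are
  the prices paid in Young's inequality.\<close>

definition absorb_const :: "real \<Rightarrow> real \<Rightarrow> real" where
  "absorb_const K s = (let c = good_const K s; \<epsilon> = 1 / (4 * c)
     in 2 * c * (\<epsilon> powr (1 - s) + \<epsilon> powr (- 1 / (s - 1))))"

text \<open>The argument free of kernels: \<open>loc\<close> is the local estimate for the scales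
  finer than a cell, \<open>osc\<close> the comparison of the coarser ones at two points of a cell.
  The size of the integral in \<open>fin\<close> does not enter the constant.\<close>

lemma nn_integral_powr_le_of_cells:
  fixes cell :: "nat \<Rightarrow> 'a \<Rightarrow> nat" and D :: "nat \<Rightarrow> 'a \<Rightarrow> ennreal"
  assumes cell [measurable]: "\<And>k. cell k \<in> M \<rightarrow>\<^sub>M count_space UNIV"
    and D [measurable]: "\<And>k. D k \<in> borel_measurable M" and W [measurable]: "W \<in> borel_measurable M"
    and nest: "\<And>k x y. cell (Suc k) x = cell (Suc k) y \<Longrightarrow> cell k x = cell k y"
    and loc: "\<And>k n. k \<le> L \<Longrightarrow> (\<integral>\<^sup>+x. (\<Sum>j=k..L. D j x) * indicator (cell k -` {n}) x \<partial>M)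
        \<le> ennreal K * (\<integral>\<^sup>+x. W x * indicator (cell k -` {n}) x \<partial>M)"
    and osc: "\<And>k x y. k \<le> L \<Longrightarrow> cell k x = cell k y \<Longrightarrow>
        (\<Sum>j\<le>k. D j x) \<le> 2 * (\<Sum>j\<le>k. D j y) + ennreal K * W x"
    and s: "1 < s" and K: "0 < K"
    and fin: "(\<integral>\<^sup>+x. ennreal_powr (\<Sum>j\<le>L. D j x) s \<partial>M) < top"
  shows "(\<integral>\<^sup>+x. ennreal_powr (\<Sum>j\<le>L. D j x) s \<partial>M)
    \<le> ennreal (absorb_const K s) * (\<integral>\<^sup>+x. ennreal_powr (W x) s \<partial>M)"
proof -
  define A where "A k x = (\<Sum>j\<le>k. D j x)" for k x
  have [measurable]: "A k \<in> borel_measurable M" for k unfolding A_def by measurable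
  \<comment> \<open>The embedding takes coefficients that are functions of the cell number and
    increase with k. The sums \<open>A k\<close> vary inside a cell; their infima over cells
    qualify.\<close>
  define b where "b k n = (INF y\<in>{y. cell k y = n}. A k y)" for k n
  define B where "B k x = b k (cell k x)" for k x
  have [measurable]: "B k \<in> borel_measurable M" for k
    unfolding B_def by (rule measurable_compose[OF cell]) simp
  have B_le: "B k x \<le> A k x" for k x
    unfolding B_def b_def by (rule INF_lower) simp
  have B_mono: "B k x \<le> B (Suc k) x" for k x
    unfolding B_def b_def
  proof (rule INF_mono)
    fix y assume "y \<in> {y. cell (Suc k) y = cell (Suc k) x}"
    then have "cell (Suc k) y = cell (Suc k) x" by simp
    then have "y \<in> {y. cell k y = cell k x}"
      by (simp only: mem_Collect_eq) (rule nest)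
    moreover have "A k y \<le> A (Suc k) y" by (simp add: A_def)
    ultimately show "\<exists>z\<in>{y. cell k y = cell k x}. A k z \<le> A (Suc k) y" by blast
  qed
  have A_le_B: "A k x \<le> 2 * B k x + ennreal K * W x" if "k \<le> L" for k x
  proof -
    show ?thesis
    proof (cases "ennreal K * W x = top")
      case False
      have "(A k x - ennreal K * W x) / 2 \<le> B k x"
        unfolding B_def b_def
      proof (rule INF_greatest)
        fix y assume "y \<in> {y. cell k y = cell k x}"
        then have "cell k x = cell k y" by simp
        from osc[OF that this] show "(A k x - ennreal K * W x) / 2 \<le> A k y"
          unfolding A_def ennreal_diff_half_le_iff[OF False] .
      qed
      then show ?thesis by (simp only: ennreal_diff_half_le_iff[OF False])
    qed simp
  qed
  define c1 where "c1 = 2 powr (s - 1) * 2 powr (s - 1)"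
  define c2 where "c2 = 2 powr (s - 1) * K powr (s - 1)"
  define c where "c = s * (c1 * K + c2)"
  have c_pos: "0 < c1" "0 < c2" "0 < c" using s K by (auto simp: c1_def c2_def c_def add_pos_pos)
  have A_powr: "ennreal_powr (A k x) (s - 1)
      \<le> ennreal c1 * ennreal_powr (B k x) (s - 1) + ennreal c2 * ennreal_powr (W x) (s - 1)" if "k \<le> L" for k x
  proof -
    have "ennreal_powr (A k x) (s - 1) \<le> ennreal_powr (2 * B k x + ennreal K * W x) (s - 1)"
      using s by (intro ennreal_powr_mono A_le_B that) auto
    also have "\<dots> \<le> ennreal (2 powr (s - 1)) * (ennreal_powr (2 * B k x) (s - 1) + ennreal_powr (ennreal K * W x) (s - 1))"
      using s by (intro ennreal_powr_add_le) auto
    also have "\<dots> = ennreal c1 * ennreal_powr (B k x) (s - 1) + ennreal c2 * ennreal_powr (W x) (s - 1)"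
      using K ennreal_powr_ennreal[of 2 "s - 1"]
      by (simp add: ennreal_powr_mult ennreal_powr_ennreal c1_def c2_def ennreal_mult distrib_left mult.assoc)
    finally show ?thesis .
  qed
  \<comment> \<open>The power of the partial sum at j, and not that of the full sum, multiplies
    \<open>D j\<close>: only the coarse part up to j is controlled by its infimum over the cells of
    generation j.\<close>
  have tele: "ennreal_powr (A k x) s \<le> (\<Sum>j\<le>k. ennreal s * (ennreal_powr (A j x) (s - 1) * D j x))" for k x
  proof (induction k)
    case 0
    show ?case
      using ennreal_powr_add_le_telescope[OF s, of 0 "D 0 x"] by (simp add: A_def)
  next
    case (Suc k)
    have "ennreal_powr (A (Suc k) x) s
        \<le> ennreal_powr (A k x) s + ennreal s * (ennreal_powr (A (Suc k) x) (s - 1) * D (Suc k) x)"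
      using ennreal_powr_add_le_telescope[OF s, of "A k x" "D (Suc k) x"] by (simp add: A_def)
    also have "\<dots> \<le> (\<Sum>j\<le>Suc k. ennreal s * (ennreal_powr (A j x) (s - 1) * D j x))"
      using Suc by (simp add: add_right_mono)
    finally show ?case .
  qed
  let ?I = "\<integral>\<^sup>+x. ennreal_powr (A L x) s \<partial>M" and ?J = "\<integral>\<^sup>+x. ennreal_powr (W x) s \<partial>M"
  let ?U = "\<integral>\<^sup>+x. ennreal_powr (A L x) (s - 1) * W x \<partial>M" and ?V = "\<integral>\<^sup>+x. ennreal_powr (W x) (s - 1) * A L x \<partial>M"
  have "?I \<le> (\<integral>\<^sup>+x. (\<Sum>j\<le>L. ennreal s * ((ennreal c1 * ennreal_powr (B j x) (s - 1)
      + ennreal c2 * ennreal_powr (W x) (s - 1)) * D j x)) \<partial>M)"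
    by (intro nn_integral_mono order_trans[OF tele] sum_mono mult_left_mono mult_right_mono A_powr) auto
  also have "\<dots> = (\<Sum>j\<le>L. \<integral>\<^sup>+x. ennreal s * ((ennreal c1 * ennreal_powr (B j x) (s - 1)
      + ennreal c2 * ennreal_powr (W x) (s - 1)) * D j x) \<partial>M)"
    by (rule nn_integral_sum) measurable
  also have "\<dots> = (\<Sum>j\<le>L. ennreal s * (ennreal c1 * (\<integral>\<^sup>+x. ennreal_powr (B j x) (s - 1) * D j x \<partial>M)
      + ennreal c2 * (\<integral>\<^sup>+x. ennreal_powr (W x) (s - 1) * D j x \<partial>M)))"
    by (intro sum.cong refl) (simp add: nn_integral_cmult nn_integral_add distrib_right mult.assoc)
  also have "\<dots> = ennreal s * (ennreal c1 * (\<Sum>j\<le>L. \<integral>\<^sup>+x. ennreal_powr (B j x) (s - 1) * D j x \<partial>M)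
      + ennreal c2 * (\<Sum>j\<le>L. \<integral>\<^sup>+x. ennreal_powr (W x) (s - 1) * D j x \<partial>M))"
    by (simp add: sum_distrib_left sum.distrib distrib_left)
  \<comment> \<open>The coefficient containing W does not depend on j, so here the layers simply add
    up to \<open>A L\<close>.\<close>
  also have "(\<Sum>j\<le>L. \<integral>\<^sup>+x. ennreal_powr (W x) (s - 1) * D j x \<partial>M) = ?V"
    by (simp add: A_def sum_distrib_left nn_integral_sum)
  also have "(\<Sum>j\<le>L. \<integral>\<^sup>+x. ennreal_powr (B j x) (s - 1) * D j x \<partial>M)
      \<le> ennreal K * (\<integral>\<^sup>+x. ennreal_powr (B L x) (s - 1) * W x \<partial>M)"
    unfolding B_def
  proof (rule carleson_embedding[where h="\<lambda>k n. ennreal_powr (b k n) (s - 1)"])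
    show "ennreal_powr (b k (cell k x)) (s - 1) \<le> ennreal_powr (b (Suc k) (cell (Suc k) x)) (s - 1)" for k x
      using s B_mono[of k x] by (intro ennreal_powr_mono) (simp_all add: B_def)
  qed (fact cell D W nest loc)+
  also have "(\<integral>\<^sup>+x. ennreal_powr (B L x) (s - 1) * W x \<partial>M) \<le> ?U"
    using s by (intro nn_integral_mono mult_right_mono ennreal_powr_mono B_le) auto
  also have "ennreal s * (ennreal c1 * (ennreal K * ?U) + ennreal c2 * ?V) \<le> ennreal c * (?U + ?V)"
  proof -
    have "ennreal s * (ennreal c1 * (ennreal K * ?U) + ennreal c2 * ?V)
        = ennreal (s * (c1 * K)) * ?U + ennreal (s * c2) * ?V"
      using s K c_pos by (simp add: ennreal_mult distrib_left mult.assoc)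
    also have "\<dots> \<le> ennreal c * ?U + ennreal c * ?V"
      using s K c_pos by (intro add_mono mult_right_mono ennreal_leI) (auto simp: c_def)
    finally show ?thesis by (simp add: distrib_left)
  qed
  finally have main: "?I \<le> ennreal c * (?U + ?V)"
    by (simp add: mult_left_mono add_mono)
  define \<epsilon> where "\<epsilon> = 1 / (4 * c)"
  have \<epsilon>: "0 < \<epsilon>" using c_pos by (simp add: \<epsilon>_def)
  define d1 where "d1 = \<epsilon> powr (1 - s)"
  define d2 where "d2 = \<epsilon> powr (- 1 / (s - 1))"
  have d: "0 \<le> d1" "0 \<le> d2" by (auto simp: d1_def d2_def)
  \<comment> \<open>Young's inequality is used twice with different parameters: \<eta> =
    1/\<epsilon> for U, where A carries the power s - 1, and \<eta> = \<epsilon>^(1/(s-1)) for V,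
    where A occurs linearly. Both times the s-th power of A receives the factor \<epsilon>.\<close>
  have "?U \<le> (\<integral>\<^sup>+x. ennreal \<epsilon> * ennreal_powr (A L x) s + ennreal d1 * ennreal_powr (W x) s \<partial>M)"
  proof (rule nn_integral_mono)
    fix x
    have "ennreal_powr (A L x) (s - 1) * W x \<le> ennreal ((1 / \<epsilon>) powr (s - 1)) * ennreal_powr (W x) s
        + ennreal (1 / (1 / \<epsilon>)) * ennreal_powr (A L x) s"
      using \<epsilon> by (intro ennreal_young s) auto
    also have "(1 / \<epsilon>) powr (s - 1) = d1"
      using \<epsilon> by (simp add: d1_def powr_divide powr_diff)
    finally show "ennreal_powr (A L x) (s - 1) * W x
        \<le> ennreal \<epsilon> * ennreal_powr (A L x) s + ennreal d1 * ennreal_powr (W x) s"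
      by (simp add: add.commute)
  qed
  also have "\<dots> = ennreal \<epsilon> * ?I + ennreal d1 * ?J"
    by (simp add: nn_integral_add nn_integral_cmult)
  finally have U: "?U \<le> ennreal \<epsilon> * ?I + ennreal d1 * ?J" .
  have "?V \<le> (\<integral>\<^sup>+x. ennreal \<epsilon> * ennreal_powr (A L x) s + ennreal d2 * ennreal_powr (W x) s \<partial>M)"
  proof (rule nn_integral_mono)
    fix x
    have "ennreal_powr (W x) (s - 1) * A L x \<le> ennreal ((\<epsilon> powr (1 / (s - 1))) powr (s - 1)) * ennreal_powr (A L x) s
        + ennreal (1 / (\<epsilon> powr (1 / (s - 1)))) * ennreal_powr (W x) s"
      using \<epsilon> by (intro ennreal_young s) auto
    also have "(\<epsilon> powr (1 / (s - 1))) powr (s - 1) = \<epsilon>"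
      using \<epsilon> s by (simp add: powr_powr)
    also have "1 / (\<epsilon> powr (1 / (s - 1))) = d2"
      using \<epsilon> s by (simp add: d2_def powr_minus_divide)
    finally show "ennreal_powr (W x) (s - 1) * A L x
        \<le> ennreal \<epsilon> * ennreal_powr (A L x) s + ennreal d2 * ennreal_powr (W x) s" .
  qed
  also have "\<dots> = ennreal \<epsilon> * ?I + ennreal d2 * ?J"
    by (simp add: nn_integral_add nn_integral_cmult)
  finally have V: "?V \<le> ennreal \<epsilon> * ?I + ennreal d2 * ?J" .
  have I_fin: "?I < top" using fin by (simp add: A_def)
  show ?thesis
  proof (cases "?J = top")
    case True
    have "0 < absorb_const K s"
      using c_pos \<epsilon> d unfolding absorb_const_def good_const_def Let_def
      by (simp add: c_def[symmetric] c1_def[symmetric] c2_def[symmetric] \<epsilon>_def[symmetric])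
         (auto simp: add_pos_pos)
    then show ?thesis using True by (simp add: ennreal_mult_top)
  next
    case False
    obtain i j where ij: "?I = ennreal i" "?J = ennreal j" "0 \<le> i" "0 \<le> j"
      using I_fin False by (cases ?I; cases ?J) (auto simp: top_unique less_top)
    have "ennreal i \<le> ennreal c * ((ennreal \<epsilon> * ennreal i + ennreal d1 * ennreal j) + (ennreal \<epsilon> * ennreal i + ennreal d2 * ennreal j))"
      using order_trans[OF main mult_left_mono[OF add_mono[OF U V]]] by (simp add: ij)
    also have "\<dots> = ennreal (c * ((\<epsilon> * i + d1 * j) + (\<epsilon> * i + d2 * j)))"
      using c_pos \<epsilon> d ij by (simp add: ennreal_mult[symmetric] ennreal_plus[symmetric] del: ennreal_plus)
    finally have "i \<le> c * ((\<epsilon> * i + d1 * j) + (\<epsilon> * i + d2 * j))"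
      using c_pos \<epsilon> d ij by (subst (asm) ennreal_le_iff) auto
    also have "\<dots> = (2 * (c * \<epsilon>)) * i + c * (d1 + d2) * j"
      by (simp add: algebra_simps)
    also have "c * \<epsilon> = 1 / 4" using c_pos by (simp add: \<epsilon>_def)
    finally have "i \<le> 2 * c * (d1 + d2) * j" by simp
    moreover have "2 * c * (d1 + d2) = absorb_const K s"
      unfolding absorb_const_def good_const_def Let_def d1_def d2_def \<epsilon>_def c_def c1_def c2_def by simp
    moreover have "0 \<le> 2 * c * (d1 + d2)"
      using c_pos d by simp
    ultimately have "i \<le> absorb_const K s * j" "0 \<le> absorb_const K s"
      by simp_all
    then have "?I \<le> ennreal (absorb_const K s) * ?J"
      using ij by (simp add: ennreal_mult[symmetric] ennreal_leI)
    then show ?thesis by (simp add: A_def)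
  qed
qed

section \<open>Pointwise bounds and measurability of the multilinear operators\<close>

text \<open>A Caratheodory function, measurable in one variable and continuous in the other, is
  jointly measurable. Replacing y by a simple function of y leaves finitely many measurable pieces,
  and continuity lets these approximations converge.\<close>

lemma borel_measurable_caratheodory:
  fixes f :: "'a \<Rightarrow> 'b::{metric_space, second_countable_topology} \<Rightarrow> 'c::metric_space"
  assumes meas: "\<And>y. (\<lambda>t. f t y) \<in> borel_measurable M"
    and cont: "\<And>t. t \<in> space M \<Longrightarrow> continuous_on UNIV (f t)"
  shows "(\<lambda>(t, y). f t y) \<in> borel_measurable (M \<Otimes>\<^sub>M borel)"
proof -
  obtain F :: "nat \<Rightarrow> 'b \<Rightarrow> 'b" where F: "\<And>i. simple_function borel (F i)" "\<And>y. (\<lambda>i. F i y) \<longlonglongrightarrow> y"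
    using borel_measurable_implies_sequence_metric[of "\<lambda>y. y" borel undefined] by auto
  show ?thesis
  proof (rule borel_measurable_LIMSEQ_metric)
    fix i
    have g: "(\<lambda>p. F i (snd p)) \<in> M \<Otimes>\<^sub>M borel \<rightarrow>\<^sub>M count_space (range (F i))"
    proof (rule measurable_compose[OF measurable_snd])
      show "F i \<in> borel \<rightarrow>\<^sub>M count_space (range (F i))"
        using F(1)[of i] unfolding simple_function_def
        by (subst measurable_count_space_eq2) auto
    qed
    have "(\<lambda>p. f (fst p) (F i (snd p))) \<in> borel_measurable (M \<Otimes>\<^sub>M borel)"
    proof (rule measurable_compose_countable'[where f="\<lambda>y p. f (fst p) y", OF _ g])
      show "(\<lambda>p. f (fst p) y) \<in> borel_measurable (M \<Otimes>\<^sub>M borel)" for y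
        by (rule measurable_compose[OF measurable_fst meas])
      show "countable (range (F i))"
        using F(1)[of i] by (auto simp: simple_function_def intro: countable_finite)
    qed
    then show "(\<lambda>(t, y). f t (F i y)) \<in> borel_measurable (M \<Otimes>\<^sub>M borel)"
      by (simp add: case_prod_unfold)
  next
    fix p assume "p \<in> space (M \<Otimes>\<^sub>M (borel :: 'b measure))"
    then have "fst p \<in> space M" by (auto simp: space_pair_measure)
    then have "isCont (f (fst p)) (snd p)"
      using cont by (simp add: continuous_on_eq_continuous_at)
    then show "(\<lambda>i. case p of (t, y) \<Rightarrow> f t (F i y)) \<longlonglongrightarrow> (case p of (t, y) \<Rightarrow> f t y)"
      unfolding case_prod_unfold by (intro isCont_tendsto_compose[where g="f (fst p)"] F(2))
  qed
qed

text \<open>The kernel is measurable in t only for the completed measure, so the scale variable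
  keeps Lebesgue measure; exchanging integrals over space and scale then calls for its
  sigma-finiteness.\<close>

lemma sigma_finite_lebesgue: "sigma_finite_measure (lebesgue :: 'a::euclidean_space measure)"
proof
  let ?A = "range (\<lambda>n::nat. cball (0::'a) (real n))"
  have "\<exists>n::nat. norm x \<le> real n" for x :: 'a by (rule real_arch_simple)
  then have "\<Union>?A = space lebesgue" by auto
  moreover have "emeasure lebesgue (cball (0::'a) (real n)) \<noteq> \<infinity>" for n
    by (simp add: emeasure_cball)
  ultimately show "\<exists>A. countable A \<and> A \<subseteq> sets (lebesgue :: 'a measure) \<and> \<Union>A = space lebesgue
      \<and> (\<forall>a\<in>A. emeasure lebesgue a \<noteq> \<infinity>)"
    by (intro exI[of _ ?A]) auto
qed

interpretation lebesgue: sigma_finite_measure "lebesgue :: 'a::euclidean_space measure"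
  by (rule sigma_finite_lebesgue)

text \<open>Through this factorisation every estimate in m variables becomes a product of
  one-variable averages.\<close>

lemma kernel_decay_eq_prod_decay:
  fixes x :: "real^'n" and y :: "real^'n^'m"
  assumes "0 < t"
  shows "kernel_decay N \<gamma> t x y = (\<Prod>j\<in>UNIV. decay (N + \<gamma>) t (x - y $ j))"
proof -
  have "(\<Prod>j\<in>(UNIV::'m set). decay (N + \<gamma>) t (x - y $ j))
     = (\<Prod>j\<in>UNIV. (1 + norm (x - y $ j) / t) powr - (N + \<gamma>)) / t ^ (CARD('m) * CARD('n))"
    by (simp add: decay_def prod_dividef power_mult[symmetric] mult.commute)
  also have "(\<Prod>j\<in>(UNIV::'m set). (1 + norm (x - y $ j) / t) powr - (N + \<gamma>))
      = 1 / (\<Prod>j\<in>UNIV. (1 + norm (x - y $ j) / t) powr (N + \<gamma>))"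
    by (simp only: powr_minus_divide prod_dividef prod.neutral_const)
  finally show ?thesis by (simp add: kernel_decay_def mult.commute)
qed

lemma borel_measurable_kernel_decay [measurable]: "kernel_decay N \<gamma> t x \<in> borel_measurable borel"
  unfolding kernel_decay_def by measurable

lemma decay_le:
  fixes z :: "'a::euclidean_space"
  assumes "0 < t" "0 \<le> a"
  shows "decay a t z \<le> 1 / t ^ DIM('a)"
proof -
  have "(1 + norm z / t) powr (- a) \<le> 1 powr (- a)"
    using assms by (intro powr_mono2') auto
  then show ?thesis using assms by (simp add: decay_def divide_right_mono)
qed

lemma kernel_decay_le:
  fixes x :: "real^'n" and y :: "real^'n^'m"
  assumes "0 < t" "0 \<le> N + \<gamma>"
  shows "0 \<le> kernel_decay N \<gamma> t x y" "kernel_decay N \<gamma> t x y \<le> (1 / t ^ CARD('n)) ^ CARD('m)"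
proof -
  show "0 \<le> kernel_decay N \<gamma> t x y"
    using assms by (simp add: kernel_decay_eq_prod_decay prod_nonneg)
  have "(\<Prod>j\<in>(UNIV::'m set). decay (N + \<gamma>) t (x - y $ j)) \<le> (\<Prod>j\<in>(UNIV::'m set). 1 / t ^ CARD('n))"
    using assms decay_le[of t "N + \<gamma>" "x - y $ _"] by (intro prod_mono) auto
  then show "kernel_decay N \<gamma> t x y \<le> (1 / t ^ CARD('n)) ^ CARD('m)"
    using assms by (simp add: kernel_decay_eq_prod_decay)
qed

lemma square_function_kernelD:
  assumes "square_function_kernel N \<gamma> A \<theta>"
  shows "(\<lambda>t. \<theta> t x y) \<in> borel_measurable (lebesgue_on {0<..})"
    and "0 < t \<Longrightarrow> norm (\<theta> t x y) \<le> A * kernel_decay N \<gamma> t x y"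
    and "0 < t \<Longrightarrow> norm (\<theta> t x y - \<theta> t x (replace_coord y i z))
        \<le> A * (norm (y $ i - z) / t) powr \<gamma> * kernel_decay N \<gamma> t x y"
    and "0 < t \<Longrightarrow> norm (\<theta> t x y - \<theta> t x' y) \<le> A * (norm (x - x') / t) powr \<gamma> * kernel_decay N \<gamma> t x y"
  using assms by (auto simp: square_function_kernel_def)

text \<open>Condition (K2) moves one coordinate at a time, so two points are joined by m such moves.
  The decay factor is at most a constant depending on t only, which makes the choice of intermediate
  points irrelevant.\<close>

lemma continuous_kernel:
  fixes \<theta> :: "real \<Rightarrow> real^'n \<Rightarrow> real^'n^'m \<Rightarrow> complex"
  assumes ker: "square_function_kernel N \<gamma> A \<theta>" and A: "0 < A" and \<gamma>: "0 < \<gamma>" and N: "0 \<le> N + \<gamma>" and t: "0 < t"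
  shows "continuous_on UNIV (\<theta> t x)"
proof -
  define c where "c = A * (1 / t ^ CARD('n)) ^ CARD('m)"
  \<comment> \<open>S is the set of coordinates already replaced by those of
    \<open>y'\<close>.\<close>
  have diff: "norm (\<theta> t x y - \<theta> t x (\<chi> j. if j \<in> S then y' $ j else y $ j))
      \<le> (\<Sum>i\<in>S. c * (norm (y $ i - y' $ i) / t) powr \<gamma>)" for y y' S
  proof (induction S rule: infinite_finite_induct)
    case (insert i S)
    let ?u = "\<chi> j. if j \<in> S then y' $ j else y $ j"
    have eq: "(\<chi> j. if j \<in> insert i S then y' $ j else y $ j) = replace_coord ?u i (y' $ i)"
      by (auto simp: replace_coord_def vec_eq_iff)
    have "norm (\<theta> t x ?u - \<theta> t x (replace_coord ?u i (y' $ i)))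
        \<le> A * (norm (?u $ i - y' $ i) / t) powr \<gamma> * kernel_decay N \<gamma> t x ?u"
      by (rule square_function_kernelD(3)[OF ker t])
    also have "\<dots> \<le> A * (norm (?u $ i - y' $ i) / t) powr \<gamma> * (1 / t ^ CARD('n)) ^ CARD('m)"
      using A by (intro mult_left_mono kernel_decay_le t N) auto
    also have "\<dots> = c * (norm (y $ i - y' $ i) / t) powr \<gamma>"
      using insert by (simp add: c_def)
    finally have "norm (\<theta> t x y - \<theta> t x (replace_coord ?u i (y' $ i)))
        \<le> (\<Sum>i\<in>S. c * (norm (y $ i - y' $ i) / t) powr \<gamma>) + c * (norm (y $ i - y' $ i) / t) powr \<gamma>"
      using insert.IH norm_triangle_ineq[of "\<theta> t x y - \<theta> t x ?u" "\<theta> t x ?u - \<theta> t x (replace_coord ?u i (y' $ i))"]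
      by simp
    then show ?case
      using insert.hyps unfolding eq by (simp add: add.commute)
  qed auto
  have "(\<theta> t x \<longlongrightarrow> \<theta> t x y) (at y)" for y
  proof -
    have "((\<lambda>y'. \<Sum>i\<in>UNIV. c * (norm (y $ i - y' $ i) / t) powr \<gamma>)
        \<longlongrightarrow> (\<Sum>i\<in>(UNIV::'m set). c * (norm (y $ i - y $ i) / t) powr \<gamma>)) (at y)"
      using \<gamma> t by (intro tendsto_intros tendsto_sum tendsto_mult tendsto_powr' tendsto_divide tendsto_norm) auto
    then have "((\<lambda>y'. \<Sum>i\<in>UNIV. c * (norm (y $ i - y' $ i) / t) powr \<gamma>) \<longlongrightarrow> 0) (at y)"
      by simp
    moreover have "norm (\<theta> t x y' - \<theta> t x y) \<le> (\<Sum>i\<in>UNIV. c * (norm (y $ i - y' $ i) / t) powr \<gamma>)" for y'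
      using diff[of y UNIV y'] by (simp add: norm_minus_commute)
    then have "\<forall>\<^sub>F y' in at y. norm (\<theta> t x y' - \<theta> t x y) \<le> (\<Sum>i\<in>UNIV. c * (norm (y $ i - y' $ i) / t) powr \<gamma>)"
      by (intro always_eventually allI)
    ultimately have "((\<lambda>y'. \<theta> t x y' - \<theta> t x y) \<longlongrightarrow> 0) (at y)"
      by (rule Lim_null_comparison[rotated])
    then show ?thesis by (simp add: LIM_zero_iff)
  qed
  then show ?thesis by (simp add: continuous_on_def)
qed

section \<open>Domination of \<open>Theta\<close> by products of averages\<close>

definition tensor :: "('m::finite \<Rightarrow> 'a \<Rightarrow> complex) \<Rightarrow> 'a^'m \<Rightarrow> complex" where
  "tensor f y = (\<Prod>i\<in>UNIV. f i (y $ i))"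

text \<open>Up to the factor A this dominates \<open>norm (Theta \<theta> t f x)\<close>. Its
  finiteness means that the integral defining \<open>Theta\<close> converges absolutely, and is the
  standing assumption \<open>fin\<close> below.\<close>

definition Decay_prod :: "real \<Rightarrow> real \<Rightarrow> ('m::finite \<Rightarrow> 'a::euclidean_space \<Rightarrow> complex) \<Rightarrow> 'a \<Rightarrow> ennreal" where
  "Decay_prod a t f x = (\<Prod>i\<in>UNIV. decay_avg a t (\<lambda>y. ennreal (norm (f i y))) x)"

lemma borel_measurable_tensor [measurable]:
  assumes [measurable]: "\<And>i. f i \<in> borel_measurable borel"
  shows "tensor f \<in> borel_measurable (borel :: ('a::euclidean_space^'m) measure)"
  unfolding tensor_def by measurable

lemma nn_integral_kernel_decay_prod:
  fixes h :: "'m::finite \<Rightarrow> real^'n \<Rightarrow> ennreal"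
  assumes [measurable]: "\<And>i. h i \<in> borel_measurable borel" and t: "0 < t"
  shows "(\<integral>\<^sup>+y. ennreal (kernel_decay N \<gamma> t x y) * (\<Prod>i\<in>UNIV. h i (y $ i)) \<partial>lborel)
    = (\<Prod>i\<in>UNIV. decay_avg (N + \<gamma>) t (h i) x)"
proof -
  have "(\<integral>\<^sup>+y. ennreal (kernel_decay N \<gamma> t x y) * (\<Prod>i\<in>UNIV. h i (y $ i)) \<partial>(lborel :: (real^'n^'m) measure))
    = (\<integral>\<^sup>+y. (\<Prod>i\<in>UNIV. ennreal (decay (N + \<gamma>) t (x - y $ i)) * h i (y $ i)) \<partial>lborel)"
    using t by (intro nn_integral_cong)
      (simp add: kernel_decay_eq_prod_decay prod.distrib prod_ennreal)
  also have "\<dots> = (\<Prod>i\<in>UNIV. decay_avg (N + \<gamma>) t (h i) x)"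
    unfolding decay_avg_def by (rule nn_integral_prod_vec) measurable
  finally show ?thesis .
qed

lemma nn_integral_kernel_decay_tensor:
  fixes f :: "'m::finite \<Rightarrow> real^'n \<Rightarrow> complex"
  assumes [measurable]: "\<And>i. f i \<in> borel_measurable borel" and t: "0 < t"
  shows "(\<integral>\<^sup>+y. ennreal (kernel_decay N \<gamma> t x y * norm (tensor f y)) \<partial>lborel) = Decay_prod (N + \<gamma>) t f x"
proof -
  have "0 \<le> kernel_decay N \<gamma> t x y" for y :: "real^'n^'m"
    using t by (simp add: kernel_decay_eq_prod_decay prod_nonneg)
  then have "(\<integral>\<^sup>+y. ennreal (kernel_decay N \<gamma> t x y * norm (tensor f y)) \<partial>lborel)
     = (\<integral>\<^sup>+y. ennreal (kernel_decay N \<gamma> t x y) * (\<Prod>i\<in>UNIV. ennreal (norm (f i (y $ i)))) \<partial>lborel)"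
    by (intro nn_integral_cong) (simp add: tensor_def ennreal_mult prod_norm[symmetric] prod_ennreal prod_nonneg)
  then show ?thesis
    using nn_integral_kernel_decay_prod[where h="\<lambda>i y. ennreal (norm (f i y))", OF _ t]
    by (simp add: Decay_prod_def)
qed

locale square_kernel =
  fixes \<theta> :: "real \<Rightarrow> real^'n \<Rightarrow> real^'n^'m \<Rightarrow> complex" and N \<gamma> A :: real
  assumes ker: "square_function_kernel N \<gamma> A \<theta>" and A: "0 < A" and \<gamma>: "0 < \<gamma>"
    and dim_less: "real CARD('n) < N"
begin

lemma exponent: "real DIM(real^'n) < N + \<gamma>"
  using dim_less \<gamma> by simp

lemma N: "0 \<le> N + \<gamma>"
  using dim_less \<gamma> by linarith

lemma borel_measurable_kernel: "0 < t \<Longrightarrow> \<theta> t x \<in> borel_measurable borel"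
  by (intro borel_measurable_continuous_onI continuous_kernel[OF ker A \<gamma> N])

lemma Theta_eq_lborel:
  assumes [measurable]: "\<And>i. f i \<in> borel_measurable borel" and t: "0 < t"
  shows "Theta \<theta> t f x = (\<integral>y. \<theta> t x y * tensor f y \<partial>lborel)"
proof -
  note [measurable] = borel_measurable_kernel[OF t]
  show ?thesis
    unfolding Theta_def tensor_def[symmetric] by (rule integral_completion) measurable
qed

lemma integrable_kernel_tensor:
  assumes [measurable]: "\<And>i. f i \<in> borel_measurable borel" and t: "0 < t"
    and fin: "Decay_prod (N + \<gamma>) t f x < top"
  shows "integrable lborel (\<lambda>y. \<theta> t x y * tensor f y)"
proof (rule integrableI_bounded)
  note [measurable] = borel_measurable_kernel[OF t]
  show "(\<lambda>y. \<theta> t x y * tensor f y) \<in> borel_measurable lborel" by measurable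
  have "(\<integral>\<^sup>+y. ennreal (norm (\<theta> t x y * tensor f y)) \<partial>lborel)
      \<le> (\<integral>\<^sup>+y. ennreal A * ennreal (kernel_decay N \<gamma> t x y * norm (tensor f y)) \<partial>lborel)"
  proof (rule nn_integral_mono)
    fix y :: "real^'n^'m"
    have "norm (\<theta> t x y * tensor f y) \<le> A * (kernel_decay N \<gamma> t x y * norm (tensor f y))"
      using square_function_kernelD(2)[OF ker t, of x y]
      by (simp add: norm_mult mult.assoc[symmetric] mult_right_mono)
    then show "ennreal (norm (\<theta> t x y * tensor f y)) \<le> ennreal A * ennreal (kernel_decay N \<gamma> t x y * norm (tensor f y))"
      using A kernel_decay_le(1)[OF t N, of x y] by (simp add: ennreal_mult[symmetric] ennreal_leI)
  qed
  also have "\<dots> = ennreal A * Decay_prod (N + \<gamma>) t f x"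
    by (subst nn_integral_cmult) (measurable, simp add: nn_integral_kernel_decay_tensor[OF _ t])
  also have "\<dots> < \<infinity>" using fin by (simp add: ennreal_mult_less_top)
  finally show "(\<integral>\<^sup>+y. ennreal (norm (\<theta> t x y * tensor f y)) \<partial>lborel) < \<infinity>" .
qed

lemma norm_kernel_integral_le:
  fixes k :: "real^'n^'m \<Rightarrow> complex" and h :: "real^'n^'m \<Rightarrow> ennreal"
  assumes "integrable lborel k" "\<And>y. ennreal (norm (k y)) \<le> h y"
  shows "ennreal (norm (\<integral>y. k y \<partial>lborel)) \<le> (\<integral>\<^sup>+y. h y \<partial>lborel)"
proof -
  have "ennreal (norm (\<integral>y. k y \<partial>lborel)) \<le> (\<integral>\<^sup>+y. ennreal (norm (k y)) \<partial>lborel)"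
    by (rule integral_norm_bound_ennreal) fact
  also have "\<dots> \<le> (\<integral>\<^sup>+y. h y \<partial>lborel)" by (intro nn_integral_mono assms)
  finally show ?thesis .
qed

lemma norm_Theta_le:
  assumes [measurable]: "\<And>i. f i \<in> borel_measurable borel" and t: "0 < t"
  shows "ennreal (norm (Theta \<theta> t f x)) \<le> ennreal A * Decay_prod (N + \<gamma>) t f x"
proof (cases "Decay_prod (N + \<gamma>) t f x = top")
  case True
  then show ?thesis using A by (simp add: ennreal_mult_top)
next
  case False
  then have fin: "Decay_prod (N + \<gamma>) t f x < top" by (simp add: less_top)
  have "ennreal (norm (Theta \<theta> t f x))
      \<le> (\<integral>\<^sup>+y. ennreal A * ennreal (kernel_decay N \<gamma> t x y * norm (tensor f y)) \<partial>lborel)"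
    unfolding Theta_eq_lborel[OF assms]
  proof (rule norm_kernel_integral_le[OF integrable_kernel_tensor[OF assms fin]])
    fix y :: "real^'n^'m"
    have "norm (\<theta> t x y * tensor f y) \<le> A * (kernel_decay N \<gamma> t x y * norm (tensor f y))"
      using square_function_kernelD(2)[OF ker t, of x y]
      by (simp add: norm_mult mult.assoc[symmetric] mult_right_mono)
    then show "ennreal (norm (\<theta> t x y * tensor f y)) \<le> ennreal A * ennreal (kernel_decay N \<gamma> t x y * norm (tensor f y))"
      using A kernel_decay_le(1)[OF t N, of x y] by (simp add: ennreal_mult[symmetric] ennreal_leI)
  qed
  also have "\<dots> = ennreal A * Decay_prod (N + \<gamma>) t f x"
    by (subst nn_integral_cmult) (measurable, simp add: nn_integral_kernel_decay_tensor[OF _ t])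
  finally show ?thesis .
qed

text \<open>Both integrals converge, so the difference is a single integral to which (K3) applies.
  The decay in (K3) is centred at x, so only the value at x enters; the oscillation estimate
  inherits this asymmetry, and the infimum over a cell relies on it.\<close>

lemma norm_Theta_diff_le:
  assumes [measurable]: "\<And>i. f i \<in> borel_measurable borel" and t: "0 < t"
    and fin: "Decay_prod (N + \<gamma>) t f x < top" "Decay_prod (N + \<gamma>) t f x' < top"
  shows "ennreal (norm (Theta \<theta> t f x - Theta \<theta> t f x'))
    \<le> ennreal (A * (norm (x - x') / t) powr \<gamma>) * Decay_prod (N + \<gamma>) t f x"
proof -
  note int = integrable_kernel_tensor[OF assms(1,2) fin(1)] integrable_kernel_tensor[OF assms(1,2) fin(2)]
  define c where "c = A * (norm (x - x') / t) powr \<gamma>"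
  have c: "0 \<le> c" using A by (simp add: c_def)
  have eq: "Theta \<theta> t f x - Theta \<theta> t f x' = (\<integral>y. \<theta> t x y * tensor f y - \<theta> t x' y * tensor f y \<partial>lborel)"
    using int by (simp add: Theta_eq_lborel[OF assms(1,2)])
  have "ennreal (norm (Theta \<theta> t f x - Theta \<theta> t f x'))
      \<le> (\<integral>\<^sup>+y. ennreal c * ennreal (kernel_decay N \<gamma> t x y * norm (tensor f y)) \<partial>lborel)"
    unfolding eq
  proof (rule norm_kernel_integral_le)
    fix y :: "real^'n^'m"
    have "norm (\<theta> t x y * tensor f y - \<theta> t x' y * tensor f y) = norm (\<theta> t x y - \<theta> t x' y) * norm (tensor f y)"
      by (simp add: norm_mult[symmetric] left_diff_distrib)
    also have "\<dots> \<le> c * (kernel_decay N \<gamma> t x y * norm (tensor f y))"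
      using square_function_kernelD(4)[OF ker t, of x y x']
      by (simp add: c_def mult.assoc[symmetric] mult_right_mono)
    finally show "ennreal (norm (\<theta> t x y * tensor f y - \<theta> t x' y * tensor f y))
        \<le> ennreal c * ennreal (kernel_decay N \<gamma> t x y * norm (tensor f y))"
      using c kernel_decay_le(1)[OF t N, of x y] by (simp add: ennreal_mult[symmetric] ennreal_leI)
  qed (use int in auto)
  also have "\<dots> = ennreal c * Decay_prod (N + \<gamma>) t f x"
    by (subst nn_integral_cmult) (measurable, simp add: nn_integral_kernel_decay_tensor[OF _ t])
  finally show ?thesis by (simp add: c_def)
qed

text \<open>The Caratheodory criterion is used twice: for the kernel in (t, y), so that the integral
  over y is measurable in t, and then for \<open>Theta\<close> in (t, x), which is continuous in x.
  Setting the value 0 for nonpositive t is harmless and covers the scales about which the kernel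
  conditions are silent.\<close>

lemma borel_measurable_Theta:
  assumes f [measurable]: "\<And>i. f i \<in> borel_measurable borel"
    and fin: "\<And>t x. 0 < t \<Longrightarrow> Decay_prod (N + \<gamma>) t f x < top"
  shows "(\<lambda>(t, x). if 0 < t then Theta \<theta> t f x else 0) \<in> borel_measurable (lebesgue \<Otimes>\<^sub>M borel)"
proof (rule borel_measurable_caratheodory)
  fix x
  let ?\<theta> = "\<lambda>t y. if 0 < t then \<theta> t x y else 0"
  have "(\<lambda>(t, y). ?\<theta> t y) \<in> borel_measurable (lebesgue \<Otimes>\<^sub>M borel)"
  proof (rule borel_measurable_caratheodory)
    show "(\<lambda>t. ?\<theta> t y) \<in> borel_measurable lebesgue" for y
      using square_function_kernelD(1)[OF ker, of x y] borel_measurable_if[of "{0<..}" "\<lambda>t. \<theta> t x y"]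
      by simp
    show "continuous_on UNIV (?\<theta> t)" for t
      using continuous_kernel[OF ker A \<gamma> N, of t x] by (cases "0 < t") auto
  qed
  then have [measurable]: "(\<lambda>p. ?\<theta> (fst p) (snd p)) \<in> borel_measurable (lebesgue \<Otimes>\<^sub>M lborel)"
    by (simp add: case_prod_unfold cong: measurable_cong_sets sets_pair_measure_cong)
  have [measurable]: "(\<lambda>p. tensor f (snd p)) \<in> borel_measurable (lebesgue \<Otimes>\<^sub>M lborel)"
    by (rule measurable_compose[OF measurable_snd]) simp
  have "(\<lambda>t. \<integral>y. ?\<theta> t y * tensor f y \<partial>lborel) \<in> borel_measurable lebesgue"
    by (rule lborel.borel_measurable_lebesgue_integral) (simp add: case_prod_unfold)
  also have "(\<lambda>t. \<integral>y. ?\<theta> t y * tensor f y \<partial>lborel) = (\<lambda>t. if 0 < t then Theta \<theta> t f x else 0)"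
    by (auto simp: fun_eq_iff Theta_eq_lborel[OF f])
  finally show "(\<lambda>t. if 0 < t then Theta \<theta> t f x else 0) \<in> borel_measurable lebesgue" .
next
  fix t :: real
  show "continuous_on UNIV (\<lambda>x. if 0 < t then Theta \<theta> t f x else 0)"
  proof (cases "0 < t")
    case t: True
    have "(Theta \<theta> t f \<longlongrightarrow> Theta \<theta> t f x) (at x)" for x
    proof -
      define d where "d = enn2real (Decay_prod (N + \<gamma>) t f x)"
      have d: "Decay_prod (N + \<gamma>) t f x = ennreal d" "0 \<le> d"
        using fin[OF t, of x] by (auto simp: d_def less_top)
      have "((\<lambda>x'. A * (norm (x - x') / t) powr \<gamma> * d) \<longlongrightarrow> A * (norm (x - x) / t) powr \<gamma> * d) (at x)"
        using \<gamma> t by (intro tendsto_intros tendsto_mult tendsto_powr' tendsto_divide tendsto_norm) auto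
      then have lim: "((\<lambda>x'. A * (norm (x - x') / t) powr \<gamma> * d) \<longlongrightarrow> 0) (at x)" by simp
      have "norm (Theta \<theta> t f x' - Theta \<theta> t f x) \<le> A * (norm (x - x') / t) powr \<gamma> * d" for x'
        using norm_Theta_diff_le[OF f t fin[OF t, of x] fin[OF t, of x']] A d(2)
        by (simp add: d(1) ennreal_mult[symmetric] ennreal_le_iff norm_minus_commute)
      then have "((\<lambda>x'. Theta \<theta> t f x' - Theta \<theta> t f x) \<longlongrightarrow> 0) (at x)"
        by (intro Lim_null_comparison[OF _ lim] always_eventually allI)
      then show ?thesis by (simp add: LIM_zero_iff)
    qed
    then show ?thesis using t by (simp add: continuous_on_def)
  qed simp
qed

end

section \<open>Norms, comparison of scales and Borel representatives\<close>

lemma Lp_norm_eq: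
  "0 < p \<Longrightarrow> Lp_norm p g = ennreal_powr (\<integral>\<^sup>+x. ennreal_powr (g x) p \<partial>lborel) (1 / p)"
  by (simp add: Lp_norm_def nn_integral_completion)

lemma Lp_norm_powr:
  "0 < p \<Longrightarrow> ennreal_powr (Lp_norm p g) p = (\<integral>\<^sup>+x. ennreal_powr (g x) p \<partial>lborel)"
  by (simp add: Lp_norm_eq ennreal_powr_powr)

lemma in_Lp_iff:
  "0 < p \<Longrightarrow> in_Lp p f \<longleftrightarrow> f \<in> borel_measurable lebesgue \<and>
     (\<integral>\<^sup>+x. ennreal_powr (ennreal (norm (f x))) p \<partial>lborel) < top"
  by (simp add: in_Lp_def Lp_norm_eq)

lemma lebesgue_complex_ex_borel:
  fixes f :: "'a::euclidean_space \<Rightarrow> complex"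
  assumes [measurable]: "f \<in> borel_measurable lebesgue"
  obtains g where "g \<in> borel_measurable borel" "AE x in lborel. f x = g x"
proof -
  have "(\<lambda>x. Re (f x)) \<in> borel_measurable (completion lborel)" "(\<lambda>x. Im (f x)) \<in> borel_measurable (completion lborel)"
    by measurable
  then obtain u v where uv: "u \<in> borel_measurable lborel" "AE x in lborel. Re (f x) = u x"
    "v \<in> borel_measurable lborel" "AE x in lborel. Im (f x) = v x"
    by (blast dest: completion_ex_borel_measurable_real)
  have [measurable]: "u \<in> borel_measurable borel" "v \<in> borel_measurable borel"
    using uv by auto
  show ?thesis
  proof
    show "(\<lambda>x. Complex (u x) (v x)) \<in> borel_measurable borel"
      unfolding Complex_eq by measurable
    show "AE x in lborel. f x = Complex (u x) (v x)"
      using uv(2,4) by eventually_elim (simp add: complex_eq_iff)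
  qed
qed

lemma decay_avg_mono:
  assumes "\<And>y. f y \<le> g y"
  shows "decay_avg a t f x \<le> decay_avg a t g x"
  unfolding decay_avg_def by (intro nn_integral_mono mult_left_mono assms) auto

lemma decay_avg_le_nn_integral:
  fixes g :: "'a::euclidean_space \<Rightarrow> ennreal"
  assumes [measurable]: "g \<in> borel_measurable borel" and t: "0 < t" "0 \<le> a"
  shows "decay_avg a t g x \<le> ennreal (1 / t ^ DIM('a)) * (\<integral>\<^sup>+y. g y \<partial>lborel)"
proof -
  have "decay_avg a t g x \<le> (\<integral>\<^sup>+y. ennreal (1 / t ^ DIM('a)) * g y \<partial>lborel)"
    unfolding decay_avg_def using t by (intro nn_integral_mono mult_right_mono ennreal_leI decay_le) auto
  also have "\<dots> = ennreal (1 / t ^ DIM('a)) * (\<integral>\<^sup>+y. g y \<partial>lborel)"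
    by (rule nn_integral_cmult) measurable
  finally show ?thesis .
qed

text \<open>Enlarging the scale slows the decay, and the change of normalisation costs the ratio of
  volumes. All scales in a bounded range are thereby compared with the largest.\<close>

lemma decay_avg_le_rescale:
  fixes g :: "'a::euclidean_space \<Rightarrow> ennreal"
  assumes [measurable]: "g \<in> borel_measurable borel" and t: "0 < t" "t \<le> R" and a: "0 \<le> a"
  shows "decay_avg a t g x \<le> ennreal ((R / t) ^ DIM('a)) * decay_avg a R g x"
proof -
  have R: "0 < R" using t by linarith
  have "decay_avg a t g x \<le> (\<integral>\<^sup>+y. ennreal ((R / t) ^ DIM('a)) * (ennreal (decay a R (x - y)) * g y) \<partial>lborel)"
    unfolding decay_avg_def
  proof (rule nn_integral_mono)
    fix y
    have "(1 + norm (x - y) / t) powr (- a) \<le> (1 + norm (x - y) / R) powr (- a)"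
      using t R a by (intro powr_mono2') (auto simp: frac_le add_pos_nonneg)
    then have "(1 + norm (x - y) / t) powr (- a) / t ^ DIM('a) \<le> (1 + norm (x - y) / R) powr (- a) / t ^ DIM('a)"
      using t by (simp add: divide_right_mono)
    also have "\<dots> = (R / t) ^ DIM('a) * decay a R (x - y)"
      using R by (simp add: decay_def power_divide)
    finally have "ennreal (decay a t (x - y)) \<le> ennreal ((R / t) ^ DIM('a)) * ennreal (decay a R (x - y))"
      using t R by (simp add: decay_def[of a t] ennreal_mult[symmetric] ennreal_leI)
    from mult_right_mono[OF this, of "g y"]
    show "ennreal (decay a t (x - y)) * g y \<le> ennreal ((R / t) ^ DIM('a)) * (ennreal (decay a R (x - y)) * g y)"
      by (simp add: mult.assoc)
  qed
  also have "\<dots> = ennreal ((R / t) ^ DIM('a)) * decay_avg a R g x"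
    unfolding decay_avg_def by (rule nn_integral_cmult) measurable
  finally show ?thesis .
qed

text \<open>The functions \<open>g\<^sub>i\<close> play the role of \<open>|f\<^sub>i|\<close> raised to the power \<open>2 / w\<^sub>i\<close>.\<close>

definition holder_const :: "real \<Rightarrow> ('m::finite \<Rightarrow> real) \<Rightarrow> real" where
  "holder_const C w = (\<Prod>i\<in>UNIV. C powr (1 - w i / 2)) ^ 2"

lemma holder_const_pos: "0 < C \<Longrightarrow> 0 < holder_const C w"
  by (simp add: holder_const_def prod_pos)

text \<open>Hoelder's inequality in each variable with exponent \<open>w i / 2\<close>, which lies
  below 1 even when \<open>w i = 1\<close>. Squaring turns it into the weight
  \<open>w i\<close>.\<close>

lemma prod_decay_avg_square_le:
  fixes g :: "'m::finite \<Rightarrow> 'a::euclidean_space \<Rightarrow> ennreal"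
  assumes [measurable]: "\<And>i. g i \<in> borel_measurable borel" and t: "0 < t" and a: "real DIM('a) < a"
    and w: "\<And>i. 0 < w i" "\<And>i. w i \<le> 1"
  shows "(\<Prod>i\<in>UNIV. decay_avg a t (\<lambda>y. ennreal_powr (g i y) (w i / 2)) x) ^ 2
    \<le> ennreal (holder_const (decay_const DIM('a) a) w) * (\<Prod>i\<in>UNIV. ennreal_powr (decay_avg a t (g i) x) (w i))"
proof -
  let ?C = "decay_const DIM('a) a"
  have "(\<Prod>i\<in>UNIV. decay_avg a t (\<lambda>y. ennreal_powr (g i y) (w i / 2)) x)
      \<le> (\<Prod>i\<in>UNIV. ennreal (?C powr (1 - w i / 2)) * ennreal_powr (decay_avg a t (g i) x) (w i / 2))"
  proof (rule prod_mono_ennreal)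
    fix i
    have "0 < w i / 2" "w i / 2 < 1" using w[of i] by auto
    then show "decay_avg a t (\<lambda>y. ennreal_powr (g i y) (w i / 2)) x
         \<le> ennreal (?C powr (1 - w i / 2)) * ennreal_powr (decay_avg a t (g i) x) (w i / 2)"
      using t a by (simp add: decay_avg_powr_le)
  qed
  also have "\<dots> = ennreal (\<Prod>i\<in>UNIV. ?C powr (1 - w i / 2)) * (\<Prod>i\<in>UNIV. ennreal_powr (decay_avg a t (g i) x) (w i / 2))"
    by (simp add: prod.distrib prod_ennreal)
  finally have "(\<Prod>i\<in>UNIV. decay_avg a t (\<lambda>y. ennreal_powr (g i y) (w i / 2)) x) ^ 2
      \<le> (ennreal (\<Prod>i\<in>UNIV. ?C powr (1 - w i / 2)) * (\<Prod>i\<in>UNIV. ennreal_powr (decay_avg a t (g i) x) (w i / 2))) ^ 2"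
    by (rule power_mono) simp
  also have "\<dots> = ennreal (holder_const ?C w) * (\<Prod>i\<in>UNIV. ennreal_powr (decay_avg a t (g i) x) (w i))"
  proof -
    have "ennreal_powr u (w i / 2) ^ 2 = ennreal_powr u (w i)" for u i
      by (simp add: ennreal_powr_2[symmetric] ennreal_powr_powr)
    then show ?thesis
      by (simp add: power_mult_distrib prod_power_distrib holder_const_def ennreal_power prod_nonneg)
  qed
  finally show ?thesis .
qed

context square_kernel
begin

text \<open>The square of the truncated square function. The root is left out so that the quantity
  is additive over disjoint ranges of scales.\<close>

definition sq_trunc :: "('m \<Rightarrow> real^'n \<Rightarrow> complex) \<Rightarrow> real \<Rightarrow> real \<Rightarrow> real^'n \<Rightarrow> ennreal" where
  "sq_trunc f \<alpha> \<beta> x = (\<integral>\<^sup>+t\<in>{\<alpha>..<\<beta>}. ennreal ((norm (Theta \<theta> t f x))\<^sup>2 / t) \<partial>lebesgue)"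

lemma borel_measurable_Theta_pair:
  assumes f [measurable]: "\<And>i. f i \<in> borel_measurable borel"
    and fin: "\<And>t x. 0 < t \<Longrightarrow> Decay_prod (N + \<gamma>) t f x < top"
  shows "(\<lambda>p. if 0 < snd p then Theta \<theta> (snd p) f (fst p) else 0) \<in> borel_measurable (lborel \<Otimes>\<^sub>M lebesgue)"
proof -
  have "(\<lambda>p. if 0 < fst p then Theta \<theta> (fst p) f (snd p) else 0) \<in> borel_measurable (lebesgue \<Otimes>\<^sub>M borel)"
    using borel_measurable_Theta[OF assms] by (simp add: case_prod_unfold)
  then have "(\<lambda>p. if 0 < fst p then Theta \<theta> (fst p) f (snd p) else 0) \<in> borel_measurable (lebesgue \<Otimes>\<^sub>M lborel)"
    by (simp cong: measurable_cong_sets sets_pair_measure_cong)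
  from measurable_compose[OF measurable_Pair[OF measurable_snd measurable_fst] this] show ?thesis
    unfolding fst_conv snd_conv .
qed

lemma borel_measurable_snd_lebesgue: "snd \<in> borel_measurable (M \<Otimes>\<^sub>M (lebesgue :: real measure))"
  by (rule measurable_compose[OF measurable_snd]) (rule measurable_completion, simp)

lemma borel_measurable_sq_trunc:
  assumes f: "\<And>i. f i \<in> borel_measurable borel"
    and fin: "\<And>t x. 0 < t \<Longrightarrow> Decay_prod (N + \<gamma>) t f x < top"
    and "0 < \<alpha>"
  shows "sq_trunc f \<alpha> \<beta> \<in> borel_measurable borel"
proof -
  note [measurable] = borel_measurable_Theta_pair[OF f fin] borel_measurable_snd_lebesgue
  have "(\<lambda>x. \<integral>\<^sup>+t. ennreal ((norm (if 0 < t then Theta \<theta> t f x else 0))\<^sup>2 / t) * indicator {\<alpha>..<\<beta>} t \<partial>lebesgue)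
      \<in> borel_measurable lborel"
    by (rule lebesgue.borel_measurable_nn_integral, unfold case_prod_unfold) measurable
  also have "(\<lambda>x. \<integral>\<^sup>+t. ennreal ((norm (if 0 < t then Theta \<theta> t f x else 0))\<^sup>2 / t) * indicator {\<alpha>..<\<beta>} t \<partial>lebesgue)
     = sq_trunc f \<alpha> \<beta>"
    unfolding sq_trunc_def using \<open>0 < \<alpha>\<close>
    by (intro ext nn_integral_cong) (auto simp: indicator_def)
  finally show ?thesis by simp
qed

lemma Decay_prod_finite:
  fixes f :: "'m \<Rightarrow> real^'n \<Rightarrow> complex"
  assumes f: "\<And>i. f i \<in> borel_measurable borel" and ps: "\<And>i. 1 < ps i"
    and Lp: "\<And>i. (\<integral>\<^sup>+x. ennreal_powr (ennreal (norm (f i x))) (ps i) \<partial>lborel) < top"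
    and t: "0 < t"
  shows "Decay_prod (N + \<gamma>) t f x < top"
proof -
  have [measurable]: "f i \<in> borel_measurable borel" for i by fact
  have "decay_avg (N + \<gamma>) t (\<lambda>y. ennreal (norm (f i y))) x < top" for i
  proof -
    have p: "0 < 1 / ps i" "1 / ps i < 1" using ps[of i] by auto
    have "decay_avg (N + \<gamma>) t (\<lambda>y. ennreal (norm (f i y))) x
       = decay_avg (N + \<gamma>) t (\<lambda>y. ennreal_powr (ennreal_powr (ennreal (norm (f i y))) (ps i)) (1 / ps i)) x"
      using ps[of i] by (simp add: ennreal_powr_powr)
    also have "\<dots> \<le> ennreal (decay_const DIM(real^'n) (N + \<gamma>) powr (1 - 1 / ps i))
       * ennreal_powr (decay_avg (N + \<gamma>) t (\<lambda>y. ennreal_powr (ennreal (norm (f i y))) (ps i)) x) (1 / ps i)"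
      by (rule decay_avg_powr_le[OF _ t exponent p]) measurable
    also have "\<dots> < top"
    proof -
      have "decay_avg (N + \<gamma>) t (\<lambda>y. ennreal_powr (ennreal (norm (f i y))) (ps i)) x
          \<le> ennreal (1 / t ^ DIM(real^'n)) * (\<integral>\<^sup>+x. ennreal_powr (ennreal (norm (f i x))) (ps i) \<partial>lborel)"
        by (intro decay_avg_le_nn_integral t N) measurable
      also have "\<dots> < top" using Lp[of i] by (simp add: ennreal_mult_less_top)
      finally show ?thesis by (simp add: ennreal_mult_less_top)
    qed
    finally show ?thesis .
  qed
  then show ?thesis
    by (auto simp: Decay_prod_def less_top[symmetric] ennreal_prod_eq_top)
qed

text \<open>The exceptional sets are null cylinders in the space of tuples. Only the g i are Borel;
  the integrand with f is measurable because Lebesgue measure is complete.\<close>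

lemma Theta_cong_AE:
  fixes f g :: "'m \<Rightarrow> real^'n \<Rightarrow> complex"
  assumes g [measurable]: "\<And>i. g i \<in> borel_measurable borel"
    and ae: "\<And>i. AE x in lborel. f i x = g i x" and t: "0 < t"
  shows "Theta \<theta> t f x = Theta \<theta> t g x"
proof -
  note [measurable] = borel_measurable_kernel[OF t]
  have ae_y: "AE y in (lborel :: (real^'n^'m) measure). \<forall>i. f i (y $ i) = g i (y $ i)"
    unfolding AE_all_countable by (intro allI AE_vec_nth[OF ae])
  have ae': "AE y in lebesgue. \<theta> t x y * (\<Prod>i\<in>UNIV. g i (y $ i)) = \<theta> t x y * (\<Prod>i\<in>UNIV. f i (y $ i))"
    by (rule AE_completion, use ae_y in eventually_elim) (simp only:)
  have meas: "(\<lambda>y. \<theta> t x y * (\<Prod>i\<in>UNIV. g i (y $ i))) \<in> borel_measurable lebesgue"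
    by (rule measurable_completion) measurable
  show ?thesis
    unfolding Theta_def
    by (rule integral_cong_AE[OF borel_measurable_AE[OF meas ae'] meas])
      (use ae' in \<open>eventually_elim, simp only:\<close>)
qed

lemma square_function_cong_AE:
  fixes f g :: "'m \<Rightarrow> real^'n \<Rightarrow> complex"
  assumes "\<And>i. g i \<in> borel_measurable borel" "\<And>i. AE x in lborel. f i x = g i x"
  shows "square_function \<theta> f = square_function \<theta> g"
  unfolding square_function_def
  by (intro ext arg_cong[where f="\<lambda>u. ennreal_powr u _"] nn_integral_cong)
    (auto simp: indicator_def Theta_cong_AE[OF assms])

lemma borel_representative:
  fixes f :: "'m \<Rightarrow> real^'n \<Rightarrow> complex"
  assumes "\<And>i. f i \<in> borel_measurable lebesgue"
  obtains g where "\<And>i. g i \<in> borel_measurable borel" "\<And>i. AE x in lborel. f i x = g i x"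
    "square_function \<theta> f = square_function \<theta> g"
    "\<And>i p. Lp_norm p (\<lambda>x. ennreal (norm (f i x))) = Lp_norm p (\<lambda>x. ennreal (norm (g i x)))"
proof -
  have "\<exists>g. g \<in> borel_measurable borel \<and> (AE x in lborel. f i x = g x)" for i
    by (rule lebesgue_complex_ex_borel[OF assms]) blast
  then obtain g where g: "\<And>i. g i \<in> borel_measurable borel" "\<And>i. AE x in lborel. f i x = g i x"
    by metis
  have "Lp_norm p (\<lambda>x. ennreal (norm (f i x))) = Lp_norm p (\<lambda>x. ennreal (norm (g i x)))" for i p
    unfolding Lp_norm_def
    by (intro arg_cong[where f="\<lambda>u. ennreal_powr u _"] nn_integral_cong_AE AE_completion)
      (use g(2)[of i] in \<open>eventually_elim, simp\<close>)
  from that[OF g square_function_cong_AE[OF g] this] show ?thesis .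
qed

end

section \<open>Oscillation and localisation\<close>

lemma nn_integral_powr_to_inf:
  assumes "0 < b" "0 < e"
  shows "(\<integral>\<^sup>+t. ennreal (t powr (- e - 1)) * indicator {b..} t \<partial>lborel) = ennreal (b powr (- e) / e)"
proof -
  have "((\<lambda>x. x powr (- e - 1)) has_integral - (b powr ((- e - 1) + 1)) / ((- e - 1) + 1)) {b..}"
    using assms by (intro has_integral_powr_to_inf) auto
  then have "((\<lambda>x. if x \<in> {b..} then x powr (- e - 1) else 0) has_integral (b powr (- e) / e)) UNIV"
    by (simp only: has_integral_restrict_UNIV) simp
  then have "(\<integral>\<^sup>+x. ennreal (if x \<in> {b..} then x powr (- e - 1) else 0) \<partial>lborel) = ennreal (b powr (- e) / e)"
    by (intro nn_integral_has_integral_lborel) auto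
  also have "(\<integral>\<^sup>+x. ennreal (if x \<in> {b..} then x powr (- e - 1) else 0) \<partial>lborel)
      = (\<integral>\<^sup>+t. ennreal (t powr (- e - 1)) * indicator {b..} t \<partial>lborel)"
    by (intro nn_integral_cong) (auto simp: indicator_def)
  finally show ?thesis .
qed

lemma ennreal_sum_square_le:
  fixes u :: "'i \<Rightarrow> ennreal"
  assumes "finite I"
  shows "(\<Sum>i\<in>I. u i)\<^sup>2 \<le> (of_nat (card I))\<^sup>2 * (\<Sum>i\<in>I. (u i)\<^sup>2)"
proof (cases "I = {}")
  case False
  define M where "M = Max (u ` I)"
  have M: "M \<in> u ` I" "\<And>i. i \<in> I \<Longrightarrow> u i \<le> M"
    using assms False by (auto simp: M_def)
  then obtain k where k: "k \<in> I" "M = u k" by auto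
  have "(\<Sum>i\<in>I. u i) \<le> of_nat (card I) * M"
    using M(2) by (rule sum_bounded_above)
  then have "(\<Sum>i\<in>I. u i)\<^sup>2 \<le> (of_nat (card I) * M)\<^sup>2" by (rule power_mono_ennreal)
  also have "\<dots> = (of_nat (card I))\<^sup>2 * (u k)\<^sup>2" by (simp add: power_mult_distrib k)
  also have "\<dots> \<le> (of_nat (card I))\<^sup>2 * (\<Sum>i\<in>I. (u i)\<^sup>2)"
    using k assms by (intro mult_left_mono member_le_sum) auto
  finally show ?thesis .
qed simp

lemma norm_square_le: "(norm u)\<^sup>2 \<le> 2 * (norm v)\<^sup>2 + 2 * (norm (u - v))\<^sup>2"
proof -
  have "norm u \<le> norm v + norm (u - v)" by (metis add_diff_cancel_left' diff_add_cancel norm_triangle_sub)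
  then have "(norm u)\<^sup>2 \<le> (norm v + norm (u - v))\<^sup>2" by (rule power_mono) simp
  also have "\<dots> \<le> 2 * (norm v)\<^sup>2 + 2 * (norm (u - v))\<^sup>2"
    using sum_squares_bound[of "norm v" "norm (u - v)"] by (simp add: power2_sum)
  finally show ?thesis .
qed

interpretation lborel_lebesgue: pair_sigma_finite "lborel :: 'a::euclidean_space measure" "lebesgue :: 'b::euclidean_space measure" ..

section \<open>The majorant W and the oscillation bound\<close>

locale weighted_kernel = square_kernel \<theta> N \<gamma> A
  for \<theta> :: "real \<Rightarrow> real^'n \<Rightarrow> real^'n^'m \<Rightarrow> complex" and N \<gamma> A :: real +
  fixes w :: "'m \<Rightarrow> real"
  assumes w_pos: "\<And>i. 0 < w i" and w_sum: "sum w UNIV = 1"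
begin

lemma w_le_1: "w i \<le> 1"
  using member_le_sum[of i UNIV w] w_pos w_sum by (auto simp: less_imp_le)

text \<open>\<open>Cd\<close> bounds the mass of the decay kernel, \<open>Ch\<close> is the loss in
  Hoelder's inequality, and \<open>Ca\<close> is the constant for integrals of averages over a ball,
  without the factor \<open>r ^ n\<close>.\<close>

definition Cd :: real where "Cd = decay_const DIM(real^'n) (N + \<gamma>)"

definition Ch :: real where "Ch = holder_const Cd w"

definition Ca :: real where
  "Ca = (2 ^ DIM(real^'n) + 2 powr (N + \<gamma>)) * Cd * unit_ball_vol DIM(real^'n)"

lemma Cd_pos: "0 < Cd"
  unfolding Cd_def by (rule decay_const_pos[OF exponent])

lemma Ch_pos: "0 < Ch"
  unfolding Ch_def by (rule holder_const_pos[OF Cd_pos])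

lemma Ca_pos: "0 < Ca"
  unfolding Ca_def using Cd_pos by (simp add: add_pos_pos)

definition pw :: "('m \<Rightarrow> real^'n \<Rightarrow> complex) \<Rightarrow> 'm \<Rightarrow> real^'n \<Rightarrow> ennreal" where
  "pw f i y = ennreal_powr (ennreal (norm (f i y))) (2 / w i)"

text \<open>The i-th factor scales like the square of \<open>f i\<close>, so W has the homogeneity
  of the square of the square function.\<close>

definition Wmax :: "('m \<Rightarrow> real^'n \<Rightarrow> complex) \<Rightarrow> real^'n \<Rightarrow> ennreal" where
  "Wmax f x = (\<Prod>i\<in>UNIV. ennreal_powr (hl_maximal (pw f i) x) (w i))"

lemma borel_measurable_pw [measurable]:
  assumes [measurable]: "\<And>i. f i \<in> borel_measurable borel"
  shows "pw f i \<in> borel_measurable borel"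
  unfolding pw_def by measurable

lemma borel_measurable_Wmax [measurable]: "Wmax f \<in> borel_measurable borel"
  unfolding Wmax_def by measurable

lemma pw_powr: "ennreal_powr (pw f i y) (w i / 2) = ennreal (norm (f i y))"
  using w_pos[of i] by (simp add: pw_def ennreal_powr_powr)

lemma prod_powr_cmult:
  assumes "\<And>i. 0 \<le> c i"
  shows "(\<Prod>i\<in>UNIV. ennreal_powr (ennreal (c i) * u i) (w i))
    = ennreal (\<Prod>i\<in>UNIV. c i powr w i) * (\<Prod>i\<in>UNIV. ennreal_powr (u i) (w i))"
  using assms by (simp add: ennreal_powr_mult ennreal_powr_ennreal prod.distrib prod_ennreal)

text \<open>The weights sum to 1, so a constant common to all factors leaves the product to the
  first power. In particular volumes of balls appear exactly once, however many functions there
  are.\<close>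

lemma prod_powr_const:
  assumes "0 < c"
  shows "(\<Prod>i\<in>UNIV. c powr w i) = c"
proof -
  have "(\<Prod>i\<in>UNIV. c powr w i) = c powr (\<Sum>i\<in>UNIV. w i)"
    using assms by (subst powr_sum) auto
  then show ?thesis using w_sum assms by simp
qed

lemma Decay_prod_square_le:
  assumes f: "\<And>i. f i \<in> borel_measurable borel" and t: "0 < t"
  shows "(Decay_prod (N + \<gamma>) t f x)\<^sup>2
    \<le> ennreal Ch * (\<Prod>i\<in>UNIV. ennreal_powr (decay_avg (N + \<gamma>) t (pw f i) x) (w i))"
  using prod_decay_avg_square_le[of "pw f" t "N + \<gamma>" w x, OF borel_measurable_pw[OF f] t exponent w_pos w_le_1]
  by (simp add: Decay_prod_def Ch_def Cd_def pw_powr)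

lemma Decay_prod_square_le_Wmax:
  assumes f: "\<And>i. f i \<in> borel_measurable borel" and t: "0 < t"
  shows "(Decay_prod (N + \<gamma>) t f x)\<^sup>2 \<le> ennreal (Ch * Cd) * Wmax f x"
proof -
  have "(\<Prod>i\<in>UNIV. ennreal_powr (decay_avg (N + \<gamma>) t (pw f i) x) (w i))
      \<le> (\<Prod>i\<in>UNIV. ennreal_powr (ennreal Cd * hl_maximal (pw f i) x) (w i))"
    unfolding Cd_def using t w_pos f
    by (intro prod_mono_ennreal ennreal_powr_mono decay_avg_le_hl_maximal exponent) (auto simp: less_imp_le)
  also have "\<dots> = ennreal Cd * Wmax f x"
    using Cd_pos by (subst prod_powr_cmult) (auto simp: prod_powr_const Wmax_def less_imp_le)
  finally have "ennreal Ch * (\<Prod>i\<in>UNIV. ennreal_powr (decay_avg (N + \<gamma>) t (pw f i) x) (w i))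
      \<le> ennreal Ch * (ennreal Cd * Wmax f x)"
    by (rule mult_left_mono) simp
  also have "\<dots> = ennreal (Ch * Cd) * Wmax f x"
    using Ch_pos Cd_pos by (simp add: ennreal_mult mult.assoc)
  finally show ?thesis using Decay_prod_square_le[OF assms] by (rule order_trans[rotated])
qed

lemma borel_measurable_Theta_time:
  fixes f :: "'m \<Rightarrow> real^'n \<Rightarrow> complex"
  assumes f: "\<And>i. f i \<in> borel_measurable borel"
    and fin: "\<And>t x. 0 < t \<Longrightarrow> Decay_prod (N + \<gamma>) t f x < top"
  shows "(\<lambda>t. if 0 < t then Theta \<theta> t f x else 0) \<in> borel_measurable lebesgue"
  using measurable_compose[OF measurable_Pair1' borel_measurable_Theta_pair[OF f fin], of x]
  unfolding fst_conv snd_conv by simp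

text \<open>The integral of \<open>(r / t) powr (2 * \<gamma>) / t\<close> over
  \<open>t \<ge> r / 2\<close> is \<open>2 powr (2 * \<gamma>) / (2 * \<gamma>)\<close>; the 2 in
  the denominator cancels against the factor in \<open>norm_square_le\<close>.\<close>

definition K_osc :: real where "K_osc = A\<^sup>2 * Ch * Cd * 2 powr (2 * \<gamma>) / \<gamma>"

text \<open>By (K3) the difference at scale t gains the power \<gamma> of r/t, whose square is
  integrable against dt/t at large scales. The range starts at r/2 and not at r, since the layer of
  generation k reaches down to half the size of its cells.\<close>

lemma sq_trunc_osc:
  fixes f :: "'m \<Rightarrow> real^'n \<Rightarrow> complex"
  assumes f: "\<And>i. f i \<in> borel_measurable borel"
    and fin: "\<And>t x. 0 < t \<Longrightarrow> Decay_prod (N + \<gamma>) t f x < top"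
    and r: "0 < r" and d: "dist x x' \<le> r"
  shows "sq_trunc f (r / 2) \<beta> x \<le> 2 * sq_trunc f (r / 2) \<beta> x' + ennreal K_osc * Wmax f x"
proof -
  let ?\<Theta> = "\<lambda>t x. if 0 < t then Theta \<theta> t f x else 0"
  note [measurable] = borel_measurable_Theta_time[OF f fin]
  have [measurable]: "(\<lambda>t::real. t) \<in> borel_measurable lebesgue" by (rule measurable_completion) simp
  define c where "c = 2 * A\<^sup>2 * Ch * Cd * r powr (2 * \<gamma>)"
  have c: "0 \<le> c" using Ch_pos Cd_pos by (simp add: c_def)
  have "sq_trunc f (r / 2) \<beta> x \<le> (\<integral>\<^sup>+t. 2 * (ennreal ((norm (?\<Theta> t x'))\<^sup>2 / t) * indicator {r / 2..<\<beta>} t)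
      + (ennreal c * Wmax f x) * (ennreal (t powr (- (2 * \<gamma>) - 1)) * indicator {r / 2..} t) \<partial>lebesgue)"
    unfolding sq_trunc_def
  proof (rule nn_integral_mono)
    fix t :: real
    show "ennreal ((norm (Theta \<theta> t f x))\<^sup>2 / t) * indicator {r / 2..<\<beta>} t
      \<le> 2 * (ennreal ((norm (?\<Theta> t x'))\<^sup>2 / t) * indicator {r / 2..<\<beta>} t)
      + (ennreal c * Wmax f x) * (ennreal (t powr (- (2 * \<gamma>) - 1)) * indicator {r / 2..} t)"
    proof (cases "t \<in> {r / 2..<\<beta>}")
      case True
      then have t: "0 < t" "r / 2 \<le> t" using r by auto
      let ?u = "norm (Theta \<theta> t f x)" and ?v = "norm (Theta \<theta> t f x')" and ?e = "norm (Theta \<theta> t f x - Theta \<theta> t f x')"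
      have "(norm (x - x') / t) powr \<gamma> \<le> (r / t) powr \<gamma>"
        using d t \<gamma> by (intro powr_mono2) (auto simp: dist_norm divide_right_mono)
      then have "A * (norm (x - x') / t) powr \<gamma> \<le> A * (r / t) powr \<gamma>"
        using A by simp
      then have "ennreal ?e \<le> ennreal (A * (r / t) powr \<gamma>) * Decay_prod (N + \<gamma>) t f x"
        using norm_Theta_diff_le[OF f t(1) fin[OF t(1), of x] fin[OF t(1), of x']]
        by (meson ennreal_leI mult_right_mono order_trans zero_le)
      then have "(ennreal ?e)\<^sup>2 \<le> (ennreal (A * (r / t) powr \<gamma>) * Decay_prod (N + \<gamma>) t f x)\<^sup>2"
        by (rule power_mono_ennreal)
      also have "\<dots> \<le> ennreal ((A * (r / t) powr \<gamma>)\<^sup>2) * (ennreal (Ch * Cd) * Wmax f x)"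
        using A by (simp add: power_mult_distrib ennreal_power mult_left_mono Decay_prod_square_le_Wmax[OF f t(1)])
      also have "\<dots> = ennreal ((A * (r / t) powr \<gamma>)\<^sup>2 * (Ch * Cd)) * Wmax f x"
        using Ch_pos Cd_pos by (simp add: ennreal_mult mult.assoc)
      finally have e: "ennreal (?e\<^sup>2) \<le> ennreal ((A * (r / t) powr \<gamma>)\<^sup>2 * (Ch * Cd)) * Wmax f x"
        by (simp add: ennreal_power)
      have "ennreal (?u\<^sup>2 / t) \<le> ennreal (2 * (?v\<^sup>2 / t) + (2 / t) * ?e\<^sup>2)"
        using norm_square_le[of "Theta \<theta> t f x" "Theta \<theta> t f x'"] t
        by (intro ennreal_leI) (simp add: field_simps)
      also have "\<dots> = 2 * ennreal (?v\<^sup>2 / t) + ennreal (2 / t) * ennreal (?e\<^sup>2)"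
      proof -
        have "ennreal (2 * (?v\<^sup>2 / t)) = 2 * ennreal (?v\<^sup>2 / t)"
          using t ennreal_mult[of 2 "?v\<^sup>2 / t"] by simp
        moreover have "ennreal ((2 / t) * ?e\<^sup>2) = ennreal (2 / t) * ennreal (?e\<^sup>2)"
          using t by (intro ennreal_mult) auto
        moreover have "0 \<le> 2 * (?v\<^sup>2 / t)" "0 \<le> (2 / t) * ?e\<^sup>2" using t by auto
        ultimately show ?thesis by (simp only: ennreal_plus)
      qed
      also have "\<dots> \<le> 2 * ennreal (?v\<^sup>2 / t) + ennreal (2 / t) * (ennreal ((A * (r / t) powr \<gamma>)\<^sup>2 * (Ch * Cd)) * Wmax f x)"
        by (intro add_left_mono mult_left_mono e) simp
      also have "ennreal (2 / t) * (ennreal ((A * (r / t) powr \<gamma>)\<^sup>2 * (Ch * Cd)) * Wmax f x)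
          = ennreal (2 / t * ((A * (r / t) powr \<gamma>)\<^sup>2 * (Ch * Cd))) * Wmax f x"
        using t Ch_pos Cd_pos by (subst ennreal_mult) (auto simp: mult.assoc)
      also have "2 / t * ((A * (r / t) powr \<gamma>)\<^sup>2 * (Ch * Cd)) = c * t powr (- (2 * \<gamma>) - 1)"
      proof -
        have sq: "((r / t) powr \<gamma>)\<^sup>2 = r powr (2 * \<gamma>) * t powr (- (2 * \<gamma>))"
        proof -
          have dbl: "(x powr e)\<^sup>2 = x powr (2 * e)" for x e :: real
            unfolding power2_eq_square powr_add[symmetric] by (simp only: mult_2)
          have "((r / t) powr \<gamma>)\<^sup>2 = (r / t) powr (2 * \<gamma>)" by (rule dbl)
          also have "\<dots> = r powr (2 * \<gamma>) / t powr (2 * \<gamma>)"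
            by (rule powr_divide)
          finally show ?thesis by (simp add: powr_minus_divide)
        qed
        have "t powr (- (2 * \<gamma>) - 1) = t powr (- (2 * \<gamma>)) / t"
          using t by (simp add: powr_diff)
        then show ?thesis by (simp add: c_def power_mult_distrib sq)
      qed
      finally show ?thesis
        using True t c by (simp add: ennreal_mult mult_ac)
    qed simp
  qed
  also have "\<dots> = 2 * (\<integral>\<^sup>+t. ennreal ((norm (?\<Theta> t x'))\<^sup>2 / t) * indicator {r / 2..<\<beta>} t \<partial>lebesgue)
      + (ennreal c * Wmax f x) * (\<integral>\<^sup>+t. ennreal (t powr (- (2 * \<gamma>) - 1)) * indicator {r / 2..} t \<partial>lebesgue)"
    by (subst nn_integral_add, measurable, subst nn_integral_cmult, measurable, subst nn_integral_cmult, measurable)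
  also have "(\<integral>\<^sup>+t. ennreal ((norm (?\<Theta> t x'))\<^sup>2 / t) * indicator {r / 2..<\<beta>} t \<partial>lebesgue) = sq_trunc f (r / 2) \<beta> x'"
    unfolding sq_trunc_def using r by (intro nn_integral_cong) (auto simp: indicator_def)
  also have "(\<integral>\<^sup>+t. ennreal (t powr (- (2 * \<gamma>) - 1)) * indicator {r / 2..} t \<partial>lebesgue)
      = ennreal ((r / 2) powr (- (2 * \<gamma>)) / (2 * \<gamma>))"
    unfolding nn_integral_completion using r \<gamma> by (intro nn_integral_powr_to_inf) auto
  also have "ennreal c * Wmax f x * ennreal ((r / 2) powr (- (2 * \<gamma>)) / (2 * \<gamma>)) = ennreal K_osc * Wmax f x"
  proof -
    have "r powr (2 * \<gamma>) * (r / 2) powr (- (2 * \<gamma>)) = 2 powr (2 * \<gamma>)"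
      using r by (simp add: powr_minus_divide powr_divide)
    then have "c * ((r / 2) powr (- (2 * \<gamma>)) / (2 * \<gamma>)) = K_osc"
      using \<gamma> by (simp add: c_def K_osc_def)
    then have "ennreal K_osc = ennreal c * ennreal ((r / 2) powr (- (2 * \<gamma>)) / (2 * \<gamma>))"
      using c \<gamma> by (subst ennreal_mult[symmetric]) auto
    then show ?thesis by (simp only: mult_ac)
  qed
  finally show ?thesis .
qed

section \<open>Near and far parts of the functions\<close>

text \<open>The radius is \<open>2 * r\<close> so that a distance of at least r separates the
  removed part from \<open>ball z r\<close>, over which the average is taken.\<close>

definition near :: "real^'n \<Rightarrow> real \<Rightarrow> ('m \<Rightarrow> real^'n \<Rightarrow> complex) \<Rightarrow> 'm \<Rightarrow> real^'n \<Rightarrow> complex" where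
  "near z r f i y = (if y \<in> ball z (2 * r) then f i y else 0)"

text \<open>Only the i-th function is restricted to far points; all others stay whole. A tuple with
  some far entry is counted for at least one i, at the price of a sum over i.\<close>

definition far_at :: "real^'n \<Rightarrow> real \<Rightarrow> 'm \<Rightarrow> ('m \<Rightarrow> real^'n \<Rightarrow> ennreal) \<Rightarrow> 'm \<Rightarrow> real^'n \<Rightarrow> ennreal" where
  "far_at z r i g j y = (if j = i then g j y * indicator (- ball z (2 * r)) y else g j y)"

lemma borel_measurable_near [measurable]:
  assumes [measurable]: "\<And>i. f i \<in> borel_measurable borel"
  shows "near z r f i \<in> borel_measurable borel"
proof -
  have [measurable]: "ball z (2 * r) \<in> sets borel" by simp
  show ?thesis unfolding near_def by measurable
qed

lemma borel_measurable_far_at [measurable]: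
  assumes [measurable]: "\<And>i. g i \<in> borel_measurable borel"
  shows "far_at z r i g j \<in> borel_measurable borel"
proof -
  have [measurable]: "- ball z (2 * r) \<in> sets borel" by auto
  have "far_at z r i g j = (\<lambda>y. g j y * (if j = i then indicator (- ball z (2 * r)) y else 1))"
    by (auto simp: far_at_def)
  also have "\<dots> \<in> borel_measurable borel" by measurable
  finally show ?thesis .
qed

lemma far_at_powr:
  "ennreal_powr (far_at z r i (pw f) j y) (w j / 2) = far_at z r i (\<lambda>j y. ennreal (norm (f j y))) j y"
  by (auto simp: far_at_def ennreal_powr_mult pw_powr indicator_def)

lemma Decay_prod_near_le: "Decay_prod a t (near z r f) x \<le> Decay_prod a t f x"
  unfolding Decay_prod_def
  by (intro prod_mono_ennreal decay_avg_mono) (auto simp: near_def)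

text \<open>The integrands of \<open>\<Theta>\<^sub>t f\<close> and \<open>\<Theta>\<^sub>t (near z r f)\<close> differ only where some \<open>y\<^sub>i\<close> is far from \<open>z\<close>.\<close>

lemma norm_tensor_diff_near_le:
  "ennreal (norm (tensor f y - tensor (near z r f) y))
    \<le> (\<Sum>i\<in>UNIV. \<Prod>j\<in>UNIV. far_at z r i (\<lambda>j y. ennreal (norm (f j y))) j (y $ j))"
proof (cases "\<forall>i. y $ i \<in> ball z (2 * r)")
  case True
  then have "tensor (near z r f) y = tensor f y" by (simp add: tensor_def near_def)
  then show ?thesis by simp
next
  case False
  then obtain i where i: "y $ i \<notin> ball z (2 * r)" by auto
  then have zero: "tensor (near z r f) y = 0"
    by (auto simp: tensor_def near_def intro!: prod_zero)
  have "ennreal (norm (tensor f y - tensor (near z r f) y)) = (\<Prod>j\<in>UNIV. ennreal (norm (f j (y $ j))))"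
    by (simp add: zero) (simp add: tensor_def prod_norm[symmetric] prod_ennreal)
  also have "\<dots> = (\<Prod>j\<in>UNIV. far_at z r i (\<lambda>j y. ennreal (norm (f j y))) j (y $ j))"
    using i by (intro prod.cong) (auto simp: far_at_def)
  also have "\<dots> \<le> (\<Sum>i\<in>UNIV. \<Prod>j\<in>UNIV. far_at z r i (\<lambda>j y. ennreal (norm (f j y))) j (y $ j))"
    by (rule member_le_sum) auto
  finally show ?thesis .
qed

lemma norm_Theta_diff_near_le:
  fixes f :: "'m \<Rightarrow> real^'n \<Rightarrow> complex"
  assumes f [measurable]: "\<And>i. f i \<in> borel_measurable borel" and t: "0 < t"
    and fin: "Decay_prod (N + \<gamma>) t f x < top"
  shows "ennreal (norm (Theta \<theta> t f x - Theta \<theta> t (near z r f) x))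
    \<le> ennreal A * (\<Sum>i\<in>UNIV. \<Prod>j\<in>UNIV. decay_avg (N + \<gamma>) t (far_at z r i (\<lambda>j y. ennreal (norm (f j y))) j) x)"
proof -
  let ?h = "\<lambda>i j y. far_at z r i (\<lambda>j y. ennreal (norm (f j y))) j y"
  have fin': "Decay_prod (N + \<gamma>) t (near z r f) x < top"
    using Decay_prod_near_le fin by (rule le_less_trans)
  note near = borel_measurable_near[OF f]
  note int = integrable_kernel_tensor[OF f t fin] integrable_kernel_tensor[OF near t fin']
  have eq: "Theta \<theta> t f x - Theta \<theta> t (near z r f) x
      = (\<integral>y. \<theta> t x y * tensor f y - \<theta> t x y * tensor (near z r f) y \<partial>lborel)"
    using int by (simp add: Theta_eq_lborel[OF f t] Theta_eq_lborel[OF near t])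
  have "ennreal (norm (Theta \<theta> t f x - Theta \<theta> t (near z r f) x))
      \<le> (\<integral>\<^sup>+y. ennreal A * (\<Sum>i\<in>UNIV. ennreal (kernel_decay N \<gamma> t x y) * (\<Prod>j\<in>UNIV. ?h i j (y $ j))) \<partial>lborel)"
    unfolding eq
  proof (rule norm_kernel_integral_le)
    fix y :: "real^'n^'m"
    have kd: "0 \<le> kernel_decay N \<gamma> t x y" by (rule kernel_decay_le(1)[OF t N])
    have "norm (\<theta> t x y * tensor f y - \<theta> t x y * tensor (near z r f) y)
        = norm (\<theta> t x y) * norm (tensor f y - tensor (near z r f) y)"
      by (simp add: norm_mult[symmetric] right_diff_distrib)
    also have "\<dots> \<le> (A * kernel_decay N \<gamma> t x y) * norm (tensor f y - tensor (near z r f) y)"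
      by (intro mult_right_mono square_function_kernelD(2)[OF ker t]) auto
    finally have "ennreal (norm (\<theta> t x y * tensor f y - \<theta> t x y * tensor (near z r f) y))
        \<le> ennreal A * (ennreal (kernel_decay N \<gamma> t x y) * ennreal (norm (tensor f y - tensor (near z r f) y)))"
      using A kd by (simp add: ennreal_mult[symmetric] ennreal_leI mult.assoc)
    also have "\<dots> \<le> ennreal A * (ennreal (kernel_decay N \<gamma> t x y) * (\<Sum>i\<in>UNIV. \<Prod>j\<in>UNIV. ?h i j (y $ j)))"
      by (intro mult_left_mono norm_tensor_diff_near_le) auto
    finally show "ennreal (norm (\<theta> t x y * tensor f y - \<theta> t x y * tensor (near z r f) y))
        \<le> ennreal A * (\<Sum>i\<in>UNIV. ennreal (kernel_decay N \<gamma> t x y) * (\<Prod>j\<in>UNIV. ?h i j (y $ j)))"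
      by (simp add: sum_distrib_left)
  qed (use int in auto)
  also have "\<dots> = ennreal A * (\<Sum>i\<in>UNIV. \<integral>\<^sup>+y. ennreal (kernel_decay N \<gamma> t x y) * (\<Prod>j\<in>UNIV. ?h i j (y $ j)) \<partial>lborel)"
    by (subst nn_integral_cmult, measurable, subst nn_integral_sum, measurable)
  also have "(\<Sum>i\<in>UNIV. \<integral>\<^sup>+y. ennreal (kernel_decay N \<gamma> t x y) * (\<Prod>j\<in>UNIV. ?h i j (y $ j)) \<partial>lborel)
      = (\<Sum>i\<in>UNIV. \<Prod>j\<in>UNIV. decay_avg (N + \<gamma>) t (?h i j) x)"
    by (intro sum.cong refl nn_integral_kernel_decay_prod t) measurable
  finally show ?thesis .
qed

lemma norm_Theta_diff_near_square_le:
  fixes f :: "'m \<Rightarrow> real^'n \<Rightarrow> complex"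
  assumes f [measurable]: "\<And>i. f i \<in> borel_measurable borel" and t: "0 < t"
    and fin: "Decay_prod (N + \<gamma>) t f x < top"
  shows "ennreal ((norm (Theta \<theta> t f x - Theta \<theta> t (near z r f) x))\<^sup>2)
    \<le> ennreal (A\<^sup>2 * (real CARD('m))\<^sup>2 * Ch)
      * (\<Sum>i\<in>UNIV. \<Prod>j\<in>UNIV. ennreal_powr (decay_avg (N + \<gamma>) t (far_at z r i (pw f) j) x) (w j))"
proof -
  let ?u = "\<lambda>i. \<Prod>j\<in>UNIV. decay_avg (N + \<gamma>) t (far_at z r i (\<lambda>j y. ennreal (norm (f j y))) j) x"
  let ?v = "\<lambda>i. \<Prod>j\<in>UNIV. ennreal_powr (decay_avg (N + \<gamma>) t (far_at z r i (pw f) j) x) (w j)"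
  have u: "(?u i)\<^sup>2 \<le> ennreal Ch * ?v i" for i
    using prod_decay_avg_square_le[of "far_at z r i (pw f)" t "N + \<gamma>" w x,
        OF borel_measurable_far_at[OF borel_measurable_pw[OF f]] t exponent w_pos w_le_1]
    by (simp add: far_at_powr Ch_def Cd_def)
  have "ennreal ((norm (Theta \<theta> t f x - Theta \<theta> t (near z r f) x))\<^sup>2) \<le> (ennreal A * (\<Sum>i\<in>UNIV. ?u i))\<^sup>2"
    using power_mono_ennreal[OF norm_Theta_diff_near_le[OF f t fin, of z r], of 2] by (simp add: ennreal_power)
  also have "\<dots> = ennreal (A\<^sup>2) * (\<Sum>i\<in>UNIV. ?u i)\<^sup>2"
    using A by (simp add: power_mult_distrib ennreal_power)
  also have "\<dots> \<le> ennreal (A\<^sup>2) * ((of_nat CARD('m))\<^sup>2 * (\<Sum>i\<in>UNIV. (?u i)\<^sup>2))"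
    by (intro mult_left_mono ennreal_sum_square_le) auto
  also have "\<dots> \<le> ennreal (A\<^sup>2) * ((of_nat CARD('m))\<^sup>2 * (\<Sum>i\<in>UNIV. ennreal Ch * ?v i))"
    by (intro mult_left_mono sum_mono u) auto
  also have "\<dots> = ennreal (A\<^sup>2 * (real CARD('m))\<^sup>2 * Ch) * (\<Sum>i\<in>UNIV. ?v i)"
    using Ch_pos by (simp add: ennreal_mult sum_distrib_left[symmetric] mult.assoc
        ennreal_power[symmetric] ennreal_of_nat_eq_real_of_nat)
  finally show ?thesis .
qed

text \<open>Hoelder's inequality over the ball with the weights w separates the factors. Only the
  i-th one gains a power of t/r, so the exponent of the gain is multiplied by \<open>w i\<close>,
  and it stays positive.\<close>

lemma nn_integral_ball_far_le:
  fixes f :: "'m \<Rightarrow> real^'n \<Rightarrow> complex"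
  assumes f [measurable]: "\<And>i. f i \<in> borel_measurable borel" and t: "0 < t" "t \<le> r"
  shows "(\<integral>\<^sup>+x\<in>ball z r. (\<Prod>j\<in>UNIV. ennreal_powr (decay_avg (N + \<gamma>) t (far_at z r i (pw f) j) x) (w j)) \<partial>lborel)
    \<le> ennreal (Ca * r ^ DIM(real^'n) * (t / r) powr ((N + \<gamma> - real DIM(real^'n)) * w i)) * Wmax f z"
proof -
  let ?n = "DIM(real^'n)"
  have r: "0 < r" using t by linarith
  have [measurable]: "ball z r \<in> sets borel" by simp
  define c where "c j = Ca * r ^ ?n * (if j = i then (t / r) powr (N + \<gamma> - real ?n) else 1)" for j
  have c: "0 \<le> c j" for j using Ca_pos r by (simp add: c_def)
  have "(\<integral>\<^sup>+x\<in>ball z r. (\<Prod>j\<in>UNIV. ennreal_powr (decay_avg (N + \<gamma>) t (far_at z r i (pw f) j) x) (w j)) \<partial>lborel)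
     = (\<integral>\<^sup>+x. (\<Prod>j\<in>UNIV. ennreal_powr (decay_avg (N + \<gamma>) t (far_at z r i (pw f) j) x * indicator (ball z r) x) (w j)) \<partial>lborel)"
    by (intro nn_integral_cong) (auto simp: indicator_def)
  also have "\<dots> \<le> (\<Prod>j\<in>UNIV. ennreal_powr (\<integral>\<^sup>+x\<in>ball z r. decay_avg (N + \<gamma>) t (far_at z r i (pw f) j) x \<partial>lborel) (w j))"
    using w_pos w_sum by (intro nn_integral_prod_powr_le) auto
  also have "\<dots> \<le> (\<Prod>j\<in>UNIV. ennreal_powr (ennreal (c j) * hl_maximal (pw f j) z) (w j))"
  proof (intro prod_mono_ennreal ennreal_powr_mono)
    fix j
    show "0 \<le> w j" using w_pos[of j] by simp
    show "(\<integral>\<^sup>+x\<in>ball z r. decay_avg (N + \<gamma>) t (far_at z r i (pw f) j) x \<partial>lborel) \<le> ennreal (c j) * hl_maximal (pw f j) z"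
    proof (cases "j = i")
      case True
      have "(\<integral>\<^sup>+x\<in>ball z r. decay_avg (N + \<gamma>) t (far_at z r i (pw f) j) x \<partial>lborel)
         = (\<integral>\<^sup>+x\<in>ball z r. decay_avg (N + \<gamma>) t (\<lambda>y. pw f j y * indicator (- ball z (2 * r)) y) x \<partial>lborel)"
        using True by (intro nn_integral_cong arg_cong2[where f="(*)"] decay_avg_cong) (auto simp: far_at_def)
      also have "\<dots> \<le> ennreal (2 powr (N + \<gamma>) * decay_const ?n (N + \<gamma>) * unit_ball_vol ?n * r ^ ?n
          * (t / r) powr (N + \<gamma> - real ?n)) * hl_maximal (pw f j) z"
        by (intro nn_integral_ball_decay_avg_far_le t exponent) measurable
      also have "\<dots> \<le> ennreal (c j) * hl_maximal (pw f j) z"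
        unfolding c_def Ca_def using True r Cd_pos
        by (intro mult_right_mono ennreal_leI) (auto simp: Cd_def intro!: mult_right_mono)
      finally show ?thesis .
    next
      case False
      have "(\<integral>\<^sup>+x\<in>ball z r. decay_avg (N + \<gamma>) t (far_at z r i (pw f) j) x \<partial>lborel)
         = (\<integral>\<^sup>+x\<in>ball z r. decay_avg (N + \<gamma>) t (pw f j) x \<partial>lborel)"
        using False by (intro nn_integral_cong arg_cong2[where f="(*)"] decay_avg_cong) (auto simp: far_at_def)
      also have "\<dots> \<le> ennreal (c j) * hl_maximal (pw f j) z"
        using nn_integral_ball_decay_avg_le[where f="pw f j" and z=z, OF borel_measurable_pw[OF f] t exponent] False
        by (simp add: c_def Ca_def Cd_def)
      finally show ?thesis .
    qed
  qed
  also have "\<dots> = ennreal (\<Prod>j\<in>UNIV. c j powr w j) * Wmax f z"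
    using c by (simp add: prod_powr_cmult Wmax_def)
  also have "(\<Prod>j\<in>UNIV. c j powr w j) = Ca * r ^ ?n * (t / r) powr ((N + \<gamma> - real ?n) * w i)"
  proof -
    have "(\<Prod>j\<in>UNIV. c j powr w j) = (\<Prod>j\<in>UNIV. (Ca * r ^ ?n) powr w j)
        * (\<Prod>j\<in>UNIV. if j = i then (t / r) powr ((N + \<gamma> - real ?n) * w i) else 1)"
      unfolding prod.distrib[symmetric]
      by (intro prod.cong) (auto simp: c_def powr_mult powr_powr)
    also have "(\<Prod>j\<in>UNIV. (Ca * r ^ ?n) powr w j) = Ca * r ^ ?n"
      using Ca_pos r by (intro prod_powr_const) simp
    finally show ?thesis by simp
  qed
  finally show ?thesis .
qed

end

lemma borel_measurable_ident_lebesgue: "(\<lambda>t::real. t) \<in> borel_measurable lebesgue"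
  by (rule measurable_completion) simp

context weighted_kernel
begin

text \<open>With e the exponent of the gain, the integral of \<open>(t / r) powr e / t\<close> over
  \<open>0 < t < r\<close> equals \<open>1 / e\<close>; the far terms are summed over i.\<close>

definition K_far :: real where
  "K_far = A\<^sup>2 * (real CARD('m))\<^sup>2 * Ch * Ca * (\<Sum>i\<in>UNIV. 1 / ((N + \<gamma> - real DIM(real^'n)) * w i))"

lemma K_far_nonneg: "0 \<le> K_far"
  unfolding K_far_def using exponent w_pos Ch_pos Ca_pos
  by (intro mult_nonneg_nonneg sum_nonneg divide_nonneg_nonneg) (auto simp: less_imp_le)

lemma borel_measurable_Theta_diff_near:
  fixes f :: "'m \<Rightarrow> real^'n \<Rightarrow> complex"
  assumes f: "\<And>i. f i \<in> borel_measurable borel"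
    and fin: "\<And>t x. 0 < t \<Longrightarrow> Decay_prod (N + \<gamma>) t f x < top"
  shows "(\<lambda>p. if 0 < snd p then Theta \<theta> (snd p) f (fst p) - Theta \<theta> (snd p) (near z r f) (fst p) else 0)
    \<in> borel_measurable (lborel \<Otimes>\<^sub>M lebesgue)"
proof -
  have fin': "Decay_prod (N + \<gamma>) t (near z r f) x < top" if "0 < t" for t x
    using Decay_prod_near_le fin[OF that] by (rule le_less_trans)
  have "(\<lambda>p. (if 0 < snd p then Theta \<theta> (snd p) f (fst p) else 0)
      - (if 0 < snd p then Theta \<theta> (snd p) (near z r f) (fst p) else 0)) \<in> borel_measurable (lborel \<Otimes>\<^sub>M lebesgue)"
    by (intro borel_measurable_diff borel_measurable_Theta_pair borel_measurable_near f fin fin')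
  also have "(\<lambda>p. (if 0 < snd p then Theta \<theta> (snd p) f (fst p) else 0)
      - (if 0 < snd p then Theta \<theta> (snd p) (near z r f) (fst p) else 0))
    = (\<lambda>p. if 0 < snd p then Theta \<theta> (snd p) f (fst p) - Theta \<theta> (snd p) (near z r f) (fst p) else 0)"
    by auto
  finally show ?thesis .
qed

lemma far_square_le:
  fixes f :: "'m \<Rightarrow> real^'n \<Rightarrow> complex"
  assumes f [measurable]: "\<And>i. f i \<in> borel_measurable borel"
    and fin: "\<And>t x. 0 < t \<Longrightarrow> Decay_prod (N + \<gamma>) t f x < top"
    and \<alpha>: "0 < \<alpha>" and r: "0 < r"
  shows "(\<integral>\<^sup>+x\<in>ball z r. (\<integral>\<^sup>+t\<in>{\<alpha>..<r}. ennreal ((norm (Theta \<theta> t f x - Theta \<theta> t (near z r f) x))\<^sup>2 / t) \<partial>lebesgue) \<partial>lborel)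
    \<le> ennreal (K_far * r ^ DIM(real^'n)) * Wmax f z"
proof -
  let ?n = "DIM(real^'n)"
  define \<Delta> where "\<Delta> x t = (if 0 < t then Theta \<theta> t f x - Theta \<theta> t (near z r f) x else 0)" for x t
  have [measurable]: "(\<lambda>p. \<Delta> (fst p) (snd p)) \<in> borel_measurable (lborel \<Otimes>\<^sub>M lebesgue)"
    unfolding \<Delta>_def by (rule borel_measurable_Theta_diff_near[OF f fin])
  note [measurable] = borel_measurable_snd_lebesgue
  have [measurable]: "ball z r \<in> sets borel" by simp
  have \<Delta>_space [measurable]: "(\<lambda>x. \<Delta> x t) \<in> borel_measurable lborel" if "0 < t" for t
    using measurable_compose[OF measurable_Pair2', of t lebesgue "\<lambda>p. \<Delta> (fst p) (snd p)" lborel borel] by simp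
  define c where "c = A\<^sup>2 * (real CARD('m))\<^sup>2 * Ch"
  have c: "0 \<le> c" using Ch_pos by (simp add: c_def)
  define e where "e i = (N + \<gamma> - real ?n) * w i" for i
  have e: "0 < e i" for i using exponent w_pos[of i] by (simp add: e_def)
  have "(\<integral>\<^sup>+x\<in>ball z r. (\<integral>\<^sup>+t\<in>{\<alpha>..<r}. ennreal ((norm (Theta \<theta> t f x - Theta \<theta> t (near z r f) x))\<^sup>2 / t) \<partial>lebesgue) \<partial>lborel)
     = (\<integral>\<^sup>+x. (\<integral>\<^sup>+t. ennreal ((norm (\<Delta> x t))\<^sup>2 / t) * indicator {\<alpha>..<r} t * indicator (ball z r) x \<partial>lebesgue) \<partial>lborel)"
  proof (rule nn_integral_cong)
    fix x
    have "(\<integral>\<^sup>+t\<in>{\<alpha>..<r}. ennreal ((norm (Theta \<theta> t f x - Theta \<theta> t (near z r f) x))\<^sup>2 / t) \<partial>lebesgue)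
        = (\<integral>\<^sup>+t\<in>{\<alpha>..<r}. ennreal ((norm (\<Delta> x t))\<^sup>2 / t) \<partial>lebesgue)"
      using \<alpha> by (intro nn_integral_cong) (auto simp: indicator_def \<Delta>_def)
    then show "(\<integral>\<^sup>+t\<in>{\<alpha>..<r}. ennreal ((norm (Theta \<theta> t f x - Theta \<theta> t (near z r f) x))\<^sup>2 / t) \<partial>lebesgue) * indicator (ball z r) x
      = (\<integral>\<^sup>+t. ennreal ((norm (\<Delta> x t))\<^sup>2 / t) * indicator {\<alpha>..<r} t * indicator (ball z r) x \<partial>lebesgue)"
      by (cases "x \<in> ball z r") auto
  qed
  also have "\<dots> = (\<integral>\<^sup>+t. (\<integral>\<^sup>+x. ennreal ((norm (\<Delta> x t))\<^sup>2 / t) * indicator {\<alpha>..<r} t * indicator (ball z r) x \<partial>lborel) \<partial>lebesgue)"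
    by (rule lborel_lebesgue.Fubini'[symmetric]) (unfold case_prod_unfold, measurable)
  \<comment> \<open>The range of scales is enlarged down to 0, which makes the bound independent of
    \<alpha>. The set of scales is written so that the layer cake formula, with the number r as
    upper level, evaluates the power integral.\<close>
  also have "\<dots> \<le> (\<integral>\<^sup>+t. (\<Sum>i\<in>UNIV. (ennreal (c * (Ca * r ^ ?n) * r powr (- e i)) * Wmax f z)
      * (ennreal (t powr (e i - 1)) * indicator {t. 0 < t \<and> ennreal t < ennreal r} t)) \<partial>lebesgue)"
  proof (rule nn_integral_mono)
    fix t :: real
    show "(\<integral>\<^sup>+x. ennreal ((norm (\<Delta> x t))\<^sup>2 / t) * indicator {\<alpha>..<r} t * indicator (ball z r) x \<partial>lborel)
      \<le> (\<Sum>i\<in>UNIV. (ennreal (c * (Ca * r ^ ?n) * r powr (- e i)) * Wmax f z)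
      * (ennreal (t powr (e i - 1)) * indicator {t. 0 < t \<and> ennreal t < ennreal r} t))"
    proof (cases "t \<in> {\<alpha>..<r}")
      case True
      then have t: "0 < t" "t \<le> r" "t < r" using \<alpha> by auto
      let ?P = "\<lambda>i x. \<Prod>j\<in>UNIV. ennreal_powr (decay_avg (N + \<gamma>) t (far_at z r i (pw f) j) x) (w j)"
      have "(\<integral>\<^sup>+x. ennreal ((norm (\<Delta> x t))\<^sup>2 / t) * indicator {\<alpha>..<r} t * indicator (ball z r) x \<partial>lborel)
         \<le> (\<integral>\<^sup>+x. ennreal (1 / t) * (ennreal c * (\<Sum>i\<in>UNIV. ?P i x * indicator (ball z r) x)) \<partial>lborel)"
      proof (rule nn_integral_mono)
        fix x
        have "ennreal ((norm (\<Delta> x t))\<^sup>2) \<le> ennreal c * (\<Sum>i\<in>UNIV. ?P i x)"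
          unfolding \<Delta>_def c_def using t(1) norm_Theta_diff_near_square_le[OF f t(1) fin[OF t(1)], of x z r] by simp
        then have "ennreal (1 / t) * ennreal ((norm (\<Delta> x t))\<^sup>2) \<le> ennreal (1 / t) * (ennreal c * (\<Sum>i\<in>UNIV. ?P i x))"
          by (rule mult_left_mono) simp
        moreover have "ennreal (1 / t) * ennreal ((norm (\<Delta> x t))\<^sup>2) = ennreal ((norm (\<Delta> x t))\<^sup>2 / t)"
          using t by (simp add: ennreal_mult[symmetric])
        ultimately show "ennreal ((norm (\<Delta> x t))\<^sup>2 / t) * indicator {\<alpha>..<r} t * indicator (ball z r) x
            \<le> ennreal (1 / t) * (ennreal c * (\<Sum>i\<in>UNIV. ?P i x * indicator (ball z r) x))"
          using True by (cases "x \<in> ball z r") auto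
      qed
      also have "\<dots> = ennreal (1 / t) * (ennreal c * (\<Sum>i\<in>UNIV. \<integral>\<^sup>+x\<in>ball z r. ?P i x \<partial>lborel))"
        by (subst nn_integral_cmult, measurable, subst nn_integral_cmult, measurable, subst nn_integral_sum, measurable)
      also have "\<dots> \<le> ennreal (1 / t) * (ennreal c * (\<Sum>i\<in>UNIV. ennreal (Ca * r ^ ?n * (t / r) powr (e i)) * Wmax f z))"
        unfolding e_def using t by (intro mult_left_mono sum_mono nn_integral_ball_far_le f) auto
      also have "\<dots> = (\<Sum>i\<in>UNIV. (ennreal (1 / t) * ennreal c * ennreal (Ca * r ^ ?n * (t / r) powr (e i))) * Wmax f z)"
        by (simp add: sum_distrib_left mult.assoc)
      also have "\<dots> = (\<Sum>i\<in>UNIV. (ennreal (c * (Ca * r ^ ?n) * r powr (- e i)) * Wmax f z)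
          * (ennreal (t powr (e i - 1)) * indicator {t. 0 < t \<and> ennreal t < ennreal r} t))"
      proof (rule sum.cong[OF refl])
        fix i
        have "(t / r) powr (e i) = t powr (e i) / r powr (e i)" by (rule powr_divide)
        moreover have "t powr (e i - 1) = t powr (e i) / t" using t by (simp add: powr_diff)
        ultimately have "(1 / t) * c * (Ca * r ^ ?n * (t / r) powr (e i)) = (c * (Ca * r ^ ?n) * r powr (- e i)) * t powr (e i - 1)"
          by (simp add: powr_minus_divide mult_ac)
        then have "ennreal (1 / t) * ennreal c * ennreal (Ca * r ^ ?n * (t / r) powr (e i))
            = ennreal (c * (Ca * r ^ ?n) * r powr (- e i)) * ennreal (t powr (e i - 1))"
          using t r c Ca_pos by (simp add: ennreal_mult[symmetric])
        then show "(ennreal (1 / t) * ennreal c * ennreal (Ca * r ^ ?n * (t / r) powr (e i))) * Wmax f z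
          = (ennreal (c * (Ca * r ^ ?n) * r powr (- e i)) * Wmax f z)
          * (ennreal (t powr (e i - 1)) * indicator {t. 0 < t \<and> ennreal t < ennreal r} t)"
          using t by (simp add: ennreal_less_iff mult_ac)
      qed
      finally show ?thesis .
    qed simp
  qed
  also have "\<dots> = (\<Sum>i\<in>UNIV. (ennreal (c * (Ca * r ^ ?n) * r powr (- e i)) * Wmax f z)
      * (\<integral>\<^sup>+t. ennreal (t powr (e i - 1)) * indicator {t. 0 < t \<and> ennreal t < ennreal r} t \<partial>lborel))"
    unfolding nn_integral_completion
    by (subst nn_integral_sum, measurable, intro sum.cong refl nn_integral_cmult, measurable)
  also have "\<dots> = (\<Sum>i\<in>UNIV. ennreal (c * (Ca * r ^ ?n) * (1 / e i)) * Wmax f z)"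
  proof (rule sum.cong[OF refl])
    fix i
    have "c * (Ca * r ^ ?n) * r powr (- e i) * (1 / e i * r powr (e i)) = c * (Ca * r ^ ?n) * (1 / e i)"
      using r by (simp add: powr_minus_divide)
    then have "ennreal (c * (Ca * r ^ ?n) * r powr (- e i)) * (ennreal (1 / e i) * ennreal (r powr (e i)))
        = ennreal (c * (Ca * r ^ ?n) * (1 / e i))"
      using c r Ca_pos e[of i] by (simp add: ennreal_mult[symmetric] less_imp_le)
    then show "(ennreal (c * (Ca * r ^ ?n) * r powr (- e i)) * Wmax f z)
      * (\<integral>\<^sup>+t. ennreal (t powr (e i - 1)) * indicator {t. 0 < t \<and> ennreal t < ennreal r} t \<partial>lborel)
      = ennreal (c * (Ca * r ^ ?n) * (1 / e i)) * Wmax f z"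
    proof -
      have "(\<integral>\<^sup>+t. ennreal (t powr (e i - 1)) * indicator {t. 0 < t \<and> ennreal t < ennreal r} t \<partial>lborel)
          = ennreal (1 / e i) * ennreal (r powr (e i))"
        using nn_integral_layer_cake[OF e[of i], of "ennreal r"] r by (simp add: ennreal_powr_ennreal)
      moreover have "(u * W) * (v * y) = (u * (v * y)) * W" for u v y W :: ennreal
        by (simp only: mult_ac)
      ultimately show ?thesis
        using \<open>ennreal (c * (Ca * r ^ ?n) * r powr (- e i)) * (ennreal (1 / e i) * ennreal (r powr (e i))) = _\<close>
        by simp
    qed
  qed
  also have "\<dots> = ennreal (\<Sum>i\<in>UNIV. c * (Ca * r ^ ?n) * (1 / e i)) * Wmax f z"
  proof -
    have "0 \<le> c * (Ca * r ^ ?n) * (1 / e i)" for i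
      using c r Ca_pos e[of i] by (simp add: less_imp_le)
    then have "(\<Sum>i\<in>UNIV. ennreal (c * (Ca * r ^ ?n) * (1 / e i))) = ennreal (\<Sum>i\<in>UNIV. c * (Ca * r ^ ?n) * (1 / e i))"
      by (rule sum_ennreal)
    then show ?thesis by (simp only: sum_distrib_right[symmetric])
  qed
  also have "(\<Sum>i\<in>UNIV. c * (Ca * r ^ ?n) * (1 / e i)) = K_far * r ^ ?n"
    by (simp add: K_far_def c_def e_def sum_distrib_left sum_distrib_right mult_ac)
  finally show ?thesis .
qed

lemma in_Lp_near:
  fixes f :: "'m \<Rightarrow> real^'n \<Rightarrow> complex"
  assumes f: "\<And>i. f i \<in> borel_measurable borel"
    and fin: "(\<integral>\<^sup>+y\<in>ball z (2 * r). pw f i y \<partial>lborel) < top"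
  shows "in_Lp (2 / w i) (near z r f i)"
    and "Lp_norm (2 / w i) (\<lambda>x. ennreal (norm (near z r f i x)))
      = ennreal_powr (\<integral>\<^sup>+y\<in>ball z (2 * r). pw f i y \<partial>lborel) (w i / 2)"
proof -
  have eq: "(\<integral>\<^sup>+x. ennreal_powr (ennreal (norm (near z r f i x))) (2 / w i) \<partial>lborel)
      = (\<integral>\<^sup>+y\<in>ball z (2 * r). pw f i y \<partial>lborel)"
    by (intro nn_integral_cong) (auto simp: near_def pw_def indicator_def)
  have q: "0 < 2 / w i" using w_pos[of i] by simp
  show "in_Lp (2 / w i) (near z r f i)"
    unfolding in_Lp_iff[OF q] eq using fin borel_measurable_near[where z=z and r=r and i=i, OF f]
    by (simp add: measurable_completion)
  show "Lp_norm (2 / w i) (\<lambda>x. ennreal (norm (near z r f i x)))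
      = ennreal_powr (\<integral>\<^sup>+y\<in>ball z (2 * r). pw f i y \<partial>lborel) (w i / 2)"
    unfolding Lp_norm_eq[OF q] eq by simp
qed

text \<open>The hypothesis enters here only. The cut-off functions have finite norms even when the f
  i do not, and each norm is the mass of \<open>pw f i\<close> on a ball centred at z, hence at most
  the volume times the maximal function at z.\<close>

lemma near_square_le:
  fixes f :: "'m \<Rightarrow> real^'n \<Rightarrow> complex"
  assumes f [measurable]: "\<And>i. f i \<in> borel_measurable borel"
    and loc_fin: "\<And>i. (\<integral>\<^sup>+y\<in>ball z (2 * r). pw f i y \<partial>lborel) < top"
    and bd: "\<And>h. (\<And>i. in_Lp (2 / w i) (h i)) \<Longrightarrow>
        Lp_norm 2 (square_function \<theta> h) \<le> ennreal C0 * (\<Prod>i\<in>UNIV. Lp_norm (2 / w i) (\<lambda>x. ennreal (norm (h i x))))"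
    and C0: "0 \<le> C0" and r: "0 < r" and \<alpha>: "0 < \<alpha>"
  shows "(\<integral>\<^sup>+x. sq_trunc (near z r f) \<alpha> r x \<partial>lborel)
    \<le> ennreal (C0\<^sup>2 * (unit_ball_vol DIM(real^'n) * 2 ^ DIM(real^'n)) * r ^ DIM(real^'n)) * Wmax f z"
proof -
  let ?n = "DIM(real^'n)"
  define v where "v = unit_ball_vol (real ?n) * (2 * r) ^ ?n"
  have v: "0 < v" using r by (simp add: v_def)
  have "(\<integral>\<^sup>+x. sq_trunc (near z r f) \<alpha> r x \<partial>lborel) \<le> (\<integral>\<^sup>+x. ennreal_powr (square_function \<theta> (near z r f) x) 2 \<partial>lborel)"
    unfolding square_function_def ennreal_powr_powr sq_trunc_def
    using \<alpha> by (intro nn_integral_mono) (auto intro!: nn_integral_mono simp: indicator_def)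
  also have "\<dots> = ennreal_powr (Lp_norm 2 (square_function \<theta> (near z r f))) 2"
    by (subst Lp_norm_powr) auto
  also have "\<dots> \<le> ennreal_powr (ennreal C0 * (\<Prod>i\<in>UNIV. Lp_norm (2 / w i) (\<lambda>x. ennreal (norm (near z r f i x))))) 2"
    by (intro ennreal_powr_mono bd in_Lp_near f loc_fin) auto
  also have "\<dots> = ennreal (C0\<^sup>2) * (\<Prod>i\<in>UNIV. ennreal_powr (\<integral>\<^sup>+y\<in>ball z (2 * r). pw f i y \<partial>lborel) (w i))"
    using C0 by (simp add: ennreal_powr_mult ennreal_powr_prod in_Lp_near(2)[OF f loc_fin] ennreal_powr_powr
        ennreal_powr_ennreal)
  also have "\<dots> \<le> ennreal (C0\<^sup>2) * (\<Prod>i\<in>UNIV. ennreal_powr (ennreal v * hl_maximal (pw f i) z) (w i))"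
  proof (intro mult_left_mono prod_mono_ennreal ennreal_powr_mono)
    fix i
    have "(\<integral>\<^sup>+y\<in>ball z (2 * r). pw f i y \<partial>lborel) \<le> emeasure lborel (ball z (2 * r)) * hl_maximal (pw f i) z"
      using r by (intro nn_integral_ball_le_hl_maximal) simp
    also have "emeasure lborel (ball z (2 * r)) = ennreal v"
      using r by (simp add: emeasure_ball v_def)
    finally show "(\<integral>\<^sup>+y\<in>ball z (2 * r). pw f i y \<partial>lborel) \<le> ennreal v * hl_maximal (pw f i) z" .
  qed (use w_pos in \<open>auto simp: less_imp_le\<close>)
  also have "\<dots> = ennreal (C0\<^sup>2) * (ennreal v * Wmax f z)"
    using v by (simp add: prod_powr_cmult prod_powr_const Wmax_def less_imp_le)
  also have "\<dots> = ennreal (C0\<^sup>2 * v) * Wmax f z"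
    using v by (simp add: ennreal_mult mult.assoc)
  also have "C0\<^sup>2 * v = C0\<^sup>2 * (unit_ball_vol ?n * 2 ^ ?n) * r ^ ?n"
    by (simp add: v_def power_mult_distrib)
  finally show ?thesis .
qed

definition K_loc :: "real \<Rightarrow> real" where
  "K_loc C0 = 2 * (C0\<^sup>2 * (unit_ball_vol DIM(real^'n) * 2 ^ DIM(real^'n))) + 2 * K_far"

lemma K_loc_nonneg: "0 \<le> K_loc C0"
  using K_far_nonneg by (simp add: K_loc_def)

text \<open>Near and far parts recombine by \<open>norm_square_le\<close>, which accounts for the
  factors 2 in \<open>K_loc\<close>. The bound does not depend on the lower limit \<alpha> of the
  scales.\<close>

lemma local_square_le:
  fixes f :: "'m \<Rightarrow> real^'n \<Rightarrow> complex"
  assumes f [measurable]: "\<And>i. f i \<in> borel_measurable borel"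
    and fin: "\<And>t x. 0 < t \<Longrightarrow> Decay_prod (N + \<gamma>) t f x < top"
    and loc_fin: "\<And>i. (\<integral>\<^sup>+y\<in>ball z (2 * r). pw f i y \<partial>lborel) < top"
    and bd: "\<And>h. (\<And>i. in_Lp (2 / w i) (h i)) \<Longrightarrow>
        Lp_norm 2 (square_function \<theta> h) \<le> ennreal C0 * (\<Prod>i\<in>UNIV. Lp_norm (2 / w i) (\<lambda>x. ennreal (norm (h i x))))"
    and C0: "0 \<le> C0" and r: "0 < r" and \<alpha>: "0 < \<alpha>"
  shows "(\<integral>\<^sup>+x\<in>ball z r. sq_trunc f \<alpha> r x \<partial>lborel) \<le> ennreal (K_loc C0 * r ^ DIM(real^'n)) * Wmax f z"
proof -
  let ?n = "DIM(real^'n)"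
  have fin': "Decay_prod (N + \<gamma>) t (near z r f) x < top" if "0 < t" for t x
    using Decay_prod_near_le fin[OF that] by (rule le_less_trans)
  note near = borel_measurable_near[OF f]
  define \<Delta> where "\<Delta> x t = (if 0 < t then Theta \<theta> t f x - Theta \<theta> t (near z r f) x else 0)" for x t
  have \<Delta>_meas [measurable]: "(\<lambda>p. \<Delta> (fst p) (snd p)) \<in> borel_measurable (lborel \<Otimes>\<^sub>M lebesgue)"
    unfolding \<Delta>_def by (rule borel_measurable_Theta_diff_near[OF f fin])
  note [measurable] = borel_measurable_snd_lebesgue borel_measurable_ident_lebesgue
  have [measurable]: "\<Delta> x \<in> borel_measurable lebesgue" for x
    using measurable_compose[OF measurable_Pair1' \<Delta>_meas, of x] by simp
  note [measurable] = borel_measurable_Theta_time[OF near fin']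
  have [measurable]: "ball z r \<in> sets borel" by simp
  let ?E = "\<lambda>x. \<integral>\<^sup>+t\<in>{\<alpha>..<r}. ennreal ((norm (\<Delta> x t))\<^sup>2 / t) \<partial>lebesgue"
  have E_meas [measurable]: "?E \<in> borel_measurable lborel"
    by (rule lebesgue.borel_measurable_nn_integral, unfold case_prod_unfold) measurable
  have sq_meas [measurable]: "sq_trunc (near z r f) \<alpha> r \<in> borel_measurable lborel"
    using borel_measurable_sq_trunc[OF near fin' \<alpha>] by simp
  have pointwise: "sq_trunc f \<alpha> r x \<le> 2 * sq_trunc (near z r f) \<alpha> r x + 2 * ?E x" for x
  proof -
    let ?T = "\<lambda>t. if 0 < t then Theta \<theta> t (near z r f) x else 0"
    have "sq_trunc f \<alpha> r x \<le> (\<integral>\<^sup>+t. 2 * (ennreal ((norm (?T t))\<^sup>2 / t) * indicator {\<alpha>..<r} t)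
        + 2 * (ennreal ((norm (\<Delta> x t))\<^sup>2 / t) * indicator {\<alpha>..<r} t) \<partial>lebesgue)"
      unfolding sq_trunc_def
    proof (rule nn_integral_mono)
      fix t :: real
      show "ennreal ((norm (Theta \<theta> t f x))\<^sup>2 / t) * indicator {\<alpha>..<r} t
        \<le> 2 * (ennreal ((norm (?T t))\<^sup>2 / t) * indicator {\<alpha>..<r} t)
        + 2 * (ennreal ((norm (\<Delta> x t))\<^sup>2 / t) * indicator {\<alpha>..<r} t)"
      proof (cases "t \<in> {\<alpha>..<r}")
        case True
        then have t: "0 < t" using \<alpha> by auto
        have "(norm (Theta \<theta> t f x))\<^sup>2 / t \<le> (2 * (norm (?T t))\<^sup>2 + 2 * (norm (\<Delta> x t))\<^sup>2) / t"
          using norm_square_le[of "Theta \<theta> t f x" "Theta \<theta> t (near z r f) x"] t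
          by (intro divide_right_mono) (auto simp: \<Delta>_def)
        also have "\<dots> = 2 * ((norm (?T t))\<^sup>2 / t) + 2 * ((norm (\<Delta> x t))\<^sup>2 / t)"
          by (simp add: add_divide_distrib)
        finally have "ennreal ((norm (Theta \<theta> t f x))\<^sup>2 / t) \<le> ennreal (2 * ((norm (?T t))\<^sup>2 / t) + 2 * ((norm (\<Delta> x t))\<^sup>2 / t))"
          by (rule ennreal_leI)
        also have "\<dots> = ennreal (2 * ((norm (?T t))\<^sup>2 / t)) + ennreal (2 * ((norm (\<Delta> x t))\<^sup>2 / t))"
          using t by (intro ennreal_plus) auto
        also have "\<dots> = 2 * ennreal ((norm (?T t))\<^sup>2 / t) + 2 * ennreal ((norm (\<Delta> x t))\<^sup>2 / t)"
          using t ennreal_mult[of 2 "(norm (?T t))\<^sup>2 / t"] ennreal_mult[of 2 "(norm (\<Delta> x t))\<^sup>2 / t"] by simp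
        finally show ?thesis using True by simp
      qed simp
    qed
    also have "\<dots> = 2 * (\<integral>\<^sup>+t. ennreal ((norm (?T t))\<^sup>2 / t) * indicator {\<alpha>..<r} t \<partial>lebesgue) + 2 * ?E x"
      by (subst nn_integral_add, measurable, subst nn_integral_cmult, measurable, subst nn_integral_cmult, measurable)
    also have "(\<integral>\<^sup>+t. ennreal ((norm (?T t))\<^sup>2 / t) * indicator {\<alpha>..<r} t \<partial>lebesgue) = sq_trunc (near z r f) \<alpha> r x"
      unfolding sq_trunc_def using \<alpha> by (intro nn_integral_cong) (auto simp: indicator_def)
    finally show ?thesis .
  qed
  have "(\<integral>\<^sup>+x\<in>ball z r. sq_trunc f \<alpha> r x \<partial>lborel)
      \<le> (\<integral>\<^sup>+x. 2 * sq_trunc (near z r f) \<alpha> r x + 2 * (?E x * indicator (ball z r) x) \<partial>lborel)"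
    using pointwise by (intro nn_integral_mono) (auto simp: indicator_def)
  also have "\<dots> = 2 * (\<integral>\<^sup>+x. sq_trunc (near z r f) \<alpha> r x \<partial>lborel) + 2 * (\<integral>\<^sup>+x\<in>ball z r. ?E x \<partial>lborel)"
    by (subst nn_integral_add, measurable, subst nn_integral_cmult, measurable, subst nn_integral_cmult, measurable)
  also have "(\<integral>\<^sup>+x\<in>ball z r. ?E x \<partial>lborel)
     = (\<integral>\<^sup>+x\<in>ball z r. (\<integral>\<^sup>+t\<in>{\<alpha>..<r}. ennreal ((norm (Theta \<theta> t f x - Theta \<theta> t (near z r f) x))\<^sup>2 / t) \<partial>lebesgue) \<partial>lborel)"
  proof -
    have "?E x = (\<integral>\<^sup>+t\<in>{\<alpha>..<r}. ennreal ((norm (Theta \<theta> t f x - Theta \<theta> t (near z r f) x))\<^sup>2 / t) \<partial>lebesgue)" for x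
      using \<alpha> by (intro nn_integral_cong) (auto simp: indicator_def \<Delta>_def)
    then show ?thesis by (simp only:)
  qed
  also have "2 * (\<integral>\<^sup>+x. sq_trunc (near z r f) \<alpha> r x \<partial>lborel) + 2 * \<dots>
     \<le> 2 * (ennreal (C0\<^sup>2 * (unit_ball_vol ?n * 2 ^ ?n) * r ^ ?n) * Wmax f z) + 2 * (ennreal (K_far * r ^ ?n) * Wmax f z)"
    by (intro add_mono mult_left_mono near_square_le far_square_le f fin loc_fin C0 r \<alpha>) (auto intro: bd)
  also have "\<dots> = (2 * ennreal (C0\<^sup>2 * (unit_ball_vol ?n * 2 ^ ?n) * r ^ ?n) + 2 * ennreal (K_far * r ^ ?n)) * Wmax f z"
    by (simp add: distrib_right mult.assoc)
  also have "2 * ennreal (C0\<^sup>2 * (unit_ball_vol ?n * 2 ^ ?n) * r ^ ?n) + 2 * ennreal (K_far * r ^ ?n)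
      = ennreal (K_loc C0 * r ^ ?n)"
  proof -
    define X where "X = C0\<^sup>2 * (unit_ball_vol (real ?n) * 2 ^ ?n) * r ^ ?n"
    define Y where "Y = K_far * r ^ ?n"
    have "0 \<le> X" "0 \<le> Y" using r K_far_nonneg by (auto simp: X_def Y_def)
    then have "2 * ennreal X + 2 * ennreal Y = ennreal (2 * X + 2 * Y)"
      using ennreal_mult[of 2 X] ennreal_mult[of 2 Y] by (simp add: ennreal_plus)
    also have "2 * X + 2 * Y = K_loc C0 * r ^ ?n" by (simp add: X_def Y_def K_loc_def algebra_simps)
    finally show ?thesis by (simp only: X_def Y_def)
  qed
  finally show ?thesis .
qed

end

section \<open>Dyadic cells\<close>

text \<open>
  The cells of generation \<open>k\<close>, numbered by an encoding of their integer coordinates, are half-open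
  cubes of side length \<open>R / (n 2\<^sup>k)\<close>, so that their diameters are below \<open>R / 2\<^sup>k\<close>.
\<close>

definition cell :: "real \<Rightarrow> nat \<Rightarrow> real^'n \<Rightarrow> nat" where
  "cell R k x = to_nat (\<chi> i. \<lfloor>real CARD('n) * 2 ^ k / R * x $ i\<rfloor>)"

lemma cell_eq_iff:
  fixes x y :: "real^'n"
  shows "cell R k x = cell R k y \<longleftrightarrow>
    (\<forall>i. \<lfloor>real CARD('n) * 2 ^ k / R * x $ i\<rfloor> = \<lfloor>real CARD('n) * 2 ^ k / R * y $ i\<rfloor>)"
  by (simp add: cell_def vec_eq_iff)

text \<open>The index of the parent is half that of the child, rounded down; \<open>div\<close>
  rounds down for negative indices as well.\<close>

lemma cell_nested:
  fixes x y :: "real^'n"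
  assumes "cell R (Suc k) x = cell R (Suc k) y"
  shows "cell R k x = cell R k y"
proof -
  have half: "\<lfloor>real CARD('n) * 2 ^ k / R * u\<rfloor> = \<lfloor>real CARD('n) * 2 ^ Suc k / R * u\<rfloor> div 2" for u
  proof -
    have "real CARD('n) * 2 ^ k / R * u = (real CARD('n) * 2 ^ Suc k / R * u) / real_of_int 2"
      by simp
    also have "\<lfloor>\<dots>\<rfloor> = \<lfloor>real CARD('n) * 2 ^ Suc k / R * u\<rfloor> div 2"
      by (rule floor_divide_real_eq_div) simp
    finally show ?thesis .
  qed
  show ?thesis
    using assms unfolding cell_eq_iff half by simp
qed

text \<open>The Euclidean norm is at most the sum of n coordinates, each below the side length. The
  factor \<open>1 / n\<close> in the side length is there to compensate.\<close>

lemma dist_lt_of_cell_eq: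
  fixes x y :: "real^'n"
  assumes R: "0 < R" and eq: "cell R k x = cell R k y"
  shows "dist x y < R / 2 ^ k"
proof -
  define u where "u = real CARD('n) * 2 ^ k / R"
  have u: "0 < u" using R by (simp add: u_def)
  have coord: "\<bar>x $ i - y $ i\<bar> < 1 / u" for i
  proof -
    have "\<lfloor>u * x $ i\<rfloor> = \<lfloor>u * y $ i\<rfloor>" using eq by (simp add: cell_eq_iff u_def)
    then have "\<bar>u * x $ i - u * y $ i\<bar> < 1" by linarith
    then have "u * \<bar>x $ i - y $ i\<bar> < 1"
      using u by (simp add: abs_mult right_diff_distrib[symmetric])
    then show ?thesis using u by (simp add: field_simps)
  qed
  have "dist x y \<le> (\<Sum>i\<in>UNIV. \<bar>(x - y) $ i\<bar>)"
    unfolding dist_norm by (rule norm_le_l1_cart)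
  also have "\<dots> < (\<Sum>i\<in>(UNIV::'n set). 1 / u)"
    using coord by (intro sum_strict_mono) auto
  also have "\<dots> = R / 2 ^ k" using R by (simp add: u_def)
  finally show ?thesis .
qed

lemma measurable_cell [measurable]: "(cell R k :: real^'n \<Rightarrow> nat) \<in> borel \<rightarrow>\<^sub>M count_space UNIV"
proof (subst measurable_count_space_eq2_countable)
  have "cell R k -` {c} \<in> sets (borel :: (real^'n) measure)" for c
  proof (cases "\<exists>x0 :: real^'n. cell R k x0 = c")
    case True
    then obtain x0 :: "real^'n" where x0: "cell R k x0 = c" by auto
    have "cell R k -` {c} = (\<Inter>i. {x. \<lfloor>real CARD('n) * 2 ^ k / R * x $ i\<rfloor> = \<lfloor>real CARD('n) * 2 ^ k / R * x0 $ i\<rfloor>})"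
      unfolding x0[symmetric] by (auto simp: cell_eq_iff)
    also have "\<dots> \<in> sets borel"
      by (intro sets.countable_INT') auto
    finally show ?thesis .
  next
    case False
    then have "cell R k -` {c} = ({} :: (real^'n) set)" by auto
    then show ?thesis by simp
  qed
  then show "cell R k \<in> space borel \<rightarrow> UNIV \<and> (\<forall>a\<in>UNIV. cell R k -` {a} \<inter> space borel \<in> sets (borel :: (real^'n) measure))"
    by simp
qed

text \<open>The open box inside the half-open cell gives a lower bound, and that is the right
  direction: the volume of a cell will be divided by.\<close>

lemma emeasure_cell_ge:
  fixes x :: "real^'n"
  assumes R: "0 < R"
  shows "ennreal ((R / 2 ^ k / real CARD('n)) ^ CARD('n)) \<le> emeasure lborel (cell R k -` {cell R k x} :: (real^'n) set)"
proof -
  define u where "u = real CARD('n) * 2 ^ k / R"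
  have u: "0 < u" using R by (simp add: u_def)
  define l where "l = (\<chi> i. of_int \<lfloor>u * x $ i\<rfloor> / u)"
  define h where "h = (\<chi> i. (of_int \<lfloor>u * x $ i\<rfloor> + 1) / u)"
  have "y \<in> cell R k -` {cell R k x}" if "y \<in> box l h" for y
  proof -
    have "\<lfloor>u * y $ i\<rfloor> = \<lfloor>u * x $ i\<rfloor>" for i
    proof -
      have "l $ i < y $ i" "y $ i < h $ i" using that by (auto simp: mem_box_cart)
      then have "of_int \<lfloor>u * x $ i\<rfloor> < u * y $ i" "u * y $ i < of_int \<lfloor>u * x $ i\<rfloor> + 1"
        using u by (auto simp: l_def h_def field_simps)
      then show ?thesis by linarith
    qed
    then show ?thesis by (simp add: cell_eq_iff u_def)
  qed
  then have "emeasure lborel (box l h) \<le> emeasure lborel (cell R k -` {cell R k x} :: (real^'n) set)"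
    using measurable_sets[OF measurable_cell, of "{cell R k x}" R k] by (intro emeasure_mono) auto
  also have "emeasure lborel (box l h) = ennreal ((R / 2 ^ k / real CARD('n)) ^ CARD('n))"
  proof -
    have le: "l \<bullet> b \<le> h \<bullet> b" if "b \<in> Basis" for b
      using that u by (auto simp: Basis_vec_def inner_axis l_def h_def divide_right_mono)
    have "(\<Prod>b\<in>Basis. (h - l) \<bullet> b) = (\<Prod>i\<in>(UNIV::'n set). 1 / u)"
      unfolding prod_Basis_vec by (simp add: inner_axis l_def h_def diff_divide_distrib[symmetric])
    also have "\<dots> = (R / 2 ^ k / real CARD('n)) ^ CARD('n)"
      using R by (simp add: u_def field_simps)
    finally show ?thesis using le by (simp add: emeasure_lborel_box)
  qed
  finally show ?thesis .
qed

context weighted_kernel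
begin

lemma sq_trunc_split:
  fixes f :: "'m \<Rightarrow> real^'n \<Rightarrow> complex"
  assumes f: "\<And>i. f i \<in> borel_measurable borel"
    and fin: "\<And>t x. 0 < t \<Longrightarrow> Decay_prod (N + \<gamma>) t f x < top"
    and ab: "0 < a" "a \<le> b" "b \<le> c"
  shows "sq_trunc f a c x = sq_trunc f a b x + sq_trunc f b c x"
proof -
  let ?T = "\<lambda>t. if 0 < t then Theta \<theta> t f x else 0"
  note [measurable] = borel_measurable_Theta_time[OF f fin] borel_measurable_ident_lebesgue
  have eq: "sq_trunc f a' b' x = (\<integral>\<^sup>+t. ennreal ((norm (?T t))\<^sup>2 / t) * indicator {a'..<b'} t \<partial>lebesgue)"
    if "0 < a'" for a' b'
    unfolding sq_trunc_def using that by (intro nn_integral_cong) (auto simp: indicator_def)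
  have "sq_trunc f a c x = (\<integral>\<^sup>+t. ennreal ((norm (?T t))\<^sup>2 / t) * indicator {a..<b} t
      + ennreal ((norm (?T t))\<^sup>2 / t) * indicator {b..<c} t \<partial>lebesgue)"
    unfolding eq[OF ab(1)] using ab by (intro nn_integral_cong) (auto simp: indicator_def)
  also have "\<dots> = sq_trunc f a b x + sq_trunc f b c x"
    using ab by (subst nn_integral_add) (measurable, simp add: eq)
  finally show ?thesis .
qed

text \<open>Larger j means finer scales. The sum over j up to k is thus the coarse part at
  generation k, and the sum from k on collects the scales below the size of a cell.\<close>

definition layer :: "('m \<Rightarrow> real^'n \<Rightarrow> complex) \<Rightarrow> real \<Rightarrow> nat \<Rightarrow> real^'n \<Rightarrow> ennreal" where
  "layer f R j = sq_trunc f (R / 2 ^ Suc j) (R / 2 ^ j)"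

lemma sum_layer:
  fixes f :: "'m \<Rightarrow> real^'n \<Rightarrow> complex"
  assumes f: "\<And>i. f i \<in> borel_measurable borel"
    and fin: "\<And>t x. 0 < t \<Longrightarrow> Decay_prod (N + \<gamma>) t f x < top"
    and R: "0 < R" and kL: "k \<le> L"
  shows "(\<Sum>j=k..L. layer f R j x) = sq_trunc f (R / 2 ^ Suc L) (R / 2 ^ k) x"
  using kL
proof (induction L rule: dec_induct)
  case base
  then show ?case by (simp add: layer_def)
next
  case (step L)
  have "R / 2 ^ Suc (Suc L) \<le> R / 2 ^ Suc L"
    using R by (intro divide_left_mono) auto
  moreover have "R / 2 ^ Suc L \<le> R / 2 ^ k"
    using R step.hyps by (intro divide_left_mono power_increasing) auto
  ultimately have "sq_trunc f (R / 2 ^ Suc (Suc L)) (R / 2 ^ k) x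
      = sq_trunc f (R / 2 ^ Suc (Suc L)) (R / 2 ^ Suc L) x + sq_trunc f (R / 2 ^ Suc L) (R / 2 ^ k) x"
    using R by (intro sq_trunc_split f fin) auto
  then show ?case
    using step by (simp add: layer_def add.commute)
qed

text \<open>One constant serves both the local and the oscillation estimate. The power of n is the
  ratio of \<open>r ^ n\<close> to the lower bound for the volume of a cell, and the summand 1 makes
  the constant positive.\<close>

definition K_cells :: "real \<Rightarrow> real" where
  "K_cells C0 = K_loc C0 * real CARD('n) ^ CARD('n) + K_osc + 1"

lemma K_osc_nonneg: "0 \<le> K_osc"
  using Ch_pos Cd_pos \<gamma> by (simp add: K_osc_def)

lemma K_cells_pos: "0 < K_cells C0"
  using K_loc_nonneg[of C0] K_osc_nonneg by (simp add: K_cells_def add_nonneg_pos)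

text \<open>Every point z of the cell is the centre of a ball of radius r containing the cell, so
  the ball estimate holds with W at every such z. Integrating it over z in the cell and dividing by
  the volume replaces W at one point by its average.\<close>

lemma cell_square_le:
  fixes f :: "'m \<Rightarrow> real^'n \<Rightarrow> complex"
  assumes f [measurable]: "\<And>i. f i \<in> borel_measurable borel"
    and fin: "\<And>t x. 0 < t \<Longrightarrow> Decay_prod (N + \<gamma>) t f x < top"
    and loc_fin: "\<And>i z r. (\<integral>\<^sup>+y\<in>ball z r. pw f i y \<partial>lborel) < top"
    and bd: "\<And>h. (\<And>i. in_Lp (2 / w i) (h i)) \<Longrightarrow>
        Lp_norm 2 (square_function \<theta> h) \<le> ennreal C0 * (\<Prod>i\<in>UNIV. Lp_norm (2 / w i) (\<lambda>x. ennreal (norm (h i x))))"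
    and C0: "0 \<le> C0" and R: "0 < R" and \<alpha>: "0 < \<alpha>"
  shows "(\<integral>\<^sup>+x. sq_trunc f \<alpha> (R / 2 ^ k) x * indicator (cell R k -` {c}) x \<partial>lborel)
    \<le> ennreal (K_cells C0) * (\<integral>\<^sup>+x. Wmax f x * indicator (cell R k -` {c}) x \<partial>lborel)"
proof (cases "\<exists>x :: real^'n. cell R k x = c")
  case False
  then have "cell R k -` {c} = ({} :: (real^'n) set)" by auto
  then show ?thesis by simp
next
  case True
  then obtain x0 :: "real^'n" where x0: "cell R k x0 = c" by auto
  define Q where "Q = (cell R k -` {c} :: (real^'n) set)"
  have [measurable]: "Q \<in> sets borel"
    using measurable_sets[OF measurable_cell, of "{c}" R k] by (simp add: Q_def)
  define r where "r = R / 2 ^ k"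
  have r: "0 < r" using R by (simp add: r_def)
  define n where "n = CARD('n)"
  define J where "J = (\<integral>\<^sup>+x. sq_trunc f \<alpha> r x * indicator Q x \<partial>lborel)"
  have J: "J \<le> ennreal (K_loc C0 * r ^ n) * Wmax f z" if z: "z \<in> Q" for z
  proof -
    have "J \<le> (\<integral>\<^sup>+x\<in>ball z r. sq_trunc f \<alpha> r x \<partial>lborel)"
      unfolding J_def
    proof (intro nn_integral_mono mult_left_mono)
      fix x
      have "x \<in> ball z r" if "x \<in> Q"
        using dist_lt_of_cell_eq[OF R, of k z x] z that by (simp add: Q_def r_def)
      then show "indicator Q x \<le> (indicator (ball z r) x :: ennreal)"
        by (auto simp: indicator_def)
    qed simp
    also have "\<dots> \<le> ennreal (K_loc C0 * r ^ n) * Wmax f z"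
      using local_square_le[OF f fin loc_fin bd C0 r \<alpha>, of z] by (simp add: n_def)
    finally show ?thesis .
  qed
  have "J * emeasure lborel Q = (\<integral>\<^sup>+z. J * indicator Q z \<partial>lborel)"
    by (subst nn_integral_cmult_indicator) auto
  also have "\<dots> \<le> (\<integral>\<^sup>+z. ennreal (K_loc C0 * r ^ n) * (Wmax f z * indicator Q z) \<partial>lborel)"
    using J by (intro nn_integral_mono) (auto simp: indicator_def)
  also have "\<dots> = ennreal (K_loc C0 * r ^ n) * (\<integral>\<^sup>+z. Wmax f z * indicator Q z \<partial>lborel)"
    by (rule nn_integral_cmult) measurable
  finally have JQ: "J * emeasure lborel Q \<le> ennreal (K_loc C0 * r ^ n) * (\<integral>\<^sup>+z. Wmax f z * indicator Q z \<partial>lborel)" .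
  have q_pos: "0 < (r / real n) ^ n" using r by (simp add: n_def)
  \<comment> \<open>The division is written as multiplication by a real reciprocal, which also works
    when J is infinite.\<close>
  have "J = ennreal (1 / (r / real n) ^ n) * (J * ennreal ((r / real n) ^ n))"
  proof -
    have "ennreal (1 / (r / real n) ^ n) * (J * ennreal ((r / real n) ^ n))
        = J * (ennreal (1 / (r / real n) ^ n) * ennreal ((r / real n) ^ n))"
      by (simp only: mult_ac)
    also have "ennreal (1 / (r / real n) ^ n) * ennreal ((r / real n) ^ n) = 1"
    proof -
      have "ennreal (1 / c) * ennreal c = 1" if "0 < c" for c
        using that by (simp add: ennreal_mult[symmetric])
      then show ?thesis using q_pos .
    qed
    finally show ?thesis by simp
  qed
  also have "\<dots> \<le> ennreal (1 / (r / real n) ^ n) * (J * emeasure lborel Q)"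
    using emeasure_cell_ge[OF R, of k x0] by (intro mult_left_mono) (auto simp: Q_def x0 r_def n_def)
  also have "\<dots> \<le> ennreal (1 / (r / real n) ^ n) * (ennreal (K_loc C0 * r ^ n) * (\<integral>\<^sup>+z. Wmax f z * indicator Q z \<partial>lborel))"
    by (intro mult_left_mono JQ) simp
  also have "\<dots> = ennreal (1 / (r / real n) ^ n * (K_loc C0 * r ^ n)) * (\<integral>\<^sup>+z. Wmax f z * indicator Q z \<partial>lborel)"
    using q_pos K_loc_nonneg[of C0] r by (subst ennreal_mult) (auto simp: mult.assoc)
  also have "1 / (r / real n) ^ n * (K_loc C0 * r ^ n) = K_loc C0 * real n ^ n"
  proof -
    have "1 / (X / Y) * (K * X) = K * Y" if "X \<noteq> 0" for X Y K :: real
      using that by simp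
    then show ?thesis unfolding power_divide using r by simp
  qed
  also have "ennreal (K_loc C0 * real n ^ n) * (\<integral>\<^sup>+z. Wmax f z * indicator Q z \<partial>lborel)
      \<le> ennreal (K_cells C0) * (\<integral>\<^sup>+z. Wmax f z * indicator Q z \<partial>lborel)"
    using K_osc_nonneg by (intro mult_right_mono ennreal_leI) (auto simp: K_cells_def n_def)
  finally show ?thesis by (simp add: J_def Q_def r_def)
qed

text \<open>The constant depends neither on R nor on L, so the truncation can be removed
  afterwards.\<close>

lemma nn_integral_sq_trunc_powr_le_Wmax:
  fixes f :: "'m \<Rightarrow> real^'n \<Rightarrow> complex"
  assumes f: "\<And>i. f i \<in> borel_measurable borel"
    and fin: "\<And>t x. 0 < t \<Longrightarrow> Decay_prod (N + \<gamma>) t f x < top"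
    and loc_fin: "\<And>i z r. (\<integral>\<^sup>+y\<in>ball z r. pw f i y \<partial>lborel) < top"
    and bd: "\<And>h. (\<And>i. in_Lp (2 / w i) (h i)) \<Longrightarrow>
        Lp_norm 2 (square_function \<theta> h) \<le> ennreal C0 * (\<Prod>i\<in>UNIV. Lp_norm (2 / w i) (\<lambda>x. ennreal (norm (h i x))))"
    and C0: "0 \<le> C0" and R: "0 < R" and s: "1 < s"
    and a_priori: "(\<integral>\<^sup>+x. ennreal_powr (sq_trunc f (R / 2 ^ Suc L) R x) s \<partial>lborel) < top"
  shows "(\<integral>\<^sup>+x. ennreal_powr (sq_trunc f (R / 2 ^ Suc L) R x) s \<partial>lborel)
    \<le> ennreal (absorb_const (K_cells C0) s) * (\<integral>\<^sup>+x. ennreal_powr (Wmax f x) s \<partial>lborel)"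
proof -
  have from_to: "(\<Sum>j=k..L. layer f R j x) = sq_trunc f (R / 2 ^ Suc L) (R / 2 ^ k) x" if "k \<le> L" for k x
    using that by (intro sum_layer f fin R)
  have upto: "(\<Sum>j\<le>k. layer f R j x) = sq_trunc f (R / 2 ^ Suc k) R x" for k x
    using sum_layer[OF f fin R, of 0 k x] by (simp add: atLeast0AtMost)
  have "(\<integral>\<^sup>+x. ennreal_powr (\<Sum>j\<le>L. layer f R j x) s \<partial>lborel)
    \<le> ennreal (absorb_const (K_cells C0) s) * (\<integral>\<^sup>+x. ennreal_powr (Wmax f x) s \<partial>lborel)"
  proof (rule nn_integral_powr_le_of_cells[where cell="cell R"])
    show "cell R k \<in> lborel \<rightarrow>\<^sub>M count_space UNIV" for k
      using measurable_cell by simp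
    show "layer f R k \<in> borel_measurable lborel" for k
      unfolding layer_def using borel_measurable_sq_trunc[OF f fin] R by simp
    show "Wmax f \<in> borel_measurable lborel" using borel_measurable_Wmax by simp
    show "cell R k x = cell R k y" if "cell R (Suc k) x = cell R (Suc k) y" for k and x y :: "real^'n"
      using that by (rule cell_nested)
    show "(\<integral>\<^sup>+x. (\<Sum>j=k..L. layer f R j x) * indicator (cell R k -` {c}) x \<partial>lborel)
        \<le> ennreal (K_cells C0) * (\<integral>\<^sup>+x. Wmax f x * indicator (cell R k -` {c}) x \<partial>lborel)" if "k \<le> L" for k c
      unfolding from_to[OF that]
      using R by (intro cell_square_le f fin loc_fin C0) (auto intro: bd)
    show "(\<Sum>j\<le>k. layer f R j x) \<le> 2 * (\<Sum>j\<le>k. layer f R j y) + ennreal (K_cells C0) * Wmax f x"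
      if "k \<le> L" "cell R k x = cell R k y" for k x y
    proof -
      have "dist x y \<le> R / 2 ^ k" using dist_lt_of_cell_eq[OF R that(2)] by simp
      then have "sq_trunc f (R / 2 ^ k / 2) R x \<le> 2 * sq_trunc f (R / 2 ^ k / 2) R y + ennreal K_osc * Wmax f x"
        using R by (intro sq_trunc_osc f fin) auto
      also have "\<dots> \<le> 2 * sq_trunc f (R / 2 ^ k / 2) R y + ennreal (K_cells C0) * Wmax f x"
        using K_loc_nonneg[of C0] by (intro add_left_mono mult_right_mono ennreal_leI) (auto simp: K_cells_def)
      finally show ?thesis unfolding upto by (simp add: mult.commute)
    qed
  qed (use s K_cells_pos a_priori in \<open>auto simp: upto\<close>)
  then show ?thesis by (simp add: upto)
qed

end

section \<open>Passage to the limit\<close>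

lemma ennreal_powr_SUP_le_SUP:
  assumes "0 < a"
  shows "ennreal_powr (SUP k. A k) a \<le> (SUP k. ennreal_powr (A k) a)"
  using assms by (intro ennreal_powr_SUP_le SUP_upper) auto

lemma ennreal_le_1_plus_powr:
  assumes "1 \<le> s"
  shows "u \<le> 1 + ennreal_powr u s"
proof (cases u)
  case (real x)
  have "x \<le> 1 + x powr s"
  proof (cases "x \<le> 1")
    case False
    then have "x powr 1 \<le> x powr s" using assms by (intro powr_mono) auto
    then show ?thesis using False by simp
  qed (simp add: add_increasing2)
  then show ?thesis
    using real by (simp add: ennreal_powr_ennreal ennreal_plus[symmetric] ennreal_1[symmetric] ennreal_leI
      del: ennreal_plus ennreal_1)
qed simp

lemma indicator_le_of_subset: "A \<subseteq> B \<Longrightarrow> (indicator A x :: ennreal) \<le> indicator B x"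
  by (auto simp: indicator_def)

context weighted_kernel
begin

section \<open>Finiteness of the truncated integrals and the bound for W\<close>

lemma local_integrability:
  fixes f :: "'m \<Rightarrow> real^'n \<Rightarrow> complex"
  assumes f [measurable]: "\<And>i. f i \<in> borel_measurable borel" and s: "1 < s"
    and Lp: "\<And>i. (\<integral>\<^sup>+x. ennreal_powr (pw f i x) s \<partial>lborel) < top"
  shows "(\<integral>\<^sup>+y\<in>ball z r. pw f i y \<partial>lborel) < top"
proof -
  have [measurable]: "ball z r \<in> sets borel" by simp
  have "(\<integral>\<^sup>+y\<in>ball z r. pw f i y \<partial>lborel) \<le> (\<integral>\<^sup>+y. indicator (ball z r) y + ennreal_powr (pw f i y) s \<partial>lborel)"
    using s by (intro nn_integral_mono) (auto simp: indicator_def ennreal_le_1_plus_powr)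
  also have "\<dots> = emeasure lborel (ball z r) + (\<integral>\<^sup>+x. ennreal_powr (pw f i x) s \<partial>lborel)"
    by (subst nn_integral_add) auto
  also have "\<dots> < top"
    using Lp[of i] emeasure_bounded_finite[of "ball z r"] by simp
  finally show ?thesis .
qed

lemma decay_avg_powr_le_decay_avg:
  assumes g [measurable]: "g \<in> borel_measurable borel" and t: "0 < t" and s: "1 < s"
  shows "ennreal_powr (decay_avg (N + \<gamma>) t g x) s
    \<le> ennreal (Cd powr (s - 1)) * decay_avg (N + \<gamma>) t (\<lambda>y. ennreal_powr (g y) s) (x :: real^'n)"
proof -
  have w: "0 < 1 / s" "1 / s < 1" using s by auto
  have "decay_avg (N + \<gamma>) t g x = decay_avg (N + \<gamma>) t (\<lambda>y. ennreal_powr (ennreal_powr (g y) s) (1 / s)) x"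
    using s by (simp add: ennreal_powr_powr)
  also have "\<dots> \<le> ennreal (Cd powr (1 - 1 / s)) * ennreal_powr (decay_avg (N + \<gamma>) t (\<lambda>y. ennreal_powr (g y) s) x) (1 / s)"
    unfolding Cd_def by (rule decay_avg_powr_le[OF _ t exponent w]) measurable
  finally have "ennreal_powr (decay_avg (N + \<gamma>) t g x) s
      \<le> ennreal_powr (ennreal (Cd powr (1 - 1 / s)) * ennreal_powr (decay_avg (N + \<gamma>) t (\<lambda>y. ennreal_powr (g y) s) x) (1 / s)) s"
    using s by (intro ennreal_powr_mono) auto
  also have "\<dots> = ennreal (Cd powr (s - 1)) * decay_avg (N + \<gamma>) t (\<lambda>y. ennreal_powr (g y) s) x"
    using s by (simp add: ennreal_powr_mult ennreal_powr_powr ennreal_powr_ennreal powr_powr left_diff_distrib)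
  finally show ?thesis .
qed

text \<open>All scales of the truncated range are compared with the single scale R. The constant
  grows with \<open>R / \<alpha>\<close>, which is harmless because the bound only serves to
  establish finiteness.\<close>

lemma sq_trunc_le_Decay_prod:
  fixes f :: "'m \<Rightarrow> real^'n \<Rightarrow> complex"
  assumes f [measurable]: "\<And>i. f i \<in> borel_measurable borel" and R: "0 < \<alpha>" "\<alpha> \<le> R"
  shows "\<exists>c\<ge>0. \<forall>x. sq_trunc f \<alpha> R x \<le> ennreal c * (Decay_prod (N + \<gamma>) R f x)\<^sup>2"
proof -
  define \<kappa> where "\<kappa> = ((R / \<alpha>) ^ DIM(real^'n)) ^ CARD('m)"
  have \<kappa>: "0 \<le> \<kappa>" using R by (simp add: \<kappa>_def)
  define c where "c = 1 / \<alpha> * (A * \<kappa>)\<^sup>2"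
  have c: "0 \<le> c" using R by (simp add: c_def)
  have "sq_trunc f \<alpha> R x \<le> ennreal (c * (R - \<alpha>)) * (Decay_prod (N + \<gamma>) R f x)\<^sup>2" for x
  proof -
    let ?P = "Decay_prod (N + \<gamma>) R f x"
    have "sq_trunc f \<alpha> R x \<le> (\<integral>\<^sup>+t. (ennreal c * ?P\<^sup>2) * indicator {\<alpha>..<R} t \<partial>lebesgue)"
      unfolding sq_trunc_def
    proof (rule nn_integral_mono)
      fix t :: real
      show "ennreal ((norm (Theta \<theta> t f x))\<^sup>2 / t) * indicator {\<alpha>..<R} t \<le> (ennreal c * ?P\<^sup>2) * indicator {\<alpha>..<R} t"
      proof (cases "t \<in> {\<alpha>..<R}")
        case True
        then have t: "0 < t" "t \<le> R" "\<alpha> \<le> t" using R by auto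
        have "Decay_prod (N + \<gamma>) t f x
            \<le> (\<Prod>i\<in>(UNIV::'m set). ennreal ((R / \<alpha>) ^ DIM(real^'n)) * decay_avg (N + \<gamma>) R (\<lambda>y. ennreal (norm (f i y))) x)"
          unfolding Decay_prod_def
        proof (rule prod_mono_ennreal)
          fix i
          have "decay_avg (N + \<gamma>) t (\<lambda>y. ennreal (norm (f i y))) x
              \<le> ennreal ((R / t) ^ DIM(real^'n)) * decay_avg (N + \<gamma>) R (\<lambda>y. ennreal (norm (f i y))) x"
            using t by (intro decay_avg_le_rescale N) auto
          also have "\<dots> \<le> ennreal ((R / \<alpha>) ^ DIM(real^'n)) * decay_avg (N + \<gamma>) R (\<lambda>y. ennreal (norm (f i y))) x"
            using t R by (intro mult_right_mono ennreal_leI power_mono divide_left_mono) auto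
          finally show "decay_avg (N + \<gamma>) t (\<lambda>y. ennreal (norm (f i y))) x \<le> \<dots>" .
        qed
        also have "\<dots> = ennreal \<kappa> * ?P"
          using R by (simp add: prod.distrib Decay_prod_def \<kappa>_def ennreal_power)
        finally have "ennreal A * Decay_prod (N + \<gamma>) t f x \<le> ennreal A * (ennreal \<kappa> * ?P)"
          by (rule mult_left_mono) simp
        with norm_Theta_le[where f=f and x=x, OF f t(1)]
        have "ennreal (norm (Theta \<theta> t f x)) \<le> ennreal (A * \<kappa>) * ?P"
          using A \<kappa> by (simp add: ennreal_mult mult.assoc)
        from power_mono_ennreal[OF this, of 2]
        have "ennreal ((norm (Theta \<theta> t f x))\<^sup>2) \<le> ennreal ((A * \<kappa>)\<^sup>2) * ?P\<^sup>2"
          using A \<kappa> by (simp add: power_mult_distrib ennreal_power ennreal_mult)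
        then have "ennreal (1 / \<alpha>) * ennreal ((norm (Theta \<theta> t f x))\<^sup>2) \<le> ennreal (1 / \<alpha>) * (ennreal ((A * \<kappa>)\<^sup>2) * ?P\<^sup>2)"
          by (rule mult_left_mono) simp
        also have "\<dots> = ennreal c * ?P\<^sup>2"
          using R unfolding c_def by (subst ennreal_mult) (auto simp: mult.assoc)
        finally have le: "ennreal (1 / \<alpha>) * ennreal ((norm (Theta \<theta> t f x))\<^sup>2) \<le> ennreal c * ?P\<^sup>2" .
        have "(norm (Theta \<theta> t f x))\<^sup>2 / t \<le> 1 / \<alpha> * (norm (Theta \<theta> t f x))\<^sup>2"
          using t R by (simp add: frac_le)
        then have "ennreal ((norm (Theta \<theta> t f x))\<^sup>2 / t) \<le> ennreal (1 / \<alpha>) * ennreal ((norm (Theta \<theta> t f x))\<^sup>2)"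
          using R by (subst ennreal_mult[symmetric]) (auto intro: ennreal_leI)
        from order_trans[OF this le] show ?thesis using True by simp
      qed simp
    qed
    also have "\<dots> = (ennreal c * ?P\<^sup>2) * ennreal (R - \<alpha>)"
      using R by (subst nn_integral_cmult_indicator) auto
    also have "\<dots> = ennreal (c * (R - \<alpha>)) * ?P\<^sup>2"
      using R c by (simp add: ennreal_mult mult_ac)
    finally show ?thesis .
  qed
  then show ?thesis using R c by (intro exI[of _ "c * (R - \<alpha>)"]) auto
qed

text \<open>At the single scale R, averages are bounded on integrable functions, so no maximal
  function is involved: Jensen's inequality moves the power s inside the averages, and Hoelder's
  inequality separates the factors.\<close>

lemma sq_trunc_a_priori:
  fixes f :: "'m \<Rightarrow> real^'n \<Rightarrow> complex"
  assumes f [measurable]: "\<And>i. f i \<in> borel_measurable borel" and R: "0 < \<alpha>" "\<alpha> \<le> R" and s: "1 < s"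
    and Lp: "\<And>i. (\<integral>\<^sup>+x. ennreal_powr (pw f i x) s \<partial>lborel) < top"
  shows "(\<integral>\<^sup>+x. ennreal_powr (sq_trunc f \<alpha> R x) s \<partial>lborel) < top"
proof -
  have R0: "0 < R" using R by linarith
  obtain c where c: "0 \<le> c" "\<And>x. sq_trunc f \<alpha> R x \<le> ennreal c * (Decay_prod (N + \<gamma>) R f x)\<^sup>2"
    using sq_trunc_le_Decay_prod[where f=f, OF f R] by blast
  define k where "k = Cd powr (s - 1)"
  have k: "0 < k" using Cd_pos by (simp add: k_def)
  let ?v = "\<lambda>i. decay_avg (N + \<gamma>) R (\<lambda>y. ennreal_powr (pw f i y) s)"
  have "ennreal_powr (sq_trunc f \<alpha> R x) s
      \<le> ennreal ((c * Ch) powr s * k) * (\<Prod>i\<in>UNIV. ennreal_powr (?v i x) (w i))" for x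
  proof -
    let ?u = "\<lambda>i. decay_avg (N + \<gamma>) R (pw f i) x"
    have "sq_trunc f \<alpha> R x \<le> ennreal c * (ennreal Ch * (\<Prod>i\<in>UNIV. ennreal_powr (?u i) (w i)))"
      by (rule order_trans[OF c(2)]) (intro mult_left_mono Decay_prod_square_le f R0, simp)
    also have "\<dots> = ennreal (c * Ch) * (\<Prod>i\<in>UNIV. ennreal_powr (?u i) (w i))"
      using c Ch_pos by (simp add: ennreal_mult mult.assoc)
    finally have "ennreal_powr (sq_trunc f \<alpha> R x) s
        \<le> ennreal_powr (ennreal (c * Ch) * (\<Prod>i\<in>UNIV. ennreal_powr (?u i) (w i))) s"
      using s by (intro ennreal_powr_mono) auto
    also have "\<dots> = ennreal ((c * Ch) powr s) * (\<Prod>i\<in>UNIV. ennreal_powr (ennreal_powr (?u i) s) (w i))"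
      using c Ch_pos by (simp add: ennreal_powr_mult ennreal_powr_prod ennreal_powr_ennreal ennreal_powr_powr mult.commute)
    also have "\<dots> \<le> ennreal ((c * Ch) powr s) * (\<Prod>i\<in>UNIV. ennreal_powr (ennreal k * ?v i x) (w i))"
      unfolding k_def using w_pos s R0
      by (intro mult_left_mono prod_mono_ennreal ennreal_powr_mono decay_avg_powr_le_decay_avg) (auto simp: less_imp_le)
    also have "\<dots> = ennreal ((c * Ch) powr s) * (ennreal k * (\<Prod>i\<in>UNIV. ennreal_powr (?v i x) (w i)))"
      using k by (simp add: prod_powr_cmult prod_powr_const less_imp_le)
    also have "\<dots> = ennreal ((c * Ch) powr s * k) * (\<Prod>i\<in>UNIV. ennreal_powr (?v i x) (w i))"
      using k by (simp add: ennreal_mult mult.assoc)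
    finally show ?thesis .
  qed
  then have "(\<integral>\<^sup>+x. ennreal_powr (sq_trunc f \<alpha> R x) s \<partial>lborel)
      \<le> (\<integral>\<^sup>+x. ennreal ((c * Ch) powr s * k) * (\<Prod>i\<in>UNIV. ennreal_powr (?v i x) (w i)) \<partial>lborel)"
    by (rule nn_integral_mono)
  also have "\<dots> = ennreal ((c * Ch) powr s * k) * (\<integral>\<^sup>+x. (\<Prod>i\<in>UNIV. ennreal_powr (?v i x) (w i)) \<partial>lborel)"
    by (rule nn_integral_cmult) measurable
  also have "\<dots> \<le> ennreal ((c * Ch) powr s * k) * (\<Prod>i\<in>UNIV. ennreal_powr (\<integral>\<^sup>+x. ?v i x \<partial>lborel) (w i))"
    using w_pos w_sum by (intro mult_left_mono nn_integral_prod_powr_le) auto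
  also have "\<dots> < top"
  proof -
    have "(\<integral>\<^sup>+x. ?v i x \<partial>lborel) < top" for i
    proof -
      have "(\<integral>\<^sup>+x. ?v i x \<partial>lborel) \<le> ennreal Cd * (\<integral>\<^sup>+x. ennreal_powr (pw f i x) s \<partial>lborel)"
        unfolding Cd_def by (intro nn_integral_decay_avg_le R0 exponent) measurable
      also have "\<dots> < top" using Lp[of i] by (simp add: ennreal_mult_less_top)
      finally show ?thesis .
    qed
    then have "(\<Prod>i\<in>UNIV. ennreal_powr (\<integral>\<^sup>+x. ?v i x \<partial>lborel) (w i)) \<noteq> top"
      by (auto simp: ennreal_prod_eq_top less_top[symmetric])
    then show ?thesis by (simp add: ennreal_mult_less_top less_top)
  qed
  finally show ?thesis .
qed

definition hl_const :: "real \<Rightarrow> real" where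
  "hl_const s = s * (2 * 5 ^ DIM(real^'n)) * (1 / (s - 1)) * 2 powr (s - 1)"

text \<open>Hoelder's inequality with the weights w reduces the product to one function at a time,
  and s > 1 is what the maximal theorem asks for.\<close>

lemma nn_integral_Wmax_powr_le:
  fixes f :: "'m \<Rightarrow> real^'n \<Rightarrow> complex"
  assumes f [measurable]: "\<And>i. f i \<in> borel_measurable borel" and s: "1 < s"
  shows "(\<integral>\<^sup>+x. ennreal_powr (Wmax f x) s \<partial>lborel)
    \<le> ennreal (hl_const s) * (\<Prod>i\<in>UNIV. ennreal_powr (\<integral>\<^sup>+x. ennreal_powr (pw f i x) s \<partial>lborel) (w i))"
proof -
  have pos: "0 < hl_const s" using s by (simp add: hl_const_def)
  have "(\<integral>\<^sup>+x. ennreal_powr (Wmax f x) s \<partial>lborel)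
      = (\<integral>\<^sup>+x. (\<Prod>i\<in>UNIV. ennreal_powr (ennreal_powr (hl_maximal (pw f i) x) s) (w i)) \<partial>lborel)"
    by (simp add: Wmax_def ennreal_powr_prod ennreal_powr_powr mult.commute)
  also have "\<dots> \<le> (\<Prod>i\<in>UNIV. ennreal_powr (\<integral>\<^sup>+x. ennreal_powr (hl_maximal (pw f i) x) s \<partial>lborel) (w i))"
    using w_pos w_sum by (intro nn_integral_prod_powr_le) auto
  also have "\<dots> \<le> (\<Prod>i\<in>UNIV. ennreal_powr (ennreal (hl_const s) * (\<integral>\<^sup>+x. ennreal_powr (pw f i x) s \<partial>lborel)) (w i))"
    unfolding hl_const_def using w_pos s
    by (intro prod_mono_ennreal ennreal_powr_mono hl_maximal_strong_type) (auto simp: less_imp_le)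
  also have "\<dots> = ennreal (hl_const s) * (\<Prod>i\<in>UNIV. ennreal_powr (\<integral>\<^sup>+x. ennreal_powr (pw f i x) s \<partial>lborel) (w i))"
    using pos by (simp add: prod_powr_cmult prod_powr_const less_imp_le)
  finally show ?thesis .
qed

section \<open>Exhausting all scales\<close>

definition sq_full :: "('m \<Rightarrow> real^'n \<Rightarrow> complex) \<Rightarrow> real^'n \<Rightarrow> ennreal" where
  "sq_full f x = (\<integral>\<^sup>+t\<in>{0<..}. ennreal ((norm (Theta \<theta> t f x))\<^sup>2 / t) \<partial>lebesgue)"

text \<open>The shape \<open>R / 2 ^ Suc L\<close> of the cell estimate with
  \<open>R = 2 ^ k\<close> and \<open>L = 2 * k\<close>. The range from \<open>1 / 2 ^ Suc k\<close>
  to \<open>2 ^ k\<close> exhausts all positive scales from both ends.\<close>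

definition sq_seq :: "('m \<Rightarrow> real^'n \<Rightarrow> complex) \<Rightarrow> nat \<Rightarrow> real^'n \<Rightarrow> ennreal" where
  "sq_seq f k = sq_trunc f (2 ^ k / 2 ^ Suc (2 * k)) (2 ^ k)"

lemma sq_seq_bounds: "(2::real) ^ k / 2 ^ Suc (2 * k) = 1 / 2 ^ Suc k"
proof -
  have "Suc (2 * k) = k + Suc k" by simp
  then have "(2::real) ^ k / 2 ^ Suc (2 * k) = 2 ^ k / (2 ^ k * 2 ^ Suc k)"
    by (simp only: power_add)
  also have "\<dots> = 1 / 2 ^ Suc k" by simp
  finally show ?thesis .
qed

lemma sq_full_eq_SUP:
  fixes f :: "'m \<Rightarrow> real^'n \<Rightarrow> complex"
  assumes f: "\<And>i. f i \<in> borel_measurable borel"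
    and fin: "\<And>t x. 0 < t \<Longrightarrow> Decay_prod (N + \<gamma>) t f x < top"
  shows "sq_full f x = (SUP k. sq_seq f k x)" and "incseq (sq_seq f)"
proof -
  let ?T = "\<lambda>t. if 0 < t then Theta \<theta> t f x else 0"
  define I where "I k = {1 / 2 ^ Suc k..<(2::real) ^ k}" for k :: nat
  have I_sets: "I k \<in> sets lebesgue" for k by (simp add: I_def)
  note [measurable] = borel_measurable_ident_lebesgue
  have [measurable]: "?T \<in> borel_measurable lebesgue"
    by (rule borel_measurable_Theta_time[where f=f, OF f fin])
  have meas: "(\<lambda>t. ennreal ((norm (?T t))\<^sup>2 / t)) \<in> borel_measurable lebesgue"
    by measurable
  have I_mono: "I k \<subseteq> I l" if "k \<le> l" for k l
  proof -
    have "(1::real) / 2 ^ Suc l \<le> 1 / 2 ^ Suc k" "(2::real) ^ k \<le> 2 ^ l"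
      using that by (intro divide_left_mono power_increasing; simp)+
    then show ?thesis
      unfolding I_def subset_iff atLeastLessThan_iff by (meson order_trans order_less_le_trans)
  qed
  have I_pos: "0 < t" if "t \<in> I k" for t k
  proof -
    have "0 < (1::real) / 2 ^ Suc k" by simp
    also have "\<dots> \<le> t" using that by (simp only: I_def atLeastLessThan_iff)
    finally show ?thesis .
  qed
  have I_UN: "\<exists>k. t \<in> I k" if "0 < t" for t
  proof -
    obtain k where k: "t < 2 ^ k" using real_arch_pow[of 2 t] by auto
    obtain l where l: "1 / t < 2 ^ l" using real_arch_pow[of 2 "1 / t"] by auto
    define m where "m = max k l"
    have "(2::real) ^ k \<le> 2 ^ m" "(2::real) ^ l \<le> 2 ^ Suc m"
      by (rule power_increasing; simp add: m_def)+
    with k l have "t < 2 ^ m" and X: "1 / t \<le> 2 ^ Suc m" by linarith+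
    have "1 \<le> 2 ^ Suc m * t" using X that by (simp only: pos_divide_le_eq)
    then have "1 / 2 ^ Suc m \<le> t" by (simp only: pos_divide_le_eq zero_less_power zero_less_numeral mult.commute)
    with \<open>t < 2 ^ m\<close> have "t \<in> I m" by (simp only: I_def atLeastLessThan_iff simp_thms)
    then show ?thesis by blast
  qed
  show "incseq (sq_seq f)"
  proof (rule monoI, rule le_funI)
    fix k l :: nat and x assume "k \<le> l"
    then show "sq_seq f k x \<le> sq_seq f l x"
      unfolding sq_seq_def sq_seq_bounds sq_trunc_def I_def[symmetric]
      by (intro nn_integral_mono mult_left_mono indicator_le_of_subset I_mono) simp_all
  qed
  have "sq_full f x = (\<integral>\<^sup>+t. (SUP k. ennreal ((norm (?T t))\<^sup>2 / t) * indicator (I k) t) \<partial>lebesgue)"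
    unfolding sq_full_def
  proof (rule nn_integral_cong)
    fix t :: real
    show "ennreal ((norm (Theta \<theta> t f x))\<^sup>2 / t) * indicator {0<..} t
        = (SUP k. ennreal ((norm (?T t))\<^sup>2 / t) * indicator (I k) t)"
    proof (cases "0 < t")
      case True
      obtain k where k: "t \<in> I k" using I_UN[OF True] by blast
      have "(SUP k. ennreal ((norm (?T t))\<^sup>2 / t) * indicator (I k) t) = ennreal ((norm (?T t))\<^sup>2 / t)"
      proof (rule antisym)
        show "(SUP k. ennreal ((norm (?T t))\<^sup>2 / t) * indicator (I k) t) \<le> ennreal ((norm (?T t))\<^sup>2 / t)"
          by (intro SUP_least) (simp add: indicator_def)
        show "ennreal ((norm (?T t))\<^sup>2 / t) \<le> (SUP k. ennreal ((norm (?T t))\<^sup>2 / t) * indicator (I k) t)"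
          using k by (intro SUP_upper2[of k]) auto
      qed
      then show ?thesis using True by simp
    next
      case False
      then have "t \<notin> I k" for k using I_pos by blast
      then show ?thesis using False by simp
    qed
  qed
  also have "\<dots> = (SUP k. \<integral>\<^sup>+t. ennreal ((norm (?T t))\<^sup>2 / t) * indicator (I k) t \<partial>lebesgue)"
  proof (rule nn_integral_monotone_convergence_SUP)
    show "incseq (\<lambda>k t. ennreal ((norm (?T t))\<^sup>2 / t) * indicator (I k) t)"
    proof (rule monoI, rule le_funI)
      fix k l :: nat and t assume "k \<le> l"
      then show "ennreal ((norm (?T t))\<^sup>2 / t) * indicator (I k) t \<le> ennreal ((norm (?T t))\<^sup>2 / t) * indicator (I l) t"
        by (intro mult_left_mono indicator_le_of_subset I_mono) simp_all
    qed
  qed (intro borel_measurable_times_ennreal meas borel_measurable_indicator I_sets)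
  also have "(\<lambda>k. \<integral>\<^sup>+t. ennreal ((norm (?T t))\<^sup>2 / t) * indicator (I k) t \<partial>lebesgue) = (\<lambda>k. sq_seq f k x)"
  proof
    fix k
    show "(\<integral>\<^sup>+t. ennreal ((norm (?T t))\<^sup>2 / t) * indicator (I k) t \<partial>lebesgue) = sq_seq f k x"
      unfolding sq_seq_def sq_seq_bounds sq_trunc_def I_def[symmetric]
    proof (rule nn_integral_cong)
      fix t :: real
      show "ennreal ((norm (?T t))\<^sup>2 / t) * indicator (I k) t
          = ennreal ((norm (Theta \<theta> t f x))\<^sup>2 / t) * indicator (I k) t"
      proof (cases "t \<in> I k")
        case True
        then show ?thesis using I_pos by simp
      qed simp
    qed
  qed
  finally show "sq_full f x = (SUP k. sq_seq f k x)" .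
qed

lemma nn_integral_sq_full_powr_le:
  fixes f :: "'m \<Rightarrow> real^'n \<Rightarrow> complex"
  assumes f [measurable]: "\<And>i. f i \<in> borel_measurable borel" and s: "1 < s"
    and Lp: "\<And>i. (\<integral>\<^sup>+x. ennreal_powr (pw f i x) s \<partial>lborel) < top"
    and bd: "\<And>h. (\<And>i. in_Lp (2 / w i) (h i)) \<Longrightarrow>
        Lp_norm 2 (square_function \<theta> h) \<le> ennreal C0 * (\<Prod>i\<in>UNIV. Lp_norm (2 / w i) (\<lambda>x. ennreal (norm (h i x))))"
    and C0: "0 \<le> C0"
  shows "sq_full f \<in> borel_measurable borel"
    and "(\<integral>\<^sup>+x. ennreal_powr (sq_full f x) s \<partial>lborel)
      \<le> ennreal (absorb_const (K_cells C0) s) * (ennreal (hl_const s) *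
        (\<Prod>i\<in>UNIV. ennreal_powr (\<integral>\<^sup>+x. ennreal_powr (pw f i x) s \<partial>lborel) (w i)))"
proof -
  have exps: "1 < 2 / w i * s" for i
  proof -
    have "1 < 2 / w i" using w_pos[of i] w_le_1[of i] by simp
    then have "1 * 1 < 2 / w i * s" using s w_pos[of i] by (intro mult_strict_mono) auto
    then show ?thesis by simp
  qed
  have fin: "Decay_prod (N + \<gamma>) t f x < top" if "0 < t" for t x
  proof (rule Decay_prod_finite[OF f exps _ that])
    show "(\<integral>\<^sup>+x. ennreal_powr (ennreal (norm (f i x))) (2 / w i * s) \<partial>lborel) < top" for i
      using Lp[of i] by (simp add: pw_def ennreal_powr_powr)
  qed
  have seq_meas [measurable]: "sq_seq f k \<in> borel_measurable borel" for k
    unfolding sq_seq_def by (intro borel_measurable_sq_trunc f fin) auto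
  have inc: "incseq (sq_seq f)"
    by (rule sq_full_eq_SUP(2)[where f=f, OF f fin])
  have full: "sq_full f = (\<lambda>x. SUP k. sq_seq f k x)"
    using sq_full_eq_SUP(1)[where f=f, OF f fin] by blast
  show "sq_full f \<in> borel_measurable borel"
    unfolding full by measurable
  let ?B = "ennreal (absorb_const (K_cells C0) s) * (\<integral>\<^sup>+x. ennreal_powr (Wmax f x) s \<partial>lborel)"
  have seq: "(\<integral>\<^sup>+x. ennreal_powr (sq_seq f k x) s \<partial>lborel) \<le> ?B" for k
    unfolding sq_seq_def
  proof (rule nn_integral_sq_trunc_powr_le_Wmax[OF f fin _ bd C0 _ s])
    show "(\<integral>\<^sup>+y\<in>ball z r. pw f i y \<partial>lborel) < top" for i z r
      by (rule local_integrability[OF f s Lp])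
    show "(\<integral>\<^sup>+x. ennreal_powr (sq_trunc f (2 ^ k / 2 ^ Suc (2 * k)) (2 ^ k) x) s \<partial>lborel) < top"
    proof (rule sq_trunc_a_priori[OF f _ _ s Lp])
      have "(1::real) \<le> 2 ^ Suc k" by (rule one_le_power) simp
      then have "(2::real) ^ k / 2 ^ Suc (2 * k) \<le> 1"
        unfolding sq_seq_bounds by (simp del: power_Suc)
      then show "(2::real) ^ k / 2 ^ Suc (2 * k) \<le> 2 ^ k" by (rule order_trans) simp
    qed simp
  qed auto
  have "(\<integral>\<^sup>+x. ennreal_powr (sq_full f x) s \<partial>lborel) \<le> (\<integral>\<^sup>+x. (SUP k. ennreal_powr (sq_seq f k x) s) \<partial>lborel)"
    unfolding full using s by (intro nn_integral_mono ennreal_powr_SUP_le_SUP) auto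
  also have "\<dots> = (SUP k. \<integral>\<^sup>+x. ennreal_powr (sq_seq f k x) s \<partial>lborel)"
  proof (rule nn_integral_monotone_convergence_SUP)
    show "incseq (\<lambda>k x. ennreal_powr (sq_seq f k x) s)"
    proof (rule monoI, rule le_funI)
      fix k l :: nat and x assume "k \<le> l"
      then have "sq_seq f k x \<le> sq_seq f l x"
        by (rule le_funD[OF monoD[OF inc]])
      then show "ennreal_powr (sq_seq f k x) s \<le> ennreal_powr (sq_seq f l x) s"
        using s by (intro ennreal_powr_mono) auto
    qed
  qed measurable
  also have "\<dots> \<le> ?B" by (intro SUP_least seq)
  also have "\<dots> \<le> ennreal (absorb_const (K_cells C0) s) * (ennreal (hl_const s) *
        (\<Prod>i\<in>UNIV. ennreal_powr (\<integral>\<^sup>+x. ennreal_powr (pw f i x) s \<partial>lborel) (w i)))"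
    by (intro mult_left_mono nn_integral_Wmax_powr_le f s) auto
  finally show "(\<integral>\<^sup>+x. ennreal_powr (sq_full f x) s \<partial>lborel) \<le> \<dots>" .
qed

end

section \<open>Choice of exponents and the final bound\<close>

theorem corollary4p2:
  fixes \<theta> :: "real \<Rightarrow> real^'n \<Rightarrow> real^'n^'m \<Rightarrow> complex"
    and N \<gamma> A :: real
  assumes "N > real CARD('n)" and "0 < \<gamma>" and "\<gamma> \<le> 1" and "A > 0"
    and "square_function_kernel N \<gamma> A \<theta>"
    and "\<And>ps :: 'm \<Rightarrow> real. (\<forall>i. 1 < ps i) \<Longrightarrow> 1/2 = (\<Sum>i\<in>UNIV. 1 / ps i)
           \<Longrightarrow> square_function_bounded \<theta> ps 2"
  shows "\<forall>(p::real) (ps :: 'm \<Rightarrow> real). 2 \<le> p \<longrightarrow> (\<forall>i. 1 < ps i) \<longrightarrow> 1/p = (\<Sum>i\<in>UNIV. 1 / ps i)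
           \<longrightarrow> square_function_bounded \<theta> ps p"
proof (intro allI impI)
  fix p :: real and ps :: "'m \<Rightarrow> real"
  assume p: "2 \<le> p" and ps: "\<forall>i. 1 < ps i" and sum: "1 / p = (\<Sum>i\<in>UNIV. 1 / ps i)"
  show "square_function_bounded \<theta> ps p"
  proof (cases "p = 2")
    case True
    then show ?thesis using assms(6)[OF ps] sum by simp
  next
    case False
    define s where "s = p / 2"
    have s: "1 < s" using p False by (simp add: s_def)
    define w where "w i = p / ps i" for i
    have w_pos: "0 < w i" for i using p ps[rule_format, of i] by (simp add: w_def)
    have w_sum: "sum w UNIV = 1"
    proof -
      have "sum w UNIV = p * (\<Sum>i\<in>UNIV. 1 / ps i)" by (simp add: w_def sum_distrib_left)
      then show ?thesis using p by (simp add: sum[symmetric])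
    qed
    interpret weighted_kernel \<theta> N \<gamma> A w
      by unfold_locales (use assms w_pos w_sum in auto)
    have "1 < 2 / w i" for i using w_pos[of i] w_le_1[of i] by simp
    then have "\<forall>i. 1 < 2 / w i" by blast
    moreover have "1 / 2 = (\<Sum>i\<in>UNIV. 1 / (2 / w i))"
      using w_sum by (simp add: sum_divide_distrib[symmetric])
    \<comment> \<open>Since each w i is at most 1, the exponents \<open>2 / w i\<close> are at least
      2, and their reciprocals sum to 1/2.\<close>
    ultimately have "square_function_bounded \<theta> (\<lambda>i. 2 / w i) 2" by (rule assms(6))
    then obtain C0 where C0: "0 \<le> C0" and bd: "\<And>h. (\<And>i. in_Lp (2 / w i) (h i)) \<Longrightarrow>
        Lp_norm 2 (square_function \<theta> h) \<le> ennreal C0 * (\<Prod>i\<in>UNIV. Lp_norm (2 / w i) (\<lambda>x. ennreal (norm (h i x))))"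
      unfolding square_function_bounded_def by blast
    \<comment> \<open>Taking maxima with 0 leaves the extended reals unchanged and makes the product
      law of \<open>ennreal\<close> available whatever the signs of the constants.\<close>
    define K where "K = max 0 (absorb_const (K_cells C0) s) * max 0 (hl_const s)"
    have "square_function \<theta> f \<in> borel_measurable lebesgue \<and>
        Lp_norm p (square_function \<theta> f) \<le> ennreal (K powr (1 / p)) * (\<Prod>i\<in>UNIV. Lp_norm (ps i) (\<lambda>x. ennreal (norm (f i x))))"
      if f: "\<forall>i. in_Lp (ps i) (f i)" for f
    proof -
      have ps0: "0 < ps i" for i using ps[rule_format, of i] by linarith
      have "f i \<in> borel_measurable lebesgue" for i using f by (simp add: in_Lp_def)
      then obtain g where g: "\<And>i. g i \<in> borel_measurable borel" "square_function \<theta> f = square_function \<theta> g"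
        "\<And>i p. Lp_norm p (\<lambda>x. ennreal (norm (f i x))) = Lp_norm p (\<lambda>x. ennreal (norm (g i x)))"
        using borel_representative by metis
      have pw_g: "(\<integral>\<^sup>+x. ennreal_powr (pw g i x) s \<partial>lborel)
          = ennreal_powr (Lp_norm (ps i) (\<lambda>x. ennreal (norm (f i x)))) (ps i)" for i
      proof -
        have "2 / w i * s = ps i" using p ps0[of i] by (simp add: w_def s_def)
        then show ?thesis
          unfolding g(3) Lp_norm_powr[OF ps0] by (simp add: pw_def ennreal_powr_powr)
      qed
      have Lp: "(\<integral>\<^sup>+x. ennreal_powr (pw g i x) s \<partial>lborel) < top" for i
        using f by (simp add: pw_g in_Lp_def)
      have sq: "square_function \<theta> f = (\<lambda>x. ennreal_powr (sq_full g x) (1 / 2))"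
        unfolding g(2) by (simp add: fun_eq_iff square_function_def sq_full_def)
      note main = nn_integral_sq_full_powr_le[where f=g, OF g(1) s Lp bd C0]
      have "square_function \<theta> f \<in> borel_measurable borel"
        unfolding sq using main(1) by measurable
      then have meas: "square_function \<theta> f \<in> borel_measurable lebesgue"
        by (simp add: measurable_completion)
      have "Lp_norm p (square_function \<theta> f) = ennreal_powr (\<integral>\<^sup>+x. ennreal_powr (sq_full g x) s \<partial>lborel) (1 / p)"
        using p by (simp add: Lp_norm_eq sq ennreal_powr_powr s_def)
      also have "\<dots> \<le> ennreal_powr (ennreal K * (\<Prod>i\<in>UNIV. ennreal_powr (\<integral>\<^sup>+x. ennreal_powr (pw g i x) s \<partial>lborel) (w i))) (1 / p)"
      proof (intro ennreal_powr_mono)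
        have "ennreal K = ennreal (absorb_const (K_cells C0) s) * ennreal (hl_const s)"
          by (simp add: K_def ennreal_mult ennreal_max_0)
        then show "(\<integral>\<^sup>+x. ennreal_powr (sq_full g x) s \<partial>lborel)
            \<le> ennreal K * (\<Prod>i\<in>UNIV. ennreal_powr (\<integral>\<^sup>+x. ennreal_powr (pw g i x) s \<partial>lborel) (w i))"
          using main(2) by (simp add: mult.assoc)
      qed (use p in simp)
      also have "\<dots> = ennreal (K powr (1 / p)) * (\<Prod>i\<in>UNIV. Lp_norm (ps i) (\<lambda>x. ennreal (norm (f i x))))"
      proof -
        \<comment> \<open>The three exponents on each norm cancel: \<open>ps i\<close> from the s-th
          power integral, \<open>w i\<close> from Hoelder's inequality, \<open>1 / p\<close> from
          the outer norm.\<close>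
        have "ps i * (w i * (1 / p)) = 1" for i using p ps0[of i] by (simp add: w_def)
        moreover have "0 \<le> K" by (simp add: K_def)
        ultimately show ?thesis
          by (simp add: ennreal_powr_mult ennreal_powr_ennreal ennreal_powr_prod ennreal_powr_powr pw_g mult.assoc)
      qed
      finally show ?thesis using meas by simp
    qed
    then show ?thesis
      unfolding square_function_bounded_def by (intro exI[of _ "K powr (1 / p)"]) auto
  qed
qed

end
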